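(* Let $G$ be a planar graph of order $n$ and $v$ a central vertex of $G$. (a) If $G$ is a triangulation, then $\pi(G) \leq \frac{n+19}{12} + \frac{25}{3(n-1)}$. (b) If $G$ is a $4$-connected triangulation, then $\pi(G) \leq \frac{n+35}{16} + \frac{91}{4(n-1)}$. (c) If $G$ is a $5$-connected triangulation, then $\pi(G) \leq \frac{n+57}{20} + \frac{393}{10(n-1)}$. (d) If $G$ is a quadrangulation, then $\pi(G) \leq \frac{n+11}{8} + \frac{9}{2(n-1)}$. (e) If $G$ is a $3$-connected quadrangulation, then $\pi(G) \leq \frac{n+25}{12} + \frac{169}{12(n-1)}$.
   Context: All graphs are simple. A triangulation is a maximal planar graph (a simple planar graph to which no edge can be added while preserving planarity). A quadrangulation is a maximal bipartite planar graph (equivalently, a simple plane bipartite graph in which every face is bounded by a cycle of length $4$). A graph is $k$-connected if deleting fewer than $k$ vertices always leaves a connected graph. For a connected graph $G$ of order $n$ and a vertex $u$, $\sigma(u)=\sum_{x\in V(G)} d_G(u,x)$ is the total distance of $u$ and $\overline{\sigma}(u)=\sigma(u)/(n-1)$ its average distance; the proximity of $G$ is $\pi(G)=\min_{u\in V(G)}\overline{\sigma}(u)$. A central vertex is a vertex of minimum eccentricity, where the eccentricity of $u$ is $\max_{x\in V(G)} d_G(u,x)$. *)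

theory Defs
  imports "HOL-Analysis.Analysis"
begin

definition simple_graph :: "'a set \<Rightarrow> 'a set set \<Rightarrow> bool" where
  "simple_graph V E \<longleftrightarrow> finite V \<and>
     (\<forall>e\<in>E. \<exists>u w. e = {u, w} \<and> u \<noteq> w \<and> u \<in> V \<and> w \<in> V)"

definition planar :: "'a set \<Rightarrow> 'a set set \<Rightarrow> bool" where
  "planar V E \<longleftrightarrow> simple_graph V E \<and>
     (\<exists>(p :: 'a \<Rightarrow> complex) (\<gamma> :: 'a set \<Rightarrow> real \<Rightarrow> complex).
        inj_on p V \<and>
        (\<forall>e\<in>E. arc (\<gamma> e) \<and> {pathstart (\<gamma> e), pathfinish (\<gamma> e)} = p ` e \<and>
                 path_image (\<gamma> e) \<inter> p ` V = p ` e) \<and>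
        (\<forall>e\<in>E. \<forall>e'\<in>E. e \<noteq> e' \<longrightarrow>
                 path_image (\<gamma> e) \<inter> path_image (\<gamma> e') = p ` (e \<inter> e')))"

definition bipartite :: "'a set \<Rightarrow> 'a set set \<Rightarrow> bool" where
  "bipartite V E \<longleftrightarrow> (\<exists>A. A \<subseteq> V \<and> (\<forall>e\<in>E. card (e \<inter> A) = 1))"

definition triangulation :: "'a set \<Rightarrow> 'a set set \<Rightarrow> bool" where
  "triangulation V E \<longleftrightarrow> planar V E \<and>
     (\<forall>u\<in>V. \<forall>w\<in>V. u \<noteq> w \<and> {u, w} \<notin> E \<longrightarrow> \<not> planar V (insert {u, w} E))"

definition quadrangulation :: "'a set \<Rightarrow> 'a set set \<Rightarrow> bool" where
  "quadrangulation V E \<longleftrightarrow> planar V E \<and> bipartite V E \<and>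
     (\<forall>u\<in>V. \<forall>w\<in>V. u \<noteq> w \<and> {u, w} \<notin> E \<longrightarrow>
        \<not> (planar V (insert {u, w} E) \<and> bipartite V (insert {u, w} E)))"

definition walk :: "'a set set \<Rightarrow> 'a list \<Rightarrow> bool" where
  "walk E xs \<longleftrightarrow> xs \<noteq> [] \<and> (\<forall>i. Suc i < length xs \<longrightarrow> {xs ! i, xs ! Suc i} \<in> E)"

definition connected_on :: "'a set set \<Rightarrow> 'a set \<Rightarrow> bool" where
  "connected_on E W \<longleftrightarrow> (\<forall>u\<in>W. \<forall>w\<in>W. \<exists>xs. walk E xs \<and> set xs \<subseteq> W \<and>
                             hd xs = u \<and> last xs = w)"

definition k_connected :: "nat \<Rightarrow> 'a set \<Rightarrow> 'a set set \<Rightarrow> bool" where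
  "k_connected k V E \<longleftrightarrow> (\<forall>S. S \<subseteq> V \<and> card S < k \<longrightarrow> connected_on E (V - S))"

definition gdist :: "'a set set \<Rightarrow> 'a \<Rightarrow> 'a \<Rightarrow> nat" where
  "gdist E u x = (LEAST k. \<exists>xs. walk E xs \<and> hd xs = u \<and> last xs = x \<and> length xs = Suc k)"

definition total_distance :: "'a set \<Rightarrow> 'a set set \<Rightarrow> 'a \<Rightarrow> real" where
  "total_distance V E u = (\<Sum>x\<in>V. real (gdist E u x))"

definition average_distance :: "'a set \<Rightarrow> 'a set set \<Rightarrow> 'a \<Rightarrow> real" where
  "average_distance V E u = total_distance V E u / (real (card V) - 1)"

definition proximity :: "'a set \<Rightarrow> 'a set set \<Rightarrow> real" where
  "proximity V E = Min ((\<lambda>u. average_distance V E u) ` V)"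

definition eccentricity :: "'a set \<Rightarrow> 'a set set \<Rightarrow> 'a \<Rightarrow> nat" where
  "eccentricity V E u = Max ((\<lambda>x. gdist E u x) ` V)"

definition central_vertex :: "'a set \<Rightarrow> 'a set set \<Rightarrow> 'a \<Rightarrow> bool" where
  "central_vertex V E v \<longleftrightarrow> v \<in> V \<and> (\<forall>u\<in>V. eccentricity V E v \<le> eccentricity V E u)"

end

theory Submission
  imports Defs "HOL-Complex_Analysis.Riemann_Mapping"
begin

text \<open>
  Let \<open>k\<close> be the connectivity and \<open>v\<close> a central vertex of eccentricity \<open>r\<close>. Deleting the ball of
  radius \<open>i\<close> around \<open>v\<close> leaves components whose neighbourhoods \<open>S\<close> in the distance layer \<open>i\<close> are
  separators, so they have at least \<open>k\<close> vertices. If \<open>S\<close> is split into two parts, some face touches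
  edges at both parts: otherwise the plane would be the union of two closed sets each of which
  connects the two sides of the separator, while their intersection does not. By maximality the two
  parts are then at distance at most 1 in a triangulation and at most 2 in a quadrangulation, because
  an edge can be drawn through a common face. A layer with fewer than \<open>2k\<close> vertices therefore has small
  diameter on its relevant part, and if it is far from both ends, moving \<open>v\<close> towards it
  decreases the eccentricity. So all layers except boundedly many at both ends have at least
  \<open>2k\<close> vertices, and \<open>\<sigma>(v)\<close> is at most a quadratic function of \<open>r\<close> whose maximum gives the bound.

  Faces of a drawing with arbitrary arcs are handled without rotation systems: a point of an edge
  is accessible from a face, and the part of the edge up to an end is contracted by a
  Riemann map of the complement of that part.
\<close>

section \<open>Separation and contraction in the plane\<close>

text \<open>A set of \<open>m\<close> vertices that is connected by steps of length at most
  \<open>d\<close> has a centre within distance \<open>d * (m div 2)\<close> of all of them. With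
  \<open>t = d * (m div 2) + 1\<close>, a layer of \<open>m < 2 * k\<close> vertices can therefore
  only occur within about \<open>t\<close> steps of an end; \<open>d\<close> is 1 for triangulations
  and 2 for quadrangulations. A list records, by position from an end, how far a layer may fall
  short of \<open>2 * k\<close>. Only its total \<open>A\<close> matters, since a shortfall at
  position \<open>j\<close> weighs \<open>r - j\<close> at one end and \<open>j\<close> at the
  other. The result is \<open>s * (N + D - k * s)\<close> with \<open>N = n - 1\<close> and
  \<open>D = A + 1 - k\<close>, which is at most \<open>(N + D)^2 / (4 * k)\<close>. The delicate
  case is \<open>i + t = r\<close>, where moving the vertex need not lower the eccentricity. The
  connectivity used in (a) and (d) is itself derived from maximality, with stars as an exception in
  (d). On the topological side, accessible points are only dense in the frontier of a face, so an
  arc through the face can be made to end on an edge but not at a prescribed vertex; this is why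
  arcs are slid along edges.\<close>

lemma exp_eq_1_constant_on:
  fixes f :: "'a::topological_space \<Rightarrow> complex"
  assumes "connected T" "continuous_on T f" "\<And>x. x \<in> T \<Longrightarrow> exp (f x) = 1"
  shows "f constant_on T"
proof (rule continuous_discrete_range_constant [OF assms(1,2)])
  fix x assume x: "x \<in> T"
  have "2 * pi \<le> cmod (f y - f x)" if y: "y \<in> T" "f y \<noteq> f x" for y
  proof -
    obtain m n :: int where "Re (f x) = 0" "Re (f y) = 0" "Im (f x) = of_int (2 * m) * pi"
      "Im (f y) = of_int (2 * n) * pi"
      using assms(3)[OF x] assms(3)[OF y(1)] unfolding exp_eq_1 by blast
    moreover from this y have "m \<noteq> n" by (auto simp: complex_eq_iff)
    moreover from this have "1 \<le> \<bar>real_of_int n - real_of_int m\<bar>" by linarith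
    ultimately have "2 * pi \<le> \<bar>Im (f y - f x)\<bar>"
      by (simp add: mult.assoc flip: right_diff_distrib left_diff_distrib) (simp add: abs_mult)
    then show ?thesis using abs_Im_le_cmod order_trans by blast
  qed
  then show "\<exists>e>0. \<forall>y. y \<in> T \<and> f y \<noteq> f x \<longrightarrow> e \<le> cmod (f y - f x)"
    by (intro exI [of _ "2*pi"]) auto
qed

text \<open>This is the part \<open>H\<^sup>1 = 0\<close> of the Mayer--Vietoris sequence of the plane: a
  continuous function to the circle that winds once along \<open>A\<close> and is constant on \<open>B\<close> has no
  continuous logarithm.\<close>

lemma plane_cover_links_once:
  fixes A B L1 L2 :: "complex set"
  assumes clo: "closed A" "closed B" "closed L1" "closed L2"
    and cover: "A \<union> B = UNIV" "A \<inter> B = L1 \<union> L2" "L1 \<inter> L2 = {}"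
    and pq: "p \<in> L1" "q \<in> L2"
    and A: "connected_component A p q" and B: "connected_component B p q"
  shows False
proof -
  obtain \<phi> :: "complex \<Rightarrow> real" where \<phi>: "continuous_on UNIV \<phi>" "\<And>x. x \<in> L1 \<Longrightarrow> \<phi> x = 0"
    "\<And>x. x \<in> L2 \<Longrightarrow> \<phi> x = 1"
    using Urysohn [OF clo(3,4) cover(3), of 0 1] by metis
  define e where "e x = exp (2 * of_real pi * \<i> * of_real (\<phi> x))" for x
  \<comment> \<open>The two closed pieces agree on \<open>A \<inter> B = L1 \<union> L2\<close>,
    because \<open>\<phi>\<close> is 0 or 1 there; hence \<open>h\<close> is continuous on the whole
    plane.\<close>
  define h where "h x = (if x \<in> A then e x else 1)" for x
  have e1: "e x = 1" if "x \<in> A" "x \<in> B" for x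
    using that cover(2) \<phi>(2,3) unfolding e_def by (metis IntI UnE exp_two_pi_i exp_zero mult.right_neutral mult_zero_right of_real_0 of_real_1)
  have cont_e: "continuous_on S e" for S
    unfolding e_def by (intro continuous_intros continuous_on_subset [OF \<phi>(1)]) auto
  have "continuous_on (A \<union> B) h"
    unfolding h_def by (rule continuous_on_cases) (use clo e1 cont_e in auto)
  then have "continuous_on UNIV h" by (simp add: cover)
  then obtain \<psi> where \<psi>: "continuous_on UNIV \<psi>" "\<And>x. h x = exp (\<psi> x)"
    using continuous_logarithm_on_contractible [OF _ contractible_UNIV, of h]
    by (metis UNIV_I e_def exp_not_eq_zero h_def zero_neq_one)
  obtain JA where JA: "connected JA" "JA \<subseteq> A" "p \<in> JA" "q \<in> JA" using A by (auto simp: connected_component_def)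
  obtain JB where JB: "connected JB" "JB \<subseteq> B" "p \<in> JB" "q \<in> JB" using B by (auto simp: connected_component_def)
  \<comment> \<open>On \<open>JB\<close> the function \<open>\<psi>\<close> is a logarithm of 1, and
    on \<open>JA\<close> it differs from a multiple of \<open>\<phi>\<close> by a logarithm of 1.
    Both logarithms of 1 are constant, so \<open>\<phi> p = \<phi> q\<close>, against the choice of
    \<open>\<phi>\<close>.\<close>
  have "\<psi> constant_on JB"
  proof (rule exp_eq_1_constant_on [OF JB(1)])
    show "continuous_on JB \<psi>" using \<psi> continuous_on_subset by blast
    show "exp (\<psi> x) = 1" if "x \<in> JB" for x
      using that JB(2) e1 \<psi>(2)[of x] unfolding h_def by (auto split: if_splits)
  qed
  then have 1: "\<psi> p = \<psi> q" using JB by (auto simp: constant_on_def)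
  have "(\<lambda>x. \<psi> x - 2 * of_real pi * \<i> * of_real (\<phi> x)) constant_on JA"
  proof (rule exp_eq_1_constant_on [OF JA(1)])
    show "continuous_on JA (\<lambda>x. \<psi> x - 2 * of_real pi * \<i> * of_real (\<phi> x))"
      by (intro continuous_intros continuous_on_subset [OF \<phi>(1)] continuous_on_subset [OF \<psi>(1)]) auto
    show "exp (\<psi> x - 2 * of_real pi * \<i> * of_real (\<phi> x)) = 1" if "x \<in> JA" for x
      using that JA(2) \<psi>(2)[of x] unfolding h_def e_def by (auto simp: exp_diff)
  qed
  then have "\<psi> p - 2 * of_real pi * \<i> * of_real (\<phi> p) = \<psi> q - 2 * of_real pi * \<i> * of_real (\<phi> q)"
    using JA by (auto simp: constant_on_def)
  with 1 pq \<phi> show False by simp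
qed

lemma frontier_component_subset_closed:
  fixes G :: "'a::euclidean_space set"
  assumes "closed G" "F \<in> components (- G)"
  shows "frontier F \<subseteq> G" "F \<inter> G = {}" "open F" "connected F"
proof -
  show "F \<inter> G = {}" using in_components_subset [OF assms(2)] by auto
  show "open F" using assms by (metis open_Compl open_components)
  show "connected F" using assms by (rule_tac in_components_connected)
  show "frontier F \<subseteq> G"
    using frontier_of_components_closed_complement [OF assms] by auto
qed

text \<open>The ball is connected and contains \<open>y\<close> in the face and \<open>x\<close>
  outside it. Faces that come near \<open>x\<close> thus have frontier points near \<open>x\<close>,
  which makes the sets \<open>U1\<close> and \<open>U2\<close> below open.\<close>

lemma ball_meets_face_boundary:
  fixes G :: "'a::euclidean_space set"
  assumes "closed G" "x \<in> G" "0 < r" "y \<in> ball x r" "y \<notin> G"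
  obtains F where "F \<in> components (- G)" "y \<in> F" "frontier F \<inter> ball x r \<noteq> {}"
proof -
  obtain F where F: "F \<in> components (- G)" "y \<in> F" using assms(5) by (metis Compl_iff UnionE Union_components)
  have "ball x r \<inter> frontier F \<noteq> {}"
    using F assms frontier_component_subset_closed(2) [OF assms(1) F(1)]
    by (intro connected_Int_frontier) (auto simp: connected_ball, metis IntI centre_in_ball empty_iff subsetD)
  then show thesis using F that by blast
qed

text \<open>Lets an arc end inside an edge instead of at one of the finitely many vertex points
  \<open>P\<close>. A small disc punctured at \<open>x\<close> is still connected; it meets
  \<open>F\<close>, and it contains a point of \<open>G\<close> because \<open>x\<close> is a limit
  point of \<open>G\<close>, so it contains another frontier point.\<close>

lemma frontier_avoid_finite:
  fixes G :: "complex set"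
  assumes G: "closed G" "F \<in> components (- G)" and C: "closed C" "finite P"
    and x: "x \<in> frontier F" "x \<notin> C" and lim: "\<And>x. x \<in> P - C \<Longrightarrow> x islimpt G"
  shows "frontier F - C - P \<noteq> {}"
proof (cases "x \<in> P")
  case False then show ?thesis using x by auto
next
  case True
  have F: "frontier F \<subseteq> G" "F \<inter> G = {}" "open F" using frontier_component_subset_closed [OF G] by auto
  have "closed (C \<union> (P - {x}))" using C by (meson closed_Un finite_Diff finite_imp_closed)
  then have "open (- (C \<union> (P - {x})))" by blast
  moreover have "x \<in> - (C \<union> (P - {x}))" using x by auto
  ultimately obtain r where r: "r > 0" "ball x r \<subseteq> - (C \<union> (P - {x}))" by (meson openE)
  have conn: "connected (ball x r - {x})"
    by (rule connected_open_delete) (auto simp: connected_ball)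
  obtain z where z: "z \<in> G" "z \<noteq> x" "z \<in> ball x r"
    using lim [of x] True x(2) r(1) unfolding islimpt_approachable by (auto simp: dist_commute)
  have "x \<in> closure F" using x(1) by (simp add: frontier_def)
  then obtain w where w: "w \<in> F" "w \<in> ball x r"
    using r(1) by (metis closure_approachable dist_commute mem_ball)
  have "x \<notin> F" using x F by auto
  have "(ball x r - {x}) \<inter> frontier F \<noteq> {}"
    by (rule connected_Int_frontier [OF conn]) (use z w F \<open>x \<notin> F\<close> in auto)
  then show ?thesis using r(2) by auto
qed

text \<open>If no face touches both \<open>M1\<close> and \<open>M2\<close> off \<open>L\<close>, then \<open>U1\<close> is \<open>M1 - L\<close> together with the
  faces touching it, and \<open>U2\<close> is the rest.\<close>

lemma separation_or_linking_arc:
  fixes L M1 M2 :: "complex set"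
  assumes clo: "closed L" "closed M1" "closed M2" and int: "M1 \<inter> M2 \<subseteq> L" and P: "finite P"
    and lim1: "\<And>x. x \<in> M1 \<inter> P \<Longrightarrow> x islimpt M1" and lim2: "\<And>x. x \<in> M2 \<inter> P \<Longrightarrow> x islimpt M2"
  obtains (separated) U1 U2 where "open U1" "open U2" "U1 \<inter> U2 = {}" "U1 \<union> U2 = - L" "M1 - L \<subseteq> U1" "M2 - L \<subseteq> U2"
    | (linked) g where "arc g" "pathstart g \<in> M1 - L - P" "pathfinish g \<in> M2 - L - P"
        "\<And>t. 0 < t \<Longrightarrow> t < 1 \<Longrightarrow> g t \<notin> L \<union> M1 \<union> M2"
proof -
  define G where "G = L \<union> M1 \<union> M2"
  have G: "closed G" using clo by (auto simp: G_def)
  show thesis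
  proof (cases "\<exists>F \<in> components (- G). frontier F \<inter> (M1 - L) \<noteq> {} \<and> frontier F \<inter> (M2 - L) \<noteq> {}")
    case True
    then obtain F x1 x2 where F: "F \<in> components (- G)" and x1: "x1 \<in> frontier F" "x1 \<in> M1 - L"
      and x2: "x2 \<in> frontier F" "x2 \<in> M2 - L" by blast
    have fr: "frontier F \<subseteq> G" "F \<inter> G = {}" "open F" "connected F" using frontier_component_subset_closed [OF G F] by auto
    have lim: "x islimpt G" if "x \<in> P \<inter> (M1 \<union> M2)" for x
      using that lim1 [of x] lim2 [of x] by (auto simp: G_def islimpt_Un)
    have lim': "frontier F - C - (P \<inter> (M1 \<union> M2)) \<noteq> {}" if "closed C" "x \<in> frontier F" "x \<notin> C" for C x
      by (rule frontier_avoid_finite [OF G F that(1) _ that(2,3)]) (use P lim in auto)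
    \<comment> \<open>Not every frontier point is accessible from \<open>F\<close>. Accessible
      points are dense, so the targets of the arc have to be nonempty relatively open subsets of the
      frontier.\<close>
    define O1 where "O1 = frontier F - (L \<union> M2) - (P \<inter> (M1 \<union> M2))"
    define O2 where "O2 = frontier F - (L \<union> M1) - (P \<inter> (M1 \<union> M2))"
    have ne: "O1 \<noteq> {}" "O2 \<noteq> {}" unfolding O1_def O2_def
      using lim' [of "L \<union> M2" x1] lim' [of "L \<union> M1" x2] clo x1 x2 int by auto
    have sub: "O1 \<subseteq> M1 - L - P" "O2 \<subseteq> M2 - L - P" using fr(1) unfolding O1_def O2_def G_def by auto
    have op: "openin (top_of_set (frontier F)) (frontier F - (C \<union> (P \<inter> (M1 \<union> M2))))" if "closed C" for C
    proof -
      have "closed (C \<union> (P \<inter> (M1 \<union> M2)))" using that P by (simp add: closed_Un finite_imp_closed)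
      then show ?thesis by (metis Diff_eq open_Compl openin_open_Int)
    qed
    have op1: "openin (top_of_set (frontier F)) O1" and op2: "openin (top_of_set (frontier F)) O2"
      using op [of "L \<union> M2"] op [of "L \<union> M1"] clo unfolding O1_def O2_def by (simp_all add: Diff_eq Un_assoc Int_assoc closed_Un)
    have "O1 \<noteq> O2" using ne sub int by blast
    then obtain g where "arc g" "pathstart g \<in> O1" "pathfinish g \<in> O2" "g ` {0<..<1} \<subseteq> F"
      using dense_accessible_frontier_point_pairs [OF fr(3,4) op1 op2 ne] by metis
    moreover from this have "g t \<notin> L \<union> M1 \<union> M2" if "0 < t" "t < 1" for t
      using that fr(2) unfolding G_def by (metis IntI empty_iff greaterThanLessThan_iff image_subset_iff)
    ultimately show thesis using linked [of g] sub by (meson subsetD)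
  next
    case False
    define U1 where "U1 = (M1 - L) \<union> \<Union>{F \<in> components (- G). frontier F \<inter> (M1 - L) \<noteq> {}}"
    define U2 where "U2 = (M2 - L) \<union> \<Union>{F \<in> components (- G). frontier F \<inter> (M1 - L) = {}}"
    have comp: "F \<inter> G = {}" "open F" if "F \<in> components (- G)" for F
      using frontier_component_subset_closed [OF G that] by auto
    have "open U1" unfolding open_contains_ball
    proof
      fix x assume "x \<in> U1"
      then consider "x \<in> M1 - L" | F where "F \<in> components (- G)" "frontier F \<inter> (M1 - L) \<noteq> {}" "x \<in> F"
        unfolding U1_def by blast
      then show "\<exists>e>0. ball x e \<subseteq> U1"
      proof cases
        case 1
        have "open (- (L \<union> M2))" using clo by auto
        moreover have "x \<in> - (L \<union> M2)" using 1 int by auto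
        ultimately obtain r where r: "r > 0" "ball x r \<subseteq> - (L \<union> M2)" by (meson openE)
        \<comment> \<open>The ball avoids \<open>L\<close> and \<open>M2\<close>, so a face whose
          frontier meets it has a frontier point in \<open>M1 - L\<close>.\<close>
        have "y \<in> U1" if y: "y \<in> ball x r" for y
        proof (cases "y \<in> G")
          case True then show ?thesis using y r by (auto simp: U1_def G_def)
        next
          case False
          then obtain F where F: "F \<in> components (- G)" "y \<in> F" "frontier F \<inter> ball x r \<noteq> {}"
            using ball_meets_face_boundary [OF G _ r(1) y] 1 by (auto simp: G_def)
          then have "frontier F \<inter> (M1 - L) \<noteq> {}"
            using frontier_component_subset_closed(1) [OF G F(1)] r unfolding G_def by blast
          then show ?thesis using F by (auto simp: U1_def)
        qed
        then show ?thesis using r(1) by blast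
      next
        case 2
        then obtain r where "r > 0" "ball x r \<subseteq> F" using comp by (meson openE)
        then show ?thesis using 2 unfolding U1_def by blast
      qed
    qed
    moreover have "open U2" unfolding open_contains_ball
    proof
      fix x assume "x \<in> U2"
      then consider "x \<in> M2 - L" | F where "F \<in> components (- G)" "frontier F \<inter> (M1 - L) = {}" "x \<in> F"
        unfolding U2_def by blast
      then show "\<exists>e>0. ball x e \<subseteq> U2"
      proof cases
        case 1
        have "open (- (L \<union> M1))" using clo by auto
        moreover have "x \<in> - (L \<union> M1)" using 1 int by auto
        ultimately obtain r where r: "r > 0" "ball x r \<subseteq> - (L \<union> M1)" by (meson openE)
        have "y \<in> U2" if y: "y \<in> ball x r" for y
        proof (cases "y \<in> G")
          case True then show ?thesis using y r by (auto simp: U2_def G_def)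
        next
          case not_in: False
          then obtain F where F: "F \<in> components (- G)" "y \<in> F" "frontier F \<inter> ball x r \<noteq> {}"
            using ball_meets_face_boundary [OF G _ r(1) y] 1 by (auto simp: G_def)
          then have "frontier F \<inter> (M2 - L) \<noteq> {}"
            using frontier_component_subset_closed(1) [OF G F(1)] r unfolding G_def by blast
          then show ?thesis using F False by (auto simp: U2_def)
        qed
        then show ?thesis using r(1) by blast
      next
        case 2
        then obtain r where "r > 0" "ball x r \<subseteq> F" using comp by (meson openE)
        then show ?thesis using 2 unfolding U2_def by blast
      qed
    qed
    moreover have "U1 \<inter> U2 = {}"
    proof -
      have "F = F'" if "F \<in> components (- G)" "F' \<in> components (- G)" "x \<in> F" "x \<in> F'" for F F' x
        using that components_eq by blast
      then show ?thesis using comp(1) int unfolding U1_def U2_def G_def by blast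
    qed
    moreover have "U1 \<union> U2 = - L"
    proof -
      have "\<Union>(components (- G)) = - G" by simp
      then show ?thesis using comp(1) unfolding U1_def U2_def G_def by blast
    qed
    ultimately show thesis using separated [of U1 U2] by (auto simp: U1_def U2_def)
  qed
qed

lemma linking_arc:
  fixes L M1 M2 :: "complex set"
  assumes clo: "closed L" "closed M1" "closed M2" and int: "M1 \<inter> M2 \<subseteq> L" and P: "finite P"
    and lim1: "\<And>x. x \<in> M1 \<inter> P \<Longrightarrow> x islimpt M1" and lim2: "\<And>x. x \<in> M2 \<inter> P \<Longrightarrow> x islimpt M2"
    and conn: "connected (- L)" and ne: "M1 - L \<noteq> {}" "M2 - L \<noteq> {}"
  obtains g where "arc g" "pathstart g \<in> M1 - L - P" "pathfinish g \<in> M2 - L - P"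
        "\<And>t. 0 < t \<Longrightarrow> t < 1 \<Longrightarrow> g t \<notin> L \<union> M1 \<union> M2"
proof (rule separation_or_linking_arc [OF clo int P lim1 lim2])
  fix U1 U2 assume U: "open U1" "open U2" "U1 \<inter> U2 = {}" "U1 \<union> U2 = - L" "M1 - L \<subseteq> U1" "M2 - L \<subseteq> U2"
  then have "U1 \<inter> - L = {} \<or> U2 \<inter> - L = {}" by (intro connectedD [OF conn]) auto
  then show thesis using U ne by auto
qed (use that in auto)

section \<open>Contracting an arc to a point\<close>

text \<open>The complement of an arc in the sphere is an open disc, hence homeomorphic to the plane.
  An inversion before the homeomorphism turns this complement into a plane domain, and one after it
  brings infinity back, so that the points of the arc become the single point 0.\<close>

lemma collapse_arc:
  fixes h :: "real \<Rightarrow> complex"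
  assumes "arc h"
  shows "\<exists>f :: complex \<Rightarrow> complex. continuous_on UNIV f \<and> (\<forall>z. f z = 0 \<longleftrightarrow> z \<in> path_image h)
    \<and> inj_on f (- path_image h)"
proof -
  define K where "K = path_image h"
  \<comment> \<open>An end of the arc, so that \<open>K - {q}\<close> stays connected.\<close>
  define q where "q = pathstart h"
  have K: "compact K" "q \<in> K" "connected (- K)"
    using assms by (auto simp: K_def q_def compact_arc_image connected_arc_complement pathstart_in_path_image)
  have Kq: "K - {q} = h ` {0<..1}"
  proof -
    have "h t \<noteq> q" if "0 < t" "t \<le> 1" for t
      using assms that arcD [of h t 0] unfolding q_def pathstart_def by auto
    moreover have "h t = q \<or> t \<in> {0<..1}" if "0 \<le> t" "t \<le> 1" for t
      using that unfolding q_def pathstart_def by (cases "t = 0") auto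
    ultimately show ?thesis unfolding K_def path_image_def by (force simp: image_iff)
  qed
  have conKq: "connected (K - {q})" unfolding Kq
  proof (rule connected_continuous_image)
    show "continuous_on {0<..1} h"
      by (rule continuous_on_subset [of "{0..1}"]) (use assms in \<open>auto simp: arc_def path_def\<close>)
  qed auto
  have limq: "q islimpt K"
  proof (rule connected_imp_perfect)
    show "K \<noteq> {x}" for x
      unfolding K_def by (metis arc_distinct_ends assms pathfinish_in_path_image pathstart_in_path_image singletonD)
  qed (use assms K in \<open>auto simp: K_def connected_arc_image\<close>)
  \<comment> \<open>The complement of \<open>K\<close> in the sphere, inverted at \<open>q\<close>;
    the point 0 stands for infinity.\<close>
  define \<Omega> where "\<Omega> = {w. w = 0 \<or> q + 1 / w \<notin> K}"
  have opK: "open {w. w \<noteq> 0 \<and> q + 1 / w \<notin> K}"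
  proof -
    have "open ((\<lambda>w. q + 1 / w) -` (- K) \<inter> (- {0}))"
      by (rule continuous_open_preimage [of "-{0}", simplified Int_commute])
        (auto intro!: continuous_intros simp: K compact_imp_closed open_Compl)
    moreover have "(\<lambda>w. q + 1 / w) -` (- K) \<inter> (- {0}) = {w. w \<noteq> 0 \<and> q + 1 / w \<notin> K}" by auto
    ultimately show ?thesis by simp
  qed
  define iv where "iv z = 1 / (z - q)" for z
  have iv: "iv z \<noteq> 0" "q + 1 / iv z = z" if "z \<noteq> q" for z using that by (auto simp: iv_def)
  have iv': "iv (q + 1 / w) = w" for w by (auto simp: iv_def)
  obtain B where B: "B > 0" "\<And>z. z \<in> K \<Longrightarrow> cmod z \<le> B"
    using K(1) compact_imp_bounded bounded_pos by metis
  define e where "e = inverse (2 * B + 1)"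
  have e: "e > 0" using B by (auto simp: e_def)
  have near0: "q + 1 / w \<notin> K" if "w \<noteq> 0" "cmod w < e" for w
  proof
    assume "q + 1 / w \<in> K"
    then have "cmod (1 / w) \<le> 2 * B" using B(2)[of "q + 1/w"] B(2)[OF K(2)] norm_triangle_ineq4 [of "q + 1/w" q] by simp
    moreover have "inverse e < cmod (1 / w)" using that e less_imp_inverse_less [of "cmod w" e] by (simp add: norm_inverse divide_inverse)
    ultimately show False by (simp add: e_def)
  qed
  have \<Omega>_eq: "\<Omega> = {w. w \<noteq> 0 \<and> q + 1 / w \<notin> K} \<union> ball 0 e"
    using near0 e by (auto simp: \<Omega>_def)
  have op\<Omega>: "open \<Omega>" unfolding \<Omega>_eq using opK by auto
  define Z where "Z = {w. w \<noteq> 0 \<and> q + 1 / w \<notin> K}"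
  have Z: "Z = iv ` (- K)"
  proof (intro set_eqI iffI)
    fix w assume "w \<in> Z" then show "w \<in> iv ` (- K)" unfolding Z_def by (metis (no_types, lifting) ComplI imageI iv' mem_Collect_eq)
  next
    fix w assume "w \<in> iv ` (- K)"
    then obtain z where "z \<notin> K" "w = iv z" by auto
    moreover from this K have "z \<noteq> q" by auto
    ultimately show "w \<in> Z" using iv by (auto simp: Z_def)
  qed
  have cont_iv: "continuous_on S iv" if "q \<notin> S" for S
    unfolding iv_def using that by (intro continuous_intros) auto
  have "connected Z" unfolding Z using K by (intro connected_continuous_image cont_iv) auto
  have "Z \<subseteq> \<Omega>" by (auto simp: Z_def \<Omega>_def)
  have "0 \<in> closure Z" unfolding closure_approachable
  proof (intro allI impI)
    fix d :: real assume "d > 0"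
    then show "\<exists>y\<in>Z. dist y 0 < d" unfolding Z_def using e near0 [of "of_real (min d e / 2)"]
      by (intro bexI [of _ "of_real (min d e / 2)"]) auto
  qed
  moreover have "\<Omega> \<subseteq> insert 0 Z" by (auto simp: \<Omega>_def Z_def)
  ultimately have "\<Omega> \<subseteq> closure Z" using closure_subset [of Z] by blast
  then have con\<Omega>: "connected \<Omega>" using \<open>connected Z\<close> \<open>Z \<subseteq> \<Omega>\<close> connected_intermediate_closure by blast
  have N\<Omega>: "- \<Omega> = iv ` (K - {q})"
  proof (intro set_eqI iffI)
    fix w assume "w \<in> - \<Omega>" then show "w \<in> iv ` (K - {q})" unfolding \<Omega>_def using iv'
      by (intro image_eqI [of _ _ "q + 1 / w"]) auto
  qed (use iv in \<open>auto simp: \<Omega>_def\<close>)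
  \<comment> \<open>Simple connectedness is read off from the complement: it is connected, and it is
    unbounded because points of \<open>K\<close> near \<open>q\<close> are inverted to points far
    away.\<close>
  have "connected (- \<Omega>)" unfolding N\<Omega> using conKq by (intro connected_continuous_image cont_iv) auto
  moreover have "\<not> bounded (- \<Omega>)"
  proof
    assume "bounded (- \<Omega>)"
    then obtain b where b: "b > 0" "\<And>w. w \<in> - \<Omega> \<Longrightarrow> cmod w \<le> b" unfolding bounded_pos by blast
    obtain z where z: "z \<in> K" "z \<noteq> q" "cmod (z - q) < inverse b"
      using limq b(1) unfolding islimpt_approachable dist_norm by (meson positive_imp_inverse_positive)
    then have "b < cmod (iv z)"
      using less_imp_inverse_less [of "cmod (z - q)" "inverse b"] by (simp add: iv_def norm_inverse divide_inverse)
    moreover have "iv z \<in> - \<Omega>" using z N\<Omega> by auto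
    ultimately show False using b(2) by force
  qed
  ultimately have "\<not> bounded C" if "C \<in> components (- \<Omega>)" for C
    using that components_eq_sing_iff [of "- \<Omega>"] by (metis bounded_empty singletonD)
  then have "simply_connected \<Omega>"
    using simply_connected_eq_unbounded_complement_components [OF op\<Omega>] con\<Omega> by blast
  moreover have "0 \<in> \<Omega>" by (auto simp: \<Omega>_def)
  ultimately have "\<Omega> homeomorphic (UNIV :: complex set)"
    using simply_connected_eq_homeomorphic_to_disc [OF op\<Omega>] homeomorphic_ball_UNIV homeomorphic_trans
    by (metis empty_iff zero_less_one)
  then obtain \<phi> \<psi> where hom: "homeomorphism \<Omega> (UNIV :: complex set) \<phi> \<psi>"
    unfolding homeomorphic_def by blast
  then have inj\<phi>: "inj_on \<phi> \<Omega>" by (metis homeomorphism_apply1 inj_on_inverseI)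
  define c where "c = \<phi> 0"
  have iv\<Omega>: "iv z \<in> \<Omega>" "iv z \<noteq> 0" if "z \<notin> K" for z using that iv K(2) by (metis (mono_tags, lifting) \<Omega>_def mem_Collect_eq)+
  \<comment> \<open>The second inversion is at \<open>c\<close>, the image of infinity. When
    \<open>z\<close> tends to \<open>K\<close>, the point \<open>iv z\<close> leaves every compact
    subset of \<open>\<Omega>\<close>, so \<open>\<phi> (iv z)\<close> tends to infinity and the
    quotient to 0.\<close>
  define f where "f z = (if z \<in> K then 0 else 1 / (\<phi> (iv z) - c))" for z
  have nz: "\<phi> (iv z) - c \<noteq> 0" if "z \<notin> K" for z
    using iv\<Omega> [OF that] inj\<phi> \<open>0 \<in> \<Omega>\<close> by (auto simp: c_def inj_on_def)
  have cont\<phi>: "continuous_on \<Omega> \<phi>" and cont\<psi>: "continuous_on UNIV \<psi>" using hom by (auto simp: homeomorphism_def)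
  have out: "isCont f z" if "z \<notin> K" for z
  proof -
    have "continuous_on (- K) (\<lambda>z. 1 / (\<phi> (iv z) - c))"
      using nz iv\<Omega> K by (intro continuous_intros continuous_on_compose2 [OF cont\<phi>] cont_iv) auto
    then have "continuous_on (- K) f" by (rule continuous_on_eq) (auto simp: f_def)
    then show ?thesis using that K(1) by (simp add: continuous_on_eq_continuous_at compact_imp_closed open_Compl)
  qed
  have at: "isCont f z" if z: "z \<in> K" for z unfolding continuous_at_eps_delta
  proof (intro allI impI)
    fix \<epsilon> :: real assume "\<epsilon> > 0"
    define Q where "Q = \<psi> ` cball c (1 / \<epsilon>)"
    have Q: "compact Q" "Q \<subseteq> \<Omega>" unfolding Q_def
      using hom by (auto intro!: compact_continuous_image continuous_on_subset [OF cont\<psi>] simp: homeomorphism_def)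
    obtain b where b: "b > 0" "\<And>w. w \<in> Q \<Longrightarrow> cmod w \<le> b" using Q compact_imp_bounded bounded_pos by metis
    \<comment> \<open>Off \<open>K\<close>, the points outside \<open>W\<close> satisfy
      \<open>cmod (f x) < \<epsilon>\<close>. A ball around \<open>q\<close> may be left out since
      \<open>iv\<close> exceeds the bound \<open>b\<close> of \<open>Q\<close> there; without it
      \<open>iv\<close> is continuous and \<open>W\<close> is closed.\<close>
    define W where "W = - ball q (inverse b) \<inter> iv -` Q"
    have "closed W" unfolding W_def using b Q
      by (intro continuous_closed_preimage cont_iv) (auto simp: compact_imp_closed)
    moreover have "z \<notin> W"
    proof
      assume "z \<in> W"
      then have "z \<noteq> q" "iv z \<in> \<Omega>" using b Q by (auto simp: W_def)
      then show False using z N\<Omega> by blast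
    qed
    ultimately obtain \<delta> where \<delta>: "\<delta> > 0" "ball z \<delta> \<subseteq> - W" by (metis ComplI openE open_Compl)
    have "cmod (f x) < \<epsilon>" if x: "x \<in> ball z \<delta>" for x
    proof (cases "x \<in> K")
      case True then show ?thesis using \<open>\<epsilon> > 0\<close> by (simp add: f_def)
    next
      case False
      have "1 / \<epsilon> < cmod (\<phi> (iv x) - c)"
      proof (rule ccontr)
        assume "\<not> ?thesis"
        then have "\<phi> (iv x) \<in> cball c (1 / \<epsilon>)" by (simp add: dist_norm norm_minus_commute)
        then have "iv x \<in> Q" unfolding Q_def using homeomorphism_apply1 [OF hom iv\<Omega>(1) [OF False]] by force
        moreover have "x \<noteq> q" using False K by auto
        moreover have "inverse b \<le> cmod (x - q)"
        proof -
          have "inverse (cmod (x - q)) \<le> b" using b(2) [OF \<open>iv x \<in> Q\<close>] by (simp add: iv_def norm_inverse divide_inverse)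
          then show ?thesis using \<open>x \<noteq> q\<close> by (metis inverse_inverse_eq le_imp_inverse_le inverse_positive_iff_positive right_minus_eq zero_less_norm_iff)
        qed
        ultimately have "x \<in> W" by (auto simp: W_def dist_norm norm_minus_commute)
        then show False using x \<delta> by auto
      qed
      then have "1 / cmod (\<phi> (iv x) - c) < \<epsilon>"
        using \<open>\<epsilon> > 0\<close> nz [OF False] by (simp add: divide_less_eq mult.commute)
      then show ?thesis using False by (simp add: f_def norm_divide)
    qed
    then show "\<exists>d>0. \<forall>x'. dist x' z < d \<longrightarrow> dist (f x') (f z) < \<epsilon>"
      using z \<delta>(1) by (intro exI [of _ \<delta>]) (auto simp: f_def dist_commute)
  qed
  show ?thesis
  proof (intro exI conjI allI)
    show "continuous_on UNIV f" using out at by (metis continuous_at_imp_continuous_on)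
    show "f z = 0 \<longleftrightarrow> z \<in> path_image h" for z using nz by (auto simp: f_def K_def)
    show "inj_on f (- path_image h)"
    proof (rule inj_onI)
      fix x y assume xy: "x \<in> - path_image h" "y \<in> - path_image h" "f x = f y"
      then have "\<phi> (iv x) = \<phi> (iv y)" by (auto simp: f_def K_def)
      then have "iv x = iv y" using xy iv\<Omega> inj\<phi> by (auto simp: K_def inj_on_def)
      then show "x = y" by (auto simp: iv_def)
    qed
  qed
qed

section \<open>Plane drawings of graphs\<close>

definition drawing :: "'a set \<Rightarrow> 'a set set \<Rightarrow> ('a \<Rightarrow> complex) \<Rightarrow> ('a set \<Rightarrow> real \<Rightarrow> complex) \<Rightarrow> bool" where
  "drawing V E p \<gamma> \<longleftrightarrow> inj_on p V \<and>
     (\<forall>e\<in>E. arc (\<gamma> e) \<and> {pathstart (\<gamma> e), pathfinish (\<gamma> e)} = p ` e \<and> path_image (\<gamma> e) \<inter> p ` V = p ` e) \<and>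
     (\<forall>e\<in>E. \<forall>e'\<in>E. e \<noteq> e' \<longrightarrow> path_image (\<gamma> e) \<inter> path_image (\<gamma> e') = p ` (e \<inter> e'))"

lemma planar_iff_drawing: "planar V E \<longleftrightarrow> simple_graph V E \<and> (\<exists>p \<gamma>. drawing V E p \<gamma>)"
  by (simp add: planar_def drawing_def)

definition drawn :: "'a set \<Rightarrow> 'a set set \<Rightarrow> ('a \<Rightarrow> complex) \<Rightarrow> ('a set \<Rightarrow> real \<Rightarrow> complex) \<Rightarrow> complex set" where
  "drawn X F p \<gamma> = p ` X \<union> (\<Union>e\<in>F. path_image (\<gamma> e))"

lemma simple_graphD:
  assumes "simple_graph V E" "e \<in> E" "u \<in> e"
  obtains z where "e = {u, z}" "z \<noteq> u" "u \<in> V" "z \<in> V"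
  using assms unfolding simple_graph_def by (metis doubleton_eq_iff empty_iff insertE)

lemma simple_graph_finite: "simple_graph V E \<Longrightarrow> finite V \<and> finite E \<and> E \<subseteq> Pow V"
proof -
  assume G: "simple_graph V E"
  then have "E \<subseteq> Pow V" by (auto simp: simple_graph_def)
  with G show ?thesis unfolding simple_graph_def by (metis finite_Pow_iff finite_subset)
qed

lemma drawing_compact:
  assumes "drawing V E p \<gamma>" "F \<subseteq> E" "finite F" "finite X"
  shows "compact (drawn X F p \<gamma>)" "closed (drawn X F p \<gamma>)"
proof -
  show "compact (drawn X F p \<gamma>)" unfolding drawn_def using assms
    by (intro compact_Un compact_UN) (auto simp: drawing_def intro: compact_arc_image finite_imp_compact)
  then show "closed (drawn X F p \<gamma>)" by (rule compact_imp_closed)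
qed

text \<open>Ensures that contracted edges still meet in common vertices only. The map identifies
  nothing but points of \<open>K\<close>, so two images can gain a common point only if both sets
  meet \<open>K\<close>, and then both contain \<open>k\<close> already.\<close>

lemma collapse_image_Int:
  assumes f: "\<And>z. f z = (0::complex) \<longleftrightarrow> z \<in> K" "inj_on f (- K)" and k: "k \<in> K"
    and "X \<inter> K \<noteq> {} \<Longrightarrow> k \<in> X" "Y \<inter> K \<noteq> {} \<Longrightarrow> k \<in> Y"
  shows "f ` X \<inter> f ` Y = f ` (X \<inter> Y)"
proof (intro set_eqI iffI)
  fix w assume "w \<in> f ` X \<inter> f ` Y"
  then obtain x y where xy: "x \<in> X" "y \<in> Y" "w = f x" "w = f y" by auto
  show "w \<in> f ` (X \<inter> Y)"
  proof (cases "x \<in> K")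
    case True
    then have "y \<in> K" using xy f(1) by metis
    then have "k \<in> X \<inter> Y" using True assms(4,5) xy by auto
    moreover have "w = f k" using True f(1) k xy by metis
    ultimately show ?thesis by auto
  next
    case False
    then have "x = y" using xy f by (metis ComplI inj_onD)
    then show ?thesis using xy by auto
  qed
qed auto

lemma arc_collapse:
  assumes f: "continuous_on UNIV f" "\<And>z. f z = (0::complex) \<longleftrightarrow> z \<in> K" "inj_on f (- K)"
    and "arc c" "path_image c \<inter> K \<subseteq> {x}"
  shows "arc (f \<circ> c)"
  unfolding arc_def
proof
  show "path (f \<circ> c)"
    using assms by (intro path_continuous_image continuous_on_subset [OF f(1)]) (auto simp: arc_imp_path)
  show "inj_on (f \<circ> c) {0..1}"
  proof (rule comp_inj_on)
    show "inj_on c {0..1}" using assms by (auto simp: arc_def)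
    show "inj_on f (c ` {0..1})"
    proof (rule inj_onI)
      fix a b assume ab: "a \<in> c ` {0..1}" "b \<in> c ` {0..1}" "f a = f b"
      then have "a \<in> K \<longleftrightarrow> b \<in> K" using f(2) by metis
      then show "a = b" using ab f(3) assms(5) unfolding path_image_def by (cases "a \<in> K") (blast, auto simp: inj_on_def)
    qed
  qed
qed

lemma drawing_edge_arc:
  assumes G: "simple_graph V E" and D: "drawing V E p \<gamma>" and "e \<in> E" "e = {u, z}"
  obtains h where "arc h" "path_image h = path_image (\<gamma> e)" "pathstart h = p u" "pathfinish h = p z"
proof -
  have *: "arc (\<gamma> e)" "{pathstart (\<gamma> e), pathfinish (\<gamma> e)} = {p u, p z}"
    using D assms by (auto simp: drawing_def)
  then consider "pathstart (\<gamma> e) = p u" "pathfinish (\<gamma> e) = p z" | "pathstart (\<gamma> e) = p z" "pathfinish (\<gamma> e) = p u"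
    by (metis doubleton_eq_iff)
  then show thesis
    by cases (use that [of "\<gamma> e"] that [of "reversepath (\<gamma> e)"] * in \<open>auto simp: arc_reversepath\<close>)
qed

text \<open>A linking arc that ends in the interior of an edge is moved to the endpoint \<open>u\<close> of this edge
  by contracting the part of the edge between the two points.\<close>

lemma slide_to_vertex:
  assumes G: "simple_graph V E" and D: "drawing V E p \<gamma>" and e: "e \<in> E" "u \<in> e"
    and g: "arc g" "pathstart g \<in> path_image (\<gamma> e) - p ` V" "pathfinish g \<notin> path_image (\<gamma> e)"
    and int: "\<And>t. 0 < t \<Longrightarrow> t < 1 \<Longrightarrow> g t \<notin> drawn V E p \<gamma>"
  obtains p' \<gamma>' g' where "drawing V E p' \<gamma>'" "arc g'" "pathstart g' = p' u"
    "\<And>t. 0 < t \<Longrightarrow> t < 1 \<Longrightarrow> g' t \<notin> drawn V E p' \<gamma>'"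
    "\<And>w. pathfinish g = p w \<Longrightarrow> pathfinish g' = p' w"
    "\<And>e'. e' \<in> E \<Longrightarrow> pathfinish g \<in> path_image (\<gamma> e') - p ` V \<Longrightarrow> pathfinish g' \<in> path_image (\<gamma>' e') - p' ` V"
proof -
  obtain z where z: "e = {u, z}" "z \<noteq> u" "u \<in> V" "z \<in> V" using simple_graphD [OF G e] by metis
  obtain h where h: "arc h" "path_image h = path_image (\<gamma> e)" "pathstart h = p u" "pathfinish h = p z"
    using drawing_edge_arc [OF G D e(1) z(1)] by metis
  have D': "inj_on p V" "\<And>e. e \<in> E \<Longrightarrow> arc (\<gamma> e)" "\<And>e. e \<in> E \<Longrightarrow> path_image (\<gamma> e) \<inter> p ` V = p ` e"
    "\<And>e. e \<in> E \<Longrightarrow> {pathstart (\<gamma> e), pathfinish (\<gamma> e)} = p ` e"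
    "\<And>e e'. e \<in> E \<Longrightarrow> e' \<in> E \<Longrightarrow> e \<noteq> e' \<Longrightarrow> path_image (\<gamma> e) \<inter> path_image (\<gamma> e') = p ` (e \<inter> e')"
    using D by (auto simp: drawing_def)
  have pe: "path_image h \<inter> p ` V = {p u, p z}" using D'(3) e z h by auto
  have "pathstart g \<in> path_image h" using g(2) h(2) by auto
  then obtain \<tau> where \<tau>: "\<tau> \<in> {0..1}" "pathstart g = h \<tau>" by (auto simp: path_image_def)
  have "h \<tau> \<noteq> p u" "h \<tau> \<noteq> p z" using g(2) \<tau> z by auto
  then have \<tau>01: "0 < \<tau>" "\<tau> < 1"
    using \<tau> h(3,4) by (auto simp: pathstart_def pathfinish_def less_le)
  \<comment> \<open>The part of the edge between \<open>u\<close> and the start of \<open>g\<close>.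
    After its contraction \<open>g\<close> starts at the new position of \<open>u\<close>.\<close>
  define k where "k = subpath 0 \<tau> h"
  have "arc k" unfolding k_def using \<tau> \<tau>01 h(1) by (intro arc_subpath_arc) auto
  define K where "K = path_image k"
  have K: "K = h ` {0..\<tau>}" unfolding K_def k_def using \<tau>01 by (simp add: path_image_subpath)
  have Ksub: "K \<subseteq> path_image h" using \<tau>01 unfolding K path_image_def by auto
  have inj_h: "h s = h t \<Longrightarrow> s = t" if "s \<in> {0..1}" "t \<in> {0..1}" for s t
    using h(1) that by (auto simp: arc_def inj_on_def)
  have uK: "p u \<in> K" using h(3) \<tau>01 unfolding K pathstart_def by force
  have zK: "p z \<notin> K" unfolding K using h(4) \<tau>01 inj_h [of 1] unfolding pathfinish_def by force
  have aK: "pathstart g \<in> K" unfolding K using \<tau> by auto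
  have KV: "K \<inter> p ` V = {p u}" using Ksub pe uK zK by auto
  obtain f :: "complex \<Rightarrow> complex" where f: "continuous_on UNIV f" "\<And>x. f x = 0 \<longleftrightarrow> x \<in> K" "inj_on f (- K)"
    using collapse_arc [OF \<open>arc k\<close>] unfolding K_def by auto
  have fI: "f ` X \<inter> f ` Y = f ` (X \<inter> Y)" if "X \<inter> K \<noteq> {} \<Longrightarrow> p u \<in> X" "Y \<inter> K \<noteq> {} \<Longrightarrow> p u \<in> Y" for X Y
    by (rule collapse_image_Int [where K = K and k = "p u"]) (use f uK that in auto)
  have f0: "f x = f y \<Longrightarrow> x \<in> K \<Longrightarrow> y \<in> K" for x y using f(2) by metis
  define p' where "p' = f \<circ> p"
  \<comment> \<open>The contracted part is cut off from \<open>e\<close>, because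
    \<open>f \<circ> h\<close> is constant on it and would not be an arc. The image stays the
    same.\<close>
  define \<gamma>' where "\<gamma>' e' = (if e' = e then f \<circ> subpath \<tau> 1 h else f \<circ> \<gamma> e')" for e'
  define g' where "g' = f \<circ> g"
  have im: "path_image (\<gamma>' e') = f ` path_image (\<gamma> e')" for e'
  proof (cases "e' = e")
    case True
    have "{0..1} = {0..\<tau>} \<union> {\<tau>..1}" using \<tau>01 by auto
    then have "f ` path_image h = f ` h ` {0..\<tau>} \<union> f ` h ` {\<tau>..1}" unfolding path_image_def by (simp add: image_Un)
    also have "\<dots> = f ` h ` {\<tau>..1}"
    proof -
      have "f ` h ` {0..\<tau>} \<subseteq> {0}" using f(2) unfolding K [symmetric] by auto
      moreover have "f (h \<tau>) \<in> f ` h ` {\<tau>..1}" using \<tau>01 by (intro imageI) auto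
      then have "0 \<in> f ` h ` {\<tau>..1}" using f(2) aK \<tau>(2) by metis
      moreover have "A \<union> B = B" if "A \<subseteq> {0}" "0 \<in> B" for A B :: "complex set" using that by blast
      ultimately show ?thesis by simp
    qed
    finally have 1: "f ` path_image h = f ` h ` {\<tau>..1}" .
    have "path_image (subpath \<tau> 1 h) = h ` {\<tau>..1}" using \<tau>01 by (simp add: path_image_subpath)
    then have "path_image (\<gamma>' e') = f ` h ` {\<tau>..1}" unfolding \<gamma>'_def True by (simp only: path_image_compose if_True simp_thms)
    then show ?thesis using 1 h(2) unfolding True by (simp only:)
  qed (simp add: \<gamma>'_def path_image_compose)
  have other: "path_image (\<gamma> e') \<inter> K \<subseteq> {p u}" if "e' \<in> E" "e' \<noteq> e" for e'
  proof -
    have "path_image (\<gamma> e') \<inter> K \<subseteq> p ` (e' \<inter> e)" using D'(5) [OF that(1) e(1) that(2)] Ksub h(2) by auto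
    then show ?thesis using KV z by auto
  qed
  have sat: "p u \<in> path_image (\<gamma> e')" if "e' \<in> E" "path_image (\<gamma> e') \<inter> K \<noteq> {}" for e'
  proof (cases "e' = e")
    case True then show ?thesis using uK Ksub h(2) by auto
  next
    case False then show ?thesis using other that by auto
  qed
  have arcs: "arc (\<gamma>' e')" if "e' \<in> E" for e'
  proof (cases "e' = e")
    case True
    have "path_image (subpath \<tau> 1 h) \<inter> K \<subseteq> {h \<tau>}"
    proof
      have "path_image (subpath \<tau> 1 h) = h ` {\<tau>..1}" using \<tau>01 by (simp add: path_image_subpath)
      moreover fix x assume "x \<in> path_image (subpath \<tau> 1 h) \<inter> K"
      ultimately have x: "x \<in> h ` {\<tau>..1}" "x \<in> h ` {0..\<tau>}" using K by auto
      obtain s where "x = h s" "\<tau> \<le> s" "s \<le> 1" using x(1) by auto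
      moreover obtain t where "x = h t" "0 \<le> t" "t \<le> \<tau>" using x(2) by auto
      moreover note st = calculation
      have "s = t" using st inj_h [of s t] \<tau>01 by auto
      then show "x \<in> {h \<tau>}" using st by auto
    qed
    moreover have "arc (subpath \<tau> 1 h)" using \<tau>01 h(1) by (intro arc_subpath_arc) auto
    ultimately have "arc (f \<circ> subpath \<tau> 1 h)" by (intro arc_collapse [OF f])
    then show ?thesis using True by (simp add: \<gamma>'_def)
  next
    case False
    have "arc (f \<circ> \<gamma> e')" by (rule arc_collapse [OF f D'(2) [OF that] other [OF that False]])
    then show ?thesis using False by (simp add: \<gamma>'_def)
  qed
  have inj': "inj_on p' V"
  proof (rule inj_onI)
    fix x y assume xy: "x \<in> V" "y \<in> V" "p' x = p' y"
    have "p x = p y"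
    proof (cases "p x \<in> K")
      case True then have "p y \<in> K" using f0 [of "p x" "p y"] xy(3) by (simp add: p'_def)
      then have "p x \<in> {p u}" "p y \<in> {p u}" unfolding KV [symmetric] using True xy by simp_all
      then show ?thesis by simp
    next
      case False then have "p y \<notin> K" using f0 [of "p y" "p x"] xy(3) by (auto simp: p'_def)
      then show ?thesis using inj_onD [OF f(3), of "p x" "p y"] False xy by (simp add: p'_def)
    qed
    then show "x = y" using inj_onD [OF D'(1)] xy by blast
  qed
  have ends: "{pathstart (\<gamma>' e'), pathfinish (\<gamma>' e')} = p' ` e'" if "e' \<in> E" for e'
  proof (cases "e' = e")
    case True
    have "f (h \<tau>) = f (p u)" using aK uK f(2) \<tau> by metis
    then have "pathstart (\<gamma>' e') = p' u" "pathfinish (\<gamma>' e') = p' z"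
      using True h(4) by (auto simp: \<gamma>'_def p'_def pathstart_def pathfinish_def subpath_def)
    then show ?thesis using True z by auto
  next
    case False
    then have "{pathstart (\<gamma>' e'), pathfinish (\<gamma>' e')} = f ` {pathstart (\<gamma> e'), pathfinish (\<gamma> e')}"
      by (simp add: \<gamma>'_def pathstart_compose pathfinish_compose)
    then show ?thesis using D'(4) [OF that] by (simp add: p'_def image_comp)
  qed
  have V': "p' ` V = f ` p ` V" "\<And>e'. p' ` e' = f ` p ` e'" by (auto simp: p'_def)
  have draw: "drawing V E p' \<gamma>'" unfolding drawing_def
  proof (intro conjI ballI impI)
    fix e' assume e': "e' \<in> E"
    have "f ` path_image (\<gamma> e') \<inter> f ` p ` V = f ` (path_image (\<gamma> e') \<inter> p ` V)"
      using sat [OF e'] z by (intro fI) auto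
    then show "path_image (\<gamma>' e') \<inter> p' ` V = p' ` e'" using D'(3) [OF e'] by (simp add: im V')
  next
    fix e1 e2 assume e': "e1 \<in> E" "e2 \<in> E" "e1 \<noteq> e2"
    have "f ` path_image (\<gamma> e1) \<inter> f ` path_image (\<gamma> e2) = f ` (path_image (\<gamma> e1) \<inter> path_image (\<gamma> e2))"
      using sat e' by (intro fI) auto
    then show "path_image (\<gamma>' e1) \<inter> path_image (\<gamma>' e2) = p' ` (e1 \<inter> e2)" using D'(5) [OF e'] by (simp add: im V')
  qed (use inj' arcs ends in auto)
  have drawn': "drawn V E p' \<gamma>' = f ` drawn V E p \<gamma>"
    unfolding drawn_def V' im image_Un image_UN ..
  have Kdrawn: "K \<subseteq> drawn V E p \<gamma>" using Ksub h(2) e unfolding drawn_def by auto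
  have fim: "f x \<notin> f ` Y" if "x \<notin> Y" "x \<notin> K" for x Y
  proof
    assume "f x \<in> f ` Y"
    then obtain y where y: "y \<in> Y" "f x = f y" by auto
    then have "y \<notin> K" using f0 [of y x] that by auto
    then show False using inj_onD [OF f(3) y(2)] that y by auto
  qed
  have gK: "path_image g \<inter> K \<subseteq> {pathstart g}"
  proof
    fix x assume x: "x \<in> path_image g \<inter> K"
    then obtain t where t: "0 \<le> t" "t \<le> 1" "x = g t" by (auto simp: path_image_def)
    have "t \<noteq> 1" using x t g(3) Ksub h(2) by (auto simp: pathfinish_def)
    moreover have "\<not> (0 < t \<and> t < 1)" using int x t Kdrawn by blast
    ultimately show "x \<in> {pathstart g}" using t by (auto simp: pathstart_def)
  qed
  have finK: "pathfinish g \<notin> K" using g(3) Ksub h(2) by auto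
  show thesis
  proof (rule that [of p' \<gamma>' g'])
    show "drawing V E p' \<gamma>'" by (rule draw)
    show "arc g'" unfolding g'_def by (rule arc_collapse [OF f g(1) gK])
    show "pathstart g' = p' u"
      using f(2) [of "pathstart g"] f(2) [of "p u"] aK uK unfolding g'_def p'_def pathstart_compose by simp
    show "g' t \<notin> drawn V E p' \<gamma>'" if "0 < t" "t < 1" for t
      unfolding drawn' g'_def using int [OF that] Kdrawn fim [of "g t"] by auto
    show "pathfinish g' = p' w" if "pathfinish g = p w" for w
      using that by (simp add: g'_def p'_def pathfinish_compose)
    show "pathfinish g' \<in> path_image (\<gamma>' e') - p' ` V" if "e' \<in> E" "pathfinish g \<in> path_image (\<gamma> e') - p ` V" for e'
      using that fim [of "pathfinish g" "p ` V"] finK unfolding g'_def im V' pathfinish_compose by auto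
  qed
qed

section \<open>Adding an edge along an arc in a face\<close>

lemma planar_insert_vertex_vertex:
  assumes G: "simple_graph V E" and D: "drawing V E p \<gamma>" and uw: "u \<in> V" "w \<in> V" "u \<noteq> w"
    and g: "arc g" "pathstart g = p u" "pathfinish g = p w"
    and int: "\<And>t. 0 < t \<Longrightarrow> t < 1 \<Longrightarrow> g t \<notin> drawn V E p \<gamma>"
  shows "planar V (insert {u, w} E)"
proof (cases "{u, w} \<in> E")
  case True then show ?thesis using G D planar_iff_drawing by (metis insert_absorb)
next
  case False
  have gI: "path_image g \<inter> X = {p u, p w} \<inter> X" if "X \<subseteq> drawn V E p \<gamma>" for X
  proof -
    have "path_image g \<subseteq> {p u, p w} \<union> g ` {0<..<1}"
      unfolding path_image_def g(2)[symmetric] g(3)[symmetric] pathstart_def pathfinish_def by (force simp: less_le)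
    moreover have "g ` {0<..<1} \<inter> X = {}" using int that by auto
    moreover have "{p u, p w} \<subseteq> path_image g" using g by (metis empty_subsetI insert_subset pathfinish_in_path_image pathstart_in_path_image)
    ultimately show ?thesis by blast
  qed
  define \<gamma>' where "\<gamma>' = \<gamma>({u,w} := g)"
  have "p ` V \<subseteq> drawn V E p \<gamma>" by (auto simp: drawn_def)
  then have 1: "path_image g \<inter> p ` V = p ` {u, w}" using gI uw by auto
  have int_edge: "path_image g \<inter> path_image (\<gamma> e) = p ` ({u, w} \<inter> e)" if "e \<in> E" for e
  proof -
    have "path_image (\<gamma> e) \<subseteq> drawn V E p \<gamma>" using that by (auto simp: drawn_def)
    then have "path_image g \<inter> path_image (\<gamma> e) = {p u, p w} \<inter> path_image (\<gamma> e)" by (rule gI)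
    also have "\<dots> = {p u, p w} \<inter> p ` e" using D that uw unfolding drawing_def by blast
    also have "\<dots> = p ` ({u, w} \<inter> e)"
    proof -
      have "inj_on p V" "e \<subseteq> V" "{u, w} \<subseteq> V" using D that uw simple_graph_finite [OF G] by (auto simp: drawing_def)
      then show ?thesis using inj_on_image_Int [of p V "{u,w}" e] by simp
    qed
    finally show ?thesis .
  qed
  have old: "\<gamma>' e = \<gamma> e" if "e \<in> E" for e
    using that False by (auto simp: \<gamma>'_def)
  have new: "\<gamma>' {u, w} = g" by (simp add: \<gamma>'_def)
  have D': "inj_on p V" "\<And>e. e \<in> E \<Longrightarrow> arc (\<gamma> e) \<and> {pathstart (\<gamma> e), pathfinish (\<gamma> e)} = p ` e \<and> path_image (\<gamma> e) \<inter> p ` V = p ` e"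
    "\<And>e e'. e \<in> E \<Longrightarrow> e' \<in> E \<Longrightarrow> e \<noteq> e' \<Longrightarrow> path_image (\<gamma> e) \<inter> path_image (\<gamma> e') = p ` (e \<inter> e')"
    using D unfolding drawing_def by blast+
  have "drawing V (insert {u, w} E) p \<gamma>'"
    unfolding drawing_def
  proof (intro conjI ballI)
    show "inj_on p V" by (rule D')
  next
    fix e assume "e \<in> insert {u, w} E"
    then have "e = {u, w} \<or> e \<in> E" by blast
    then have "arc (\<gamma>' e) \<and> {pathstart (\<gamma>' e), pathfinish (\<gamma>' e)} = p ` e \<and> path_image (\<gamma>' e) \<inter> p ` V = p ` e"
    proof
      assume "e = {u, w}" then show ?thesis using g 1 by (simp add: new)
    next
      assume "e \<in> E" then show ?thesis using D'(2) old by metis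
    qed
    then show "arc (\<gamma>' e)" "{pathstart (\<gamma>' e), pathfinish (\<gamma>' e)} = p ` e" "path_image (\<gamma>' e) \<inter> p ` V = p ` e"
      by blast+
  next
    fix e e' assume ee: "e \<in> insert {u, w} E" "e' \<in> insert {u, w} E"
    show "e \<noteq> e' \<longrightarrow> path_image (\<gamma>' e) \<inter> path_image (\<gamma>' e') = p ` (e \<inter> e')"
    proof
      assume "e \<noteq> e'"
      then consider "e = {u, w}" "e' \<in> E" | "e' = {u, w}" "e \<in> E" | "e \<in> E" "e' \<in> E" using ee by blast
      then show "path_image (\<gamma>' e) \<inter> path_image (\<gamma>' e') = p ` (e \<inter> e')"
      proof cases
        case 1 then show ?thesis using int_edge [of e'] by (simp only: new old)
      next
        case 2 then show ?thesis using int_edge [of e] by (simp only: new old Int_commute)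
      next
        case 3 then show ?thesis using D'(3) [OF 3 \<open>e \<noteq> e'\<close>] by (simp only: old)
      qed
    qed
  qed
  moreover have "simple_graph V (insert {u, w} E)" using G uw by (auto simp: simple_graph_def)
  ultimately show ?thesis using planar_iff_drawing by metis
qed

lemma planar_insert_vertex_edge:
  assumes G: "simple_graph V E" and D: "drawing V E p \<gamma>" and w: "w \<in> V" "u \<noteq> w" and e: "e \<in> E" "u \<in> e"
    and g: "arc g" "pathstart g \<in> path_image (\<gamma> e) - p ` V" "pathfinish g = p w"
    and int: "\<And>t. 0 < t \<Longrightarrow> t < 1 \<Longrightarrow> g t \<notin> drawn V E p \<gamma>"
  shows "planar V (insert {u, w} E)"
proof (cases "w \<in> e")
  case True
  then have "{u, w} \<in> E" using simple_graphD [OF G e] w e by (metis insertE singletonD)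
  then show ?thesis using G D planar_iff_drawing by (metis insert_absorb)
next
  case False
  have "pathfinish g \<notin> path_image (\<gamma> e)"
  proof
    assume "pathfinish g \<in> path_image (\<gamma> e)"
    then have "p w \<in> path_image (\<gamma> e) \<inter> p ` V" using g(3) w by auto
    moreover have "path_image (\<gamma> e) \<inter> p ` V = p ` e" "inj_on p V" using D e unfolding drawing_def by auto
    moreover have "e \<subseteq> V" using simple_graph_finite [OF G] e by auto
    ultimately show False using False w inj_on_image_mem_iff [of p V w e] by simp
  qed
  then show ?thesis
  proof (rule slide_to_vertex [OF G D e g(1,2) _ int])
    fix p' \<gamma>' g' assume *: "drawing V E p' \<gamma>'" "arc g'" "pathstart g' = p' u"
      "\<And>t. 0 < t \<Longrightarrow> t < 1 \<Longrightarrow> g' t \<notin> drawn V E p' \<gamma>'"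
      "\<And>w. pathfinish g = p w \<Longrightarrow> pathfinish g' = p' w"
    have "u \<in> V" using simple_graphD [OF G e] by metis
    show ?thesis
      by (rule planar_insert_vertex_vertex [OF G *(1) \<open>u \<in> V\<close> w *(2,3) *(5) [OF g(3)] *(4)])
  qed
qed

text \<open>The start is slid to \<open>u\<close> first. The last conclusion of
  \<open>slide_to_vertex\<close> keeps the other end inside its edge, so the reversed arc is again
  one from an edge to a vertex.\<close>

lemma planar_insert_edge_edge:
  assumes G: "simple_graph V E" and D: "drawing V E p \<gamma>" and uw: "u \<noteq> w"
    and e: "e \<in> E" "u \<in> e" "e' \<in> E" "w \<in> e'"
    and g: "arc g" "pathstart g \<in> path_image (\<gamma> e) - p ` V" "pathfinish g \<in> path_image (\<gamma> e') - p ` V"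
    and int: "\<And>t. 0 < t \<Longrightarrow> t < 1 \<Longrightarrow> g t \<notin> drawn V E p \<gamma>"
  shows "planar V (insert {u, w} E)"
proof (cases "e = e'")
  case True
  then have "{u, w} \<in> E" using simple_graphD [OF G e(1,2)] uw e by (metis insertE singletonD)
  then show ?thesis using G D planar_iff_drawing by (metis insert_absorb)
next
  case False
  have ee: "e \<subseteq> V" using simple_graph_finite [OF G] e by auto
  have "path_image (\<gamma> e) \<inter> path_image (\<gamma> e') \<subseteq> p ` V" using D e False ee unfolding drawing_def by blast
  then have "pathfinish g \<notin> path_image (\<gamma> e)" using g(3) by blast
  then show ?thesis
  proof (rule slide_to_vertex [OF G D e(1,2) g(1,2) _ int])
    fix p' \<gamma>' g' assume *: "drawing V E p' \<gamma>'" "arc g'" "pathstart g' = p' u"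
      "\<And>t. 0 < t \<Longrightarrow> t < 1 \<Longrightarrow> g' t \<notin> drawn V E p' \<gamma>'"
      "\<And>e'. e' \<in> E \<Longrightarrow> pathfinish g \<in> path_image (\<gamma> e') - p ` V \<Longrightarrow> pathfinish g' \<in> path_image (\<gamma>' e') - p' ` V"
    have int': "reversepath g' t \<notin> drawn V E p' \<gamma>'" if "0 < t" "t < 1" for t
      using *(4) [of "1 - t"] that by (simp add: reversepath_def)
    have u: "u \<in> V" "w \<noteq> u" using e uw ee by auto
    have rev: "arc (reversepath g')" "pathstart (reversepath g') \<in> path_image (\<gamma>' e') - p' ` V"
      "pathfinish (reversepath g') = p' u" using *(2,3) *(5) [OF e(3) g(3)] by (simp_all add: arc_reversepath)
    have "planar V (insert {w, u} E)"
      by (rule planar_insert_vertex_edge [OF G *(1) u e(3,4) rev int'])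
    then show ?thesis by (simp add: insert_commute)
  qed
qed

section \<open>Distance layers\<close>

definition adj :: "'a set set \<Rightarrow> ('a \<times> 'a) set" where
  "adj E = {(a, b). {a, b} \<in> E}"

text \<open>Turns distances into least exponents of the relation \<open>adj E\<close>, so that walks
  are concatenated and split by \<open>relpow_add\<close>.\<close>

lemma walk_iff_relpow:
  "(\<exists>xs. walk E xs \<and> hd xs = u \<and> last xs = x \<and> length xs = Suc k) \<longleftrightarrow> (u, x) \<in> adj E ^^ k"
proof
  assume "\<exists>xs. walk E xs \<and> hd xs = u \<and> last xs = x \<and> length xs = Suc k"
  then obtain xs where xs: "walk E xs" "hd xs = u" "last xs = x" "length xs = Suc k" by blast
  then have "xs ! 0 = u" "xs ! k = x" "\<forall>i<k. (xs ! i, xs ! Suc i) \<in> adj E"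
    by (auto simp: walk_def adj_def hd_conv_nth last_conv_nth)
  then show "(u, x) \<in> adj E ^^ k" unfolding relpow_fun_conv by blast
next
  assume "(u, x) \<in> adj E ^^ k"
  then obtain f where f: "f 0 = u" "f k = x" "\<forall>i<k. (f i, f (Suc i)) \<in> adj E"
    unfolding relpow_fun_conv by blast
  define xs where "xs = map f [0..<Suc k]"
  have "walk E xs" "hd xs = u" "last xs = x" "length xs = Suc k"
    using f by (auto simp: xs_def walk_def adj_def hd_map last_map nth_append simp del: upt_Suc)
  then show "\<exists>xs. walk E xs \<and> hd xs = u \<and> last xs = x \<and> length xs = Suc k" by blast
qed

lemma gdist_eq_Least: "gdist E u x = (LEAST k. (u, x) \<in> adj E ^^ k)"
  unfolding gdist_def walk_iff_relpow ..

lemma adj_relpow_sym: "(a, b) \<in> adj E ^^ k \<longleftrightarrow> (b, a) \<in> adj E ^^ k"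
proof -
  have "(b, a) \<in> adj E ^^ k" if "(a, b) \<in> adj E ^^ k" for a b
    using that
  proof (induction k arbitrary: b)
    case (Suc k)
    then obtain c where "(a, c) \<in> adj E ^^ k" "(c, b) \<in> adj E" by auto
    then show ?case using Suc.IH relpow_Suc_I2 [of b c "adj E" a k] by (auto simp: adj_def insert_commute)
  qed simp
  then show ?thesis by blast
qed

lemma walk_stays:
  assumes "walk E xs" "set xs \<subseteq> W" "hd xs \<in> X" "\<And>a b. a \<in> X \<Longrightarrow> b \<in> W - X \<Longrightarrow> {a, b} \<notin> E"
  shows "last xs \<in> X"
proof -
  have "i < length xs \<Longrightarrow> xs ! i \<in> X" for i
  proof (induction i)
    case 0 then show ?case using assms(1,3) by (simp add: walk_def hd_conv_nth)
  next
    case (Suc i)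
    then have "{xs ! i, xs ! Suc i} \<in> E" "xs ! Suc i \<in> W" "xs ! i \<in> X"
      using assms(1,2) by (auto simp: walk_def)
    then show ?case using assms(4) by blast
  qed
  then show ?thesis using assms(1) by (simp add: walk_def last_conv_nth)
qed

lemma walk_snoc:
  assumes "walk E xs" "{last xs, b} \<in> E"
  shows "walk E (xs @ [b])"
  unfolding walk_def
proof (intro conjI allI impI)
  fix i assume i: "Suc i < length (xs @ [b])"
  show "{(xs @ [b]) ! i, (xs @ [b]) ! Suc i} \<in> E"
  proof (cases "Suc i < length xs")
    case True then show ?thesis using assms(1) by (simp add: walk_def nth_append)
  next
    case False
    then have "Suc i = length xs" using i by simp
    then have "i = length xs - 1" "i < length xs" by auto
    then have "xs ! i = last xs" using assms(1) by (simp add: walk_def last_conv_nth)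
    then show ?thesis using assms(2) \<open>Suc i = length xs\<close> \<open>i < length xs\<close> by (simp add: nth_append)
  qed
qed simp

lemma connected_on_iff_no_cut:
  "connected_on E W \<longleftrightarrow> (\<forall>X\<subseteq>W. X \<noteq> {} \<and> (\<forall>a\<in>X. \<forall>b\<in>W - X. {a, b} \<notin> E) \<longrightarrow> X = W)"
proof (intro iffI allI impI)
  fix X assume *: "connected_on E W" "X \<subseteq> W" "X \<noteq> {} \<and> (\<forall>a\<in>X. \<forall>b\<in>W - X. {a, b} \<notin> E)"
  then obtain a where "a \<in> X" by blast
  have "w \<in> X" if w: "w \<in> W" for w
  proof -
    have "a \<in> W" using \<open>a \<in> X\<close> * by blast
    then obtain xs where "walk E xs" "set xs \<subseteq> W" "hd xs = a" "last xs = w"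
      using *(1) w unfolding connected_on_def by blast
    then show ?thesis using walk_stays [of E xs W X] * \<open>a \<in> X\<close> by blast
  qed
  then show "X = W" using * by blast
next
  assume *: "\<forall>X\<subseteq>W. X \<noteq> {} \<and> (\<forall>a\<in>X. \<forall>b\<in>W - X. {a, b} \<notin> E) \<longrightarrow> X = W"
  show "connected_on E W" unfolding connected_on_def
  proof (intro ballI)
    fix u w assume uw: "u \<in> W" "w \<in> W"
    define X where "X = {z. \<exists>xs. walk E xs \<and> set xs \<subseteq> W \<and> hd xs = u \<and> last xs = z}"
    have "u \<in> X" unfolding X_def using uw by (intro CollectI exI [of _ "[u]"]) (auto simp: walk_def)
    have "X \<subseteq> W"
    proof
      fix z assume "z \<in> X"
      then obtain xs where "walk E xs" "set xs \<subseteq> W" "last xs = z" unfolding X_def by blast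
      moreover from this have "xs \<noteq> []" by (simp add: walk_def)
      ultimately show "z \<in> W" using last_in_set by blast
    qed
    have "{a, b} \<notin> E" if ab: "a \<in> X" "b \<in> W - X" for a b
    proof
      assume "{a, b} \<in> E"
      obtain xs where xs: "walk E xs" "set xs \<subseteq> W" "hd xs = u" "last xs = a" using ab(1) unfolding X_def by blast
      then have "walk E (xs @ [b])" using \<open>{a, b} \<in> E\<close> walk_snoc [OF xs(1), of b] by simp
      moreover have "hd (xs @ [b]) = u" using xs by (simp add: walk_def)
      moreover have "set (xs @ [b]) \<subseteq> W" "last (xs @ [b]) = b" using xs ab by auto
      ultimately have "b \<in> X" unfolding X_def by blast
      then show False using ab by blast
    qed
    then have "X = W" using * \<open>u \<in> X\<close> \<open>X \<subseteq> W\<close> by blast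
    then show "\<exists>xs. walk E xs \<and> set xs \<subseteq> W \<and> hd xs = u \<and> last xs = w"
      using uw(2) unfolding X_def by blast
  qed
qed

lemma connected_onD:
  assumes "connected_on E W" "a \<in> X" "a \<in> W" "b \<in> W" "b \<notin> X"
  obtains x y where "x \<in> X \<inter> W" "y \<in> W - X" "{x, y} \<in> E"
proof -
  have "X \<inter> W \<noteq> W" "X \<inter> W \<noteq> {}" "X \<inter> W \<subseteq> W" using assms by auto
  then obtain x y where "x \<in> X \<inter> W" "y \<in> W - X \<inter> W" "{x, y} \<in> E"
    using assms(1)[unfolded connected_on_iff_no_cut, rule_format, of "X \<inter> W"] by blast
  then show thesis using that by blast
qed

section \<open>Distances, eccentricity and radius in a connected graph\<close>

locale conn_graph =
  fixes V :: "'a set" and E :: "'a set set"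
  assumes simple: "simple_graph V E" and conn: "connected_on E V"
begin

lemma finV: "finite V" using simple by (simp add: simple_graph_def)

lemma edgeV: "{a, b} \<in> E \<Longrightarrow> a \<in> V \<and> b \<in> V \<and> a \<noteq> b"
  using simple unfolding simple_graph_def by (metis doubleton_eq_iff)

lemma reach: 
  assumes "u \<in> V" "x \<in> V"
  shows "(u, x) \<in> adj E ^^ gdist E u x"
proof -
  obtain xs where xs: "walk E xs" "hd xs = u" "last xs = x"
    using conn assms unfolding connected_on_def by blast
  then obtain k where "length xs = Suc k" by (cases xs) (auto simp: walk_def)
  then have "(u, x) \<in> adj E ^^ k" using xs walk_iff_relpow by metis
  then show ?thesis unfolding gdist_eq_Least by (rule LeastI)
qed

lemma gdist_le: "(u, x) \<in> adj E ^^ k \<Longrightarrow> gdist E u x \<le> k"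
  unfolding gdist_eq_Least by (rule Least_le)

lemma gdist_sym: "gdist E u x = gdist E x u"
  unfolding gdist_eq_Least using adj_relpow_sym by metis

lemma gdist_self [simp]: "gdist E u u = 0"
  using gdist_le [of u u 0] by simp

lemma gdist_eq_0: "u \<in> V \<Longrightarrow> x \<in> V \<Longrightarrow> gdist E u x = 0 \<longleftrightarrow> u = x"
  using reach [of u x] by auto

lemma gdist_triangle:
  assumes "u \<in> V" "x \<in> V" "w \<in> V"
  shows "gdist E u w \<le> gdist E u x + gdist E x w"
  using reach [of u x] reach [of x w] assms by (intro gdist_le) (auto simp: relpow_add)

lemma gdist_edge: "{a, b} \<in> E \<Longrightarrow> gdist E a b \<le> 1"
  by (rule gdist_le) (auto simp: adj_def)

lemma gdist_edge_le: "u \<in> V \<Longrightarrow> {a, b} \<in> E \<Longrightarrow> gdist E u b \<le> gdist E u a + 1"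
  using gdist_triangle [of u a b] gdist_edge [of a b] edgeV [of a b] by simp

lemma relpow_V: "(u, x) \<in> adj E ^^ k \<Longrightarrow> u \<in> V \<Longrightarrow> x \<in> V"
proof (induction k arbitrary: x)
  case (Suc k)
  then obtain y where "(y, x) \<in> adj E" by auto
  then show ?case using edgeV [of y x] by (simp add: adj_def)
qed simp

lemma gdist_split:
  assumes "u \<in> V" "x \<in> V" "t \<le> gdist E u x"
  obtains z where "z \<in> V" "gdist E u z = t" "gdist E z x = gdist E u x - t"
proof -
  have "(u, x) \<in> adj E ^^ (t + (gdist E u x - t))" using reach [OF assms(1,2)] assms(3) by simp
  then obtain z where z: "(u, z) \<in> adj E ^^ t" "(z, x) \<in> adj E ^^ (gdist E u x - t)"
    unfolding relpow_add by auto
  then have "z \<in> V" using relpow_V assms(1) by blast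
  moreover have "gdist E u z \<le> t" "gdist E z x \<le> gdist E u x - t" using z gdist_le by blast+
  moreover have "gdist E u x \<le> gdist E u z + gdist E z x" using gdist_triangle assms \<open>z \<in> V\<close> by blast
  ultimately show thesis using that [of z] assms(3) by simp
qed

lemma gdist_pred:
  assumes "u \<in> V" "x \<in> V" "gdist E u x = Suc m"
  obtains z where "{z, x} \<in> E" "gdist E u z = m"
proof -
  have "(u, x) \<in> adj E ^^ Suc m" using reach assms by metis
  then obtain z where z: "(u, z) \<in> adj E ^^ m" "{z, x} \<in> E" by (auto simp: adj_def)
  have "gdist E u z \<le> m" using z gdist_le by blast
  moreover have "Suc m \<le> gdist E u z + 1" using gdist_edge_le [OF assms(1) z(2)] assms(3) by simp
  ultimately show thesis using that z by simp
qed

definition layer :: "'a \<Rightarrow> nat \<Rightarrow> 'a set" where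
  "layer v i = {x \<in> V. gdist E v x = i}"

lemma finite_layer: "finite (layer v i)" using finV by (simp add: layer_def)

lemma ecc_ge: "x \<in> V \<Longrightarrow> gdist E v x \<le> eccentricity V E v"
  unfolding eccentricity_def using finV by simp

lemma ecc_attained: "v \<in> V \<Longrightarrow> \<exists>x\<in>V. gdist E v x = eccentricity V E v"
proof -
  assume "v \<in> V"
  then have "eccentricity V E v \<in> (\<lambda>x. gdist E v x) ` V" unfolding eccentricity_def using finV by (intro Max_in) auto
  then show ?thesis by (auto simp: image_iff)
qed

lemma ex_central: "V \<noteq> {} \<Longrightarrow> \<exists>v. central_vertex V E v"
proof -
  assume "V \<noteq> {}"
  then obtain u where "u \<in> V" by blast
  then obtain v where "v \<in> V" "\<forall>y. y \<in> V \<longrightarrow> eccentricity V E v \<le> eccentricity V E y"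
    using ex_has_least_nat [of "\<lambda>v. v \<in> V" u "eccentricity V E"] by auto
  then show ?thesis unfolding central_vertex_def by blast
qed

text \<open>\<open>v'\<close> lies on a shortest path from \<open>v\<close> to \<open>y\<close>, at
  distance \<open>t\<close> from \<open>v\<close>. Vertices of \<open>R\<close> are within
  \<open>(i - t) + (t - 1) < i\<close> of \<open>v'\<close>, so everything behind \<open>R\<close>
  comes closer. A vertex up to layer \<open>i\<close> recedes by at most \<open>t\<close>, and
  reaches distance \<open>r\<close> only if \<open>i + t = r\<close> and it lies in layer
  \<open>i\<close> outside \<open>R\<close>.\<close>

lemma move_towards_layer:
  assumes v: "v \<in> V" and r: "\<And>x. x \<in> V \<Longrightarrow> gdist E v x \<le> r"
    and R: "R \<subseteq> layer v i" "y \<in> R" "\<And>y'. y' \<in> R \<Longrightarrow> gdist E y y' < t"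
    and cross: "\<And>x. x \<in> V \<Longrightarrow> i < gdist E v x \<Longrightarrow> \<exists>s\<in>R. gdist E v x = i + gdist E s x"
    and t: "t \<le> i" "i + t \<le> r"
  obtains v' where "v' \<in> V" "\<And>x. x \<in> V \<Longrightarrow> gdist E v' x \<le> r"
    "\<And>x. x \<in> V \<Longrightarrow> gdist E v' x = r \<Longrightarrow> i + t = r \<and> x \<in> layer v i - R"
proof -
  have y: "y \<in> V" "gdist E v y = i" using R by (auto simp: layer_def)
  obtain v' where v': "v' \<in> V" "gdist E v v' = t" "gdist E v' y = i - t"
    using gdist_split [OF v y(1)] t y by metis
  have R_close: "gdist E v' s < i" if "s \<in> R" for s
  proof -
    have "s \<in> V" using that R by (auto simp: layer_def)
    then show ?thesis using gdist_triangle [of v' y s] R(3) [OF that] v' y t by simp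
  qed
  have *: "gdist E v' x < r \<or> (gdist E v' x \<le> r \<and> i + t = r \<and> x \<in> layer v i - R)" if x: "x \<in> V" for x
  proof (cases "i < gdist E v x")
    case True
    then obtain s where s: "s \<in> R" "gdist E v x = i + gdist E s x" using cross x by blast
    have "s \<in> V" using s R by (auto simp: layer_def)
    then have "gdist E v' x \<le> gdist E v' s + gdist E s x" using gdist_triangle v' x by blast
    then show ?thesis using R_close [OF s(1)] s(2) r [OF x] by simp
  next
    case False
    have le: "gdist E v' x \<le> t + gdist E v x"
      using gdist_triangle [of v' v x] v v' x gdist_sym [of v v'] by simp
    show ?thesis
    proof (cases "x \<in> R")
      case True then show ?thesis using R_close [OF True] t by simp
    next
      case nR: False
      show ?thesis
      proof (cases "gdist E v x = i \<and> i + t = r")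
        case True then show ?thesis using le nR x by (auto simp: layer_def)
      next
        case False' : False
        then show ?thesis using le False t by auto
      qed
    qed
  qed
  show thesis
  proof (rule that [OF v'(1)])
    show "gdist E v' x \<le> r" if "x \<in> V" for x using * [OF that] by auto
    show "i + t = r \<and> x \<in> layer v i - R" if "x \<in> V" "gdist E v' x = r" for x using * [OF that(1)] that(2) by auto
  qed
qed

lemma central_move:
  assumes "central_vertex V E v" "v' \<in> V"
  obtains x where "x \<in> V" "eccentricity V E v \<le> gdist E v' x"
  using assms ecc_attained [of v'] unfolding central_vertex_def by metis

lemma sum_layers:
  assumes "\<And>x. x \<in> V \<Longrightarrow> gdist E v x \<le> r"
  shows "card V = (\<Sum>j\<le>r. card (layer v j))" "(\<Sum>x\<in>V. gdist E v x) = (\<Sum>j\<le>r. j * card (layer v j))"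
proof -
  have img: "gdist E v ` V \<subseteq> {..r}" using assms by auto
  have "(\<Sum>x\<in>V. h x) = (\<Sum>j\<le>r. \<Sum>x\<in>layer v j. h x)" for h :: "'a \<Rightarrow> nat"
    unfolding layer_def using sum.group [OF finV _ img, of h] by simp
  note * = this
  show "card V = (\<Sum>j\<le>r. card (layer v j))" using * [of "\<lambda>_. 1"] by simp
  have "(\<Sum>x\<in>layer v j. gdist E v x) = j * card (layer v j)" for j by (simp add: layer_def)
  then show "(\<Sum>x\<in>V. gdist E v x) = (\<Sum>j\<le>r. j * card (layer v j))" using * [of "gdist E v"] by simp
qed

lemma layer_0: "v \<in> V \<Longrightarrow> layer v 0 = {v}"
  using gdist_eq_0 by (auto simp: layer_def)

lemma layer_nonempty:
  assumes "v \<in> V" "i \<le> eccentricity V E v"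
  shows "layer v i \<noteq> {}"
proof -
  obtain x where x: "x \<in> V" "gdist E v x = eccentricity V E v" using ecc_attained assms by blast
  then obtain z where "z \<in> V" "gdist E v z = i" using gdist_split [OF assms(1) x(1), of i] assms(2) by metis
  then show ?thesis by (auto simp: layer_def)
qed

text \<open>Were the least eccentricity larger, some inner layer of a central vertex would consist
  of one vertex, and a single step towards it would lower the eccentricity. The lemma is later
  applied to an auxiliary graph on part of a layer.\<close>

lemma radius_le_half:
  assumes "V \<noteq> {}"
  shows "\<exists>y\<in>V. \<forall>x\<in>V. gdist E y x \<le> card V div 2"
proof -
  obtain y where c: "central_vertex V E y" using ex_central [OF assms] by blast
  then have y: "y \<in> V" by (simp add: central_vertex_def)
  define e where "e = eccentricity V E y"
  have "2 * e \<le> card V"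
  proof (rule ccontr)
    assume small: "\<not> 2 * e \<le> card V"
    then have "e > 0" by auto
    \<comment> \<open>Otherwise \<open>card V\<close> would be at least
      \<open>1 + 2 * (e - 1) + 1 = 2 * e\<close>.\<close>
    have "\<exists>i\<in>{1..<e}. card (layer y i) < 2"
    proof (rule ccontr)
      assume "\<not> ?thesis"
      then have big: "2 \<le> card (layer y i)" if "i \<in> {1..<e}" for i using that by force
      have "{..e} = insert 0 (insert e {1..<e})" using \<open>e > 0\<close> by auto
      then have "card V = card (layer y 0) + (card (layer y e) + (\<Sum>j\<in>{1..<e}. card (layer y j)))"
        using sum_layers(1) [of y e] ecc_ge [of _ y] \<open>e > 0\<close> by (simp add: e_def)
      moreover have "(\<Sum>j\<in>{1..<e}. 2) \<le> (\<Sum>j\<in>{1..<e}. card (layer y j))" using big by (intro sum_mono) auto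
      moreover have "1 \<le> card (layer y e)"
        using layer_nonempty [OF y, of e] finite_layer by (simp add: e_def Suc_le_eq card_gt_0_iff)
      moreover have "card (layer y 0) = 1" using layer_0 [OF y] by simp
      ultimately show False using small \<open>e > 0\<close> by simp
    qed
    then obtain i where i: "1 \<le> i" "i < e" "card (layer y i) < 2" by auto
    moreover have "card (layer y i) \<noteq> 0"
      using layer_nonempty [OF y, of i] finite_layer i by (simp add: e_def)
    ultimately have "card (layer y i) = 1" by linarith
    then obtain z where z: "layer y i = {z}" by (auto simp: card_1_singleton_iff)
    have cross: "\<exists>s\<in>{z}. gdist E y x = i + gdist E s x" if x: "x \<in> V" "i < gdist E y x" for x
    proof -
      obtain s where s: "s \<in> V" "gdist E y s = i" "gdist E s x = gdist E y x - i"
        using gdist_split [OF y x(1), of i] x(2) by (metis less_imp_le)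
      then have "s \<in> layer y i" by (simp add: layer_def)
      then show ?thesis using s x z by simp
    qed
    have le: "gdist E y x \<le> e" if "x \<in> V" for x using ecc_ge [OF that] by (simp add: e_def)
    have close: "gdist E z y' < 1" if "y' \<in> {z}" for y' using that by simp
    show False
    proof (rule move_towards_layer [where i = i and t = 1, OF y le _ _ close cross])
      fix y' assume y': "y' \<in> V" "\<And>x. x \<in> V \<Longrightarrow> gdist E y' x \<le> e"
        "\<And>x. x \<in> V \<Longrightarrow> gdist E y' x = e \<Longrightarrow> i + 1 = e \<and> x \<in> layer y i - {z}"
      obtain x where "x \<in> V" "e \<le> gdist E y' x" using central_move [OF c y'(1)] unfolding e_def by metis
      then show False using y'(2,3) [of x] z by auto
    qed (use i z in auto)
  qed
  then have "e \<le> card V div 2" by simp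
  then have "\<forall>x\<in>V. gdist E y x \<le> card V div 2" using ecc_ge [of _ y] order_trans unfolding e_def by blast
  then show ?thesis using y by blast
qed

end

section \<open>Linked sets and small layers\<close>

context conn_graph begin

text \<open>Connectedness, in cut form, of the graph on \<open>R\<close> that joins vertices at
  distance at most \<open>d\<close> in the whole graph.\<close>

definition linked :: "nat \<Rightarrow> 'a set \<Rightarrow> bool" where
  "linked d R \<longleftrightarrow> (\<forall>X\<subseteq>R. X \<noteq> {} \<and> X \<noteq> R \<longrightarrow> (\<exists>a\<in>X. \<exists>b\<in>R - X. gdist E a b \<le> d))"

lemma linkedD:
  assumes "linked d R" "X \<subseteq> R" "X \<noteq> {}" "X \<noteq> R"
  obtains a b where "a \<in> X" "b \<in> R - X" "gdist E a b \<le> d"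
  using assms unfolding linked_def by meson

text \<open>All that the counting takes from the plane. \<open>S\<close> will be the neighbourhood
  of the part of the graph around \<open>x\<close> beyond layer \<open>i\<close>; its last property
  says that a shortest path from \<open>v\<close> to \<open>x\<close> passes through it.\<close>

definition thick :: "nat \<Rightarrow> nat \<Rightarrow> bool" where
  "thick d k \<longleftrightarrow> (\<forall>v\<in>V. \<forall>i\<ge>1. \<forall>x\<in>V. i < gdist E v x \<longrightarrow>
     (\<exists>S\<subseteq>layer v i. k \<le> card S \<and> linked d S \<and> (\<exists>s\<in>S. gdist E v x = i + gdist E s x)))"

text \<open>\<open>radius_le_half\<close> for the graph \<open>H\<close> of pairs at distance at
  most \<open>d\<close>; each step in \<open>H\<close> costs at most \<open>d\<close> in the
  original graph.\<close>

lemma linked_center: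
  assumes R: "linked d R" "R \<subseteq> V" "R \<noteq> {}"
  shows "\<exists>y\<in>R. \<forall>x\<in>R. gdist E y x \<le> d * (card R div 2)"
proof -
  define H where "H = {{a, b} | a b. a \<in> R \<and> b \<in> R \<and> a \<noteq> b \<and> gdist E a b \<le> d}"
  have H: "{a, b} \<in> H \<longleftrightarrow> a \<in> R \<and> b \<in> R \<and> a \<noteq> b \<and> gdist E a b \<le> d" for a b
    unfolding H_def using gdist_sym [of a b] by (auto simp: doubleton_eq_iff)
  have "finite R" using R finV finite_subset by blast
  interpret H: conn_graph R H
  proof
    show "simple_graph R H" using \<open>finite R\<close> unfolding simple_graph_def H_def by blast
    show "connected_on H R"
      unfolding connected_on_iff_no_cut
    proof (intro allI impI)
      fix X assume X: "X \<subseteq> R" "X \<noteq> {} \<and> (\<forall>a\<in>X. \<forall>b\<in>R - X. {a, b} \<notin> H)"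
      show "X = R"
      proof (rule ccontr)
        assume "X \<noteq> R"
        obtain a b where "a \<in> X" "b \<in> R - X" "gdist E a b \<le> d"
          by (rule linkedD [OF R(1) X(1) _ \<open>X \<noteq> R\<close>]) (use X in auto)
        then show False using X H [of a b] by auto
      qed
    qed
  qed
  have gd: "gdist E a b \<le> d * m" if "(a, b) \<in> adj H ^^ m" "a \<in> R" for a b m
    using that
  proof (induction m arbitrary: b)
    case 0 then show ?case by simp
  next
    case (Suc m)
    then obtain c where c: "(a, c) \<in> adj H ^^ m" "(c, b) \<in> adj H" by auto
    then have cb: "c \<in> R" "b \<in> R" "gdist E c b \<le> d" using H by (auto simp: adj_def)
    have "gdist E a b \<le> gdist E a c + gdist E c b" using gdist_triangle cb Suc.prems R(2) by blast
    then show ?case using Suc.IH [OF c(1) Suc.prems(2)] cb(3) by simp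
  qed
  obtain y where y: "y \<in> R" "\<forall>x\<in>R. gdist H y x \<le> card R div 2" using H.radius_le_half R(3) by blast
  have "gdist E y x \<le> d * (card R div 2)" if "x \<in> R" for x
  proof -
    have "gdist E y x \<le> d * gdist H y x" using gd [OF H.reach [OF y(1) that] y(1)] .
    also have "\<dots> \<le> d * (card R div 2)" using y(2) that by simp
    finally show ?thesis .
  qed
  then show ?thesis using y(1) by blast
qed

lemma layer_ge:
  assumes th: "thick d k" and v: "v \<in> V" and i: "1 \<le> i" "i < eccentricity V E v"
  shows "k \<le> card (layer v i)"
proof -
  obtain x where "x \<in> V" "gdist E v x = eccentricity V E v" using ecc_attained [OF v] by blast
  then obtain S where "S \<subseteq> layer v i" "k \<le> card S" using th v i unfolding thick_def by metis
  then show ?thesis using card_mono [OF finite_layer] order_trans by blast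
qed

text \<open>In a layer of fewer than \<open>2 * k\<close> vertices any two of the cutting sets meet, so that their
  union is linked.\<close>

lemma small_layer:
  assumes th: "thick d k" and v: "v \<in> V" and i: "1 \<le> i" "i < eccentricity V E v"
    and small: "card (layer v i) < 2 * k"
  obtains R y where "R \<subseteq> layer v i" "k \<le> card R" "y \<in> R" "\<And>y'. y' \<in> R \<Longrightarrow> gdist E y y' \<le> d * (card R div 2)"
    "\<And>x. x \<in> V \<Longrightarrow> i < gdist E v x \<Longrightarrow> \<exists>s\<in>R. gdist E v x = i + gdist E s x"
proof -
  define B where "B = {x \<in> V. i < gdist E v x}"
  have "\<forall>x\<in>B. \<exists>S. S \<subseteq> layer v i \<and> k \<le> card S \<and> linked d S \<and> (\<exists>s\<in>S. gdist E v x = i + gdist E s x)"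
    using th v i(1) unfolding thick_def B_def by blast
  then obtain S where S: "\<And>x. x \<in> B \<Longrightarrow> S x \<subseteq> layer v i" "\<And>x. x \<in> B \<Longrightarrow> k \<le> card (S x)"
    "\<And>x. x \<in> B \<Longrightarrow> linked d (S x)" "\<And>x. x \<in> B \<Longrightarrow> \<exists>s\<in>S x. gdist E v x = i + gdist E s x" by metis
  define R where "R = (\<Union>x\<in>B. S x)"
  have R: "R \<subseteq> layer v i" using S(1) unfolding R_def by blast
  obtain x0 where x0: "x0 \<in> V" "gdist E v x0 = eccentricity V E v" using ecc_attained [OF v] by blast
  then have "x0 \<in> B" using i by (simp add: B_def)
  then have "S x0 \<subseteq> R" by (auto simp: R_def)
  have finR: "finite R" using R finite_layer finite_subset by blast
  have kR: "k \<le> card R" using S(2) [OF \<open>x0 \<in> B\<close>] card_mono [OF finR \<open>S x0 \<subseteq> R\<close>] by simp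
  have "linked d R" unfolding linked_def
  proof (intro allI impI, rule ccontr)
    fix X assume X: "X \<subseteq> R" "X \<noteq> {} \<and> X \<noteq> R" and no: "\<not> (\<exists>a\<in>X. \<exists>b\<in>R - X. gdist E a b \<le> d)"
    \<comment> \<open>A linked set lies on one side of the cut \<open>X\<close>. If both sides
      occur, two disjoint sets of at least \<open>k\<close> vertices fit into the layer.\<close>
    have dich: "S x \<subseteq> X \<or> S x \<inter> X = {}" if xB: "x \<in> B" for x
    proof (rule ccontr)
      assume *: "\<not> ?thesis"
      have "S x \<subseteq> R" using xB by (auto simp: R_def)
      have "S x \<inter> X \<noteq> {}" "S x \<inter> X \<noteq> S x" using * by auto
      then obtain a b where "a \<in> S x \<inter> X" "b \<in> S x - S x \<inter> X" "gdist E a b \<le> d"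
        using linkedD [OF S(3) [OF xB], of "S x \<inter> X"] by (metis Int_lower1)
      then show False using no \<open>S x \<subseteq> R\<close> by blast
    qed
    obtain a b where ab: "a \<in> X" "b \<in> R - X" using X by blast
    obtain x1 where x1: "x1 \<in> B" "a \<in> S x1" using ab X unfolding R_def by blast
    obtain x2 where x2: "x2 \<in> B" "b \<in> S x2" using ab unfolding R_def by blast
    have "S x1 \<inter> S x2 = {}" using dich [OF x1(1)] dich [OF x2(1)] x1(2) x2(2) ab by blast
    moreover have "finite (S x1)" "finite (S x2)" using S(1) x1 x2 finite_layer finite_subset by meson+
    ultimately have "card (S x1) + card (S x2) = card (S x1 \<union> S x2)" by (simp add: card_Un_disjoint)
    also have "\<dots> \<le> card (layer v i)" using S(1) x1 x2 by (intro card_mono finite_layer) auto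
    finally show False using S(2) [OF x1(1)] S(2) [OF x2(1)] small by simp
  qed
  moreover have "R \<subseteq> V" using R by (auto simp: layer_def)
  moreover have "R \<noteq> {}" using S(4) [OF \<open>x0 \<in> B\<close>] \<open>S x0 \<subseteq> R\<close> by blast
  ultimately obtain y where y: "y \<in> R" "\<forall>x\<in>R. gdist E y x \<le> d * (card R div 2)" using linked_center by blast
  have cross: "\<exists>s\<in>R. gdist E v x = i + gdist E s x" if "x \<in> V" "i < gdist E v x" for x
    using S(4) [of x] that unfolding R_def B_def by blast
  show thesis by (rule that [OF R kR y(1) _ cross]) (use y(2) in auto)
qed

text \<open>As \<open>v\<close> is central, moving it towards the centre of \<open>R\<close> cannot
  lower the eccentricity, so the exceptional case of \<open>move_towards_layer\<close> occurs and
  \<open>R\<close> misses a vertex of the layer. Since \<open>R\<close> has at least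
  \<open>k\<close> vertices, the layer has more. The vertex reached is again central, and its
  farthest vertices lie in \<open>layer v i - R\<close>, which turns out to be a single
  vertex.\<close>

lemma small_layer_move:
  assumes th: "thick d k" and d: "0 < d" and c: "central_vertex V E v"
    and small: "card (layer v i) < 2 * k" and t: "t = d * (card (layer v i) div 2) + 1" "t \<le> i"
    and it: "i + t \<le> eccentricity V E v"
  shows "i + t = eccentricity V E v" "card (layer v i) \<noteq> k"
    "\<exists>w. central_vertex V E w \<and> card (layer w (eccentricity V E v)) = 1"
proof -
  define r where "r = eccentricity V E v"
  have v: "v \<in> V" using c by (simp add: central_vertex_def)
  have i: "1 \<le> i" "i < eccentricity V E v" using t it by auto
  obtain R y where R: "R \<subseteq> layer v i" "k \<le> card R" "y \<in> R" "\<And>y'. y' \<in> R \<Longrightarrow> gdist E y y' \<le> d * (card R div 2)"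
    "\<And>x. x \<in> V \<Longrightarrow> i < gdist E v x \<Longrightarrow> \<exists>s\<in>R. gdist E v x = i + gdist E s x"
    using small_layer [OF th v i small] by metis
  \<comment> \<open>The length of the move is computed from \<open>R\<close>, whereas
    \<open>t\<close> comes from the whole layer. The exceptional case needs
    \<open>i + u = r\<close>, which forces \<open>u = t\<close>.\<close>
  define u where "u = d * (card R div 2) + 1"
  have cR: "card R \<le> card (layer v i)" using R(1) finite_layer card_mono by blast
  then have "u \<le> t" unfolding u_def t(1) by (simp add: div_le_mono)
  obtain v' where v': "v' \<in> V" "\<And>x. x \<in> V \<Longrightarrow> gdist E v' x \<le> r"
    "\<And>x. x \<in> V \<Longrightarrow> gdist E v' x = r \<Longrightarrow> i + u = r \<and> x \<in> layer v i - R"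
  proof (rule move_towards_layer [where v = v and R = R and y = y and t = u and i = i and r = r])
    show "gdist E v x \<le> r" if "x \<in> V" for x using ecc_ge [OF that] by (simp add: r_def)
    show "gdist E y y' < u" if "y' \<in> R" for y' using R(4) [OF that] by (simp add: u_def)
    show "\<exists>s\<in>R. gdist E v x = i + gdist E s x" if "x \<in> V" "i < gdist E v x" for x using R(5) that by blast
  qed (use v R t it \<open>u \<le> t\<close> in \<open>auto simp: r_def\<close>)
  obtain x where x: "x \<in> V" "r \<le> gdist E v' x" using central_move [OF c v'(1)] unfolding r_def by metis
  then have xr: "gdist E v' x = r" using v'(2) [OF x(1)] by simp
  then have *: "i + u = r" "x \<in> layer v i - R" using v'(3) x by auto
  then have "u = t" using it \<open>u \<le> t\<close> by (simp add: r_def)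
  then show "i + t = eccentricity V E v" using * by (simp add: r_def)
  have "R \<noteq> layer v i" using * by auto
  then have lt: "card R < card (layer v i)" using R(1) finite_layer psubset_card_mono by blast
  then show "card (layer v i) \<noteq> k" using R(2) by simp
  have "card R div 2 = card (layer v i) div 2" using \<open>u = t\<close> d by (simp add: u_def t(1))
  moreover have "card (layer v i - R) = card (layer v i) - card R"
    using R(1) finite_layer by (meson card_Diff_subset finite_subset)
  \<comment> \<open>Halves that agree after rounding down leave room for a difference of 1
    only.\<close>
  ultimately have one: "card (layer v i - R) \<le> 1" using lt by presburger
  have sub: "layer v' r \<subseteq> layer v i - R"
  proof
    fix z assume "z \<in> layer v' r"
    then show "z \<in> layer v i - R" using v'(3) [of z] by (auto simp: layer_def)
  qed
  have "card (layer v' r) \<le> 1" using card_mono [OF _ sub] one finite_layer by (meson finite_Diff order_trans)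
  moreover have "x \<in> layer v' r" using x xr by (simp add: layer_def)
  then have "card (layer v' r) \<noteq> 0" using finite_layer by auto
  ultimately have "card (layer v' r) = 1" by linarith
  moreover have "central_vertex V E v'"
  proof -
    obtain z where "z \<in> V" "gdist E v' z = eccentricity V E v'" using ecc_attained v'(1) by blast
    then have "eccentricity V E v' \<le> r" using v'(2) by metis
    then show ?thesis using c v'(1) unfolding central_vertex_def r_def by (meson order_trans)
  qed
  ultimately show "\<exists>w. central_vertex V E w \<and> card (layer w (eccentricity V E v)) = 1"
    unfolding r_def by blast
qed

end

section \<open>Weighted counting of layers\<close>

text \<open>Write \<open>j\<close> as \<open>s - (s - j)\<close> and insert the lower bounds with
  the nonnegative weights \<open>s - j\<close>; layer \<open>s\<close> has weight 0, so
  \<open>low\<close> stops before it. \<open>a\<close> and \<open>b\<close> are the shortfalls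
  against \<open>2 * k\<close>, counted from the first and from the last layer.\<close>

lemma weighted_layer_sum_le:
  fixes N a b :: "nat \<Rightarrow> int" and k :: int
  assumes low: "\<And>j. j < s \<Longrightarrow> 2 * k - a j - b (s - j) \<le> N j"
  shows "(\<Sum>j\<le>s. int j * N j) \<le>
    int s * (\<Sum>j\<le>s. N j) - k * int s * (int s + 1) + (\<Sum>j\<le>s. (int s - int j) * a j) + (\<Sum>j\<le>s. int j * b j)"
proof -
  have "(\<Sum>j\<le>s. (int s - int j) * (2 * k - a j - b (s - j))) \<le> (\<Sum>j\<le>s. (int s - int j) * N j)"
  proof (rule sum_mono)
    fix j assume "j \<in> {..s}"
    then show "(int s - int j) * (2 * k - a j - b (s - j)) \<le> (int s - int j) * N j"
      using low [of j] by (cases "j = s") (auto intro: mult_left_mono)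
  qed
  moreover have "(\<Sum>j\<le>s. (int s - int j) * N j) = int s * (\<Sum>j\<le>s. N j) - (\<Sum>j\<le>s. int j * N j)"
    by (simp add: left_diff_distrib sum_subtractf sum_distrib_left)
  moreover have "(\<Sum>j\<le>s. (int s - int j) * b (s - j)) = (\<Sum>j\<le>s. int j * b j)"
    by (rule sum.reindex_bij_witness [of _ "\<lambda>j. s - j" "\<lambda>j. s - j"]) (auto simp: of_nat_diff)
  moreover have "2 * (\<Sum>j\<le>s. int s - int j) = int s * (int s + 1)"
  proof -
    \<comment> \<open>\<open>c\<close> is separated from the upper limit \<open>m\<close> so that
      the summand stays fixed in the induction.\<close>
    have "2 * (\<Sum>j\<le>m. int c - int j) = (int m + 1) * (2 * int c - int m)" for m c
      by (induction m) (auto simp: algebra_simps)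
    from this [of s s] show ?thesis by (simp add: algebra_simps)
  qed
  moreover have "(\<Sum>j\<le>s. (int s - int j) * (2 * k - a j - b (s - j))) =
    k * (2 * (\<Sum>j\<le>s. int s - int j)) - (\<Sum>j\<le>s. (int s - int j) * a j) - (\<Sum>j\<le>s. (int s - int j) * b (s - j))"
  proof -
    have "(int s - int j) * (2 * k - a j - b (s - j)) =
      (2 * k) * (int s - int j) - (int s - int j) * a j - (int s - int j) * b (s - j)" for j
      by (simp add: algebra_simps)
    then have "(\<Sum>j\<le>s. (int s - int j) * (2 * k - a j - b (s - j))) = (\<Sum>j\<le>s. (2 * k) * (int s - int j))
       - (\<Sum>j\<le>s. (int s - int j) * a j) - (\<Sum>j\<le>s. (int s - int j) * b (s - j))"
      by (simp only: sum_subtractf)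
    moreover have "(\<Sum>j\<le>s. (2 * k) * (int s - int j)) = (2 * k) * (\<Sum>j\<le>s. int s - int j)"
      by (rule sum_distrib_left [symmetric])
    ultimately show ?thesis by simp
  qed
  ultimately show ?thesis by (smt (verit) mult.assoc)
qed

section \<open>Edges on a common face\<close>

lemma drawingD:
  assumes "drawing V E p \<gamma>"
  shows "inj_on p V"
    and "e \<in> E \<Longrightarrow> arc (\<gamma> e)"
    and "e \<in> E \<Longrightarrow> {pathstart (\<gamma> e), pathfinish (\<gamma> e)} = p ` e"
    and "e \<in> E \<Longrightarrow> path_image (\<gamma> e) \<inter> p ` V = p ` e"
    and "e \<in> E \<Longrightarrow> e' \<in> E \<Longrightarrow> e \<noteq> e' \<Longrightarrow> path_image (\<gamma> e) \<inter> path_image (\<gamma> e') = p ` (e \<inter> e')"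
  using assms unfolding drawing_def by meson+

lemma drawn_Un: "drawn (X \<union> X') (F \<union> F') p \<gamma> = drawn X F p \<gamma> \<union> drawn X' F' p \<gamma>"
  unfolding drawn_def by blast

lemma vertex_on_edge:
  assumes "simple_graph V E" "drawing V E p \<gamma>" "e \<in> E" "w \<in> V"
  shows "p w \<in> path_image (\<gamma> e) \<longleftrightarrow> w \<in> e"
proof -
  have "e \<subseteq> V" using simple_graph_finite [OF assms(1)] assms(3) by auto
  have "p w \<in> path_image (\<gamma> e) \<longleftrightarrow> p w \<in> path_image (\<gamma> e) \<inter> p ` V" using assms(4) by simp
  also have "\<dots> \<longleftrightarrow> p w \<in> p ` e" using drawingD(4) [OF assms(2,3)] by simp
  also have "\<dots> \<longleftrightarrow> w \<in> e" using inj_on_image_mem_iff [OF drawingD(1) [OF assms(2)] assms(4) \<open>e \<subseteq> V\<close>] .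
  finally show ?thesis .
qed

lemma vertex_in_drawn:
  assumes "simple_graph V E" "drawing V E p \<gamma>" "X \<subseteq> V" "F \<subseteq> E" "w \<in> V"
  shows "p w \<in> drawn X F p \<gamma> \<longleftrightarrow> w \<in> X \<union> \<Union>F"
proof -
  have "p w \<in> p ` X \<longleftrightarrow> w \<in> X" using inj_on_image_mem_iff [OF drawingD(1) [OF assms(2)] assms(5,3)] .
  moreover have "p w \<in> (\<Union>e\<in>F. path_image (\<gamma> e)) \<longleftrightarrow> (\<exists>e\<in>F. w \<in> e)"
  proof -
    have "p w \<in> path_image (\<gamma> e) \<longleftrightarrow> w \<in> e" if "e \<in> F" for e
      by (rule vertex_on_edge [OF assms(1,2) _ assms(5)]) (use that assms(4) in blast)
    then show ?thesis by simp
  qed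
  ultimately show ?thesis unfolding drawn_def by (simp only: Un_iff Union_iff)
qed

lemma drawn_Int:
  assumes G: "simple_graph V E" and D: "drawing V E p \<gamma>" and X: "X1 \<subseteq> V" "X2 \<subseteq> V"
    and F: "F1 \<subseteq> E" "F2 \<subseteq> E" "F1 \<inter> F2 = {}"
  shows "drawn X1 F1 p \<gamma> \<inter> drawn X2 F2 p \<gamma> \<subseteq> p ` ((X1 \<union> \<Union>F1) \<inter> (X2 \<union> \<Union>F2))"
proof
  fix x assume x: "x \<in> drawn X1 F1 p \<gamma> \<inter> drawn X2 F2 p \<gamma>"
  have "x \<in> p ` V"
  proof (rule ccontr)
    assume nV: "x \<notin> p ` V"
    then obtain e1 e2 where e: "e1 \<in> F1" "x \<in> path_image (\<gamma> e1)" "e2 \<in> F2" "x \<in> path_image (\<gamma> e2)"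
      using x X unfolding drawn_def by blast
    then have "e1 \<in> E" "e2 \<in> E" "e1 \<noteq> e2" using F by auto
    then have "x \<in> p ` (e1 \<inter> e2)" using drawingD(5) [OF D, of e1 e2] e by auto
    moreover have "e1 \<subseteq> V" using simple_graph_finite [OF G] \<open>e1 \<in> E\<close> by auto
    ultimately show False using nV by auto
  qed
  then obtain w where w: "w \<in> V" "x = p w" by blast
  then have "w \<in> X1 \<union> \<Union>F1" "w \<in> X2 \<union> \<Union>F2"
    using x vertex_in_drawn [OF G D X(1) F(1) w(1)] vertex_in_drawn [OF G D X(2) F(2) w(1)] by auto
  then show "x \<in> p ` ((X1 \<union> \<Union>F1) \<inter> (X2 \<union> \<Union>F2))" using w by auto
qed

lemma edge_islimpt:
  assumes "drawing V E p \<gamma>" "e \<in> E" "x \<in> path_image (\<gamma> e)"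
  shows "x islimpt path_image (\<gamma> e)"
proof (rule connected_imp_perfect)
  have a: "arc (\<gamma> e)" using drawingD(2) [OF assms(1,2)] .
  then show "connected (path_image (\<gamma> e))" by (rule connected_arc_image)
  show "path_image (\<gamma> e) \<noteq> {y}" for y
    using arc_distinct_ends [OF a] pathstart_in_path_image [of "\<gamma> e"] pathfinish_in_path_image [of "\<gamma> e"] by auto
qed (rule assms)

lemma edge_infinite:
  assumes "drawing V E p \<gamma>" "e \<in> E"
  shows "infinite (path_image (\<gamma> e))"
proof
  assume "finite (path_image (\<gamma> e))"
  then show False using edge_islimpt [OF assms pathstart_in_path_image] islimpt_finite by metis
qed

text \<open>Stands for two edges on a common face. Only the consequence is recorded, since sliding
  the ends of an arc to vertices changes the drawing and with it the faces.\<close>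

definition cofacial :: "'a set \<Rightarrow> 'a set set \<Rightarrow> 'a set \<Rightarrow> 'a set \<Rightarrow> bool" where
  "cofacial V E e1 e2 \<longleftrightarrow> (\<forall>u\<in>e1. \<forall>w\<in>e2. u \<noteq> w \<longrightarrow> planar V (insert {u, w} E))"

text \<open>By \<open>cover\<close> and the splitting of \<open>E\<close>, the set
  \<open>L \<union> M1 \<union> M2\<close> is the whole drawing, so a linking arc crosses nothing.
  Its ends lie inside edges, and sliding them joins any end of one edge to any end of the
  other.\<close>

lemma separated_or_cofacial:
  assumes G: "simple_graph V E" and D: "drawing V E p \<gamma>" and X: "X \<subseteq> V"
    and E: "E = W \<union> E1 \<union> E2" "E1 \<inter> E2 = {}" and cover: "V \<subseteq> X \<union> \<Union>E"
    and int: "\<Union>E1 \<inter> \<Union>E2 \<subseteq> X \<union> \<Union>W"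
  obtains (separated) U1 U2 where "open U1" "open U2" "U1 \<inter> U2 = {}" "U1 \<union> U2 = - drawn X W p \<gamma>"
      "drawn {} E1 p \<gamma> - drawn X W p \<gamma> \<subseteq> U1" "drawn {} E2 p \<gamma> - drawn X W p \<gamma> \<subseteq> U2"
    | (cofacial) e1 e2 where "e1 \<in> E1" "e2 \<in> E2" "cofacial V E e1 e2"
proof -
  define L where "L = drawn X W p \<gamma>"
  define M1 where "M1 = drawn {} E1 p \<gamma>"
  define M2 where "M2 = drawn {} E2 p \<gamma>"
  have fin: "finite V" "finite E" and EV: "E \<subseteq> Pow V" using simple_graph_finite [OF G] by auto
  have sub: "W \<subseteq> E" "E1 \<subseteq> E" "E2 \<subseteq> E" using E by auto
  then have finW: "finite W" "finite E1" "finite E2" "finite X" using fin X finite_subset by blast+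
  have clo: "closed L" "closed M1" "closed M2"
    unfolding L_def M1_def M2_def using drawing_compact(2) [OF D] sub finW by auto
  have "M1 \<inter> M2 \<subseteq> p ` (\<Union>E1 \<inter> \<Union>E2)"
    unfolding M1_def M2_def using drawn_Int [OF G D _ _ sub(2,3) E(2), of "{}" "{}"] by simp
  also have "\<dots> \<subseteq> L"
  proof
    fix x assume "x \<in> p ` (\<Union>E1 \<inter> \<Union>E2)"
    then obtain w where w: "x = p w" "w \<in> \<Union>E1 \<inter> \<Union>E2" by auto
    then have "w \<in> V" using sub EV by auto
    then show "x \<in> L" unfolding L_def w(1) using vertex_in_drawn [OF G D X sub(1)] w int by blast
  qed
  finally have M12: "M1 \<inter> M2 \<subseteq> L" .
  have lim: "x islimpt drawn {} F p \<gamma>" if F: "F \<subseteq> E" "x \<in> drawn {} F p \<gamma>" for F x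
  proof -
    obtain e where e: "e \<in> F" "x \<in> path_image (\<gamma> e)" using F(2) unfolding drawn_def by auto
    have "x islimpt path_image (\<gamma> e)" by (rule edge_islimpt [OF D _ e(2)]) (use F(1) e(1) in auto)
    moreover have "path_image (\<gamma> e) \<subseteq> drawn {} F p \<gamma>" using e(1) by (auto simp: drawn_def)
    ultimately show ?thesis by (rule islimpt_subset)
  qed
  have all: "L \<union> M1 \<union> M2 = drawn V E p \<gamma>"
  proof -
    have "L \<union> M1 \<union> M2 = drawn X E p \<gamma>" unfolding L_def M1_def M2_def drawn_def E(1) by blast
    moreover have "p ` V \<subseteq> drawn X E p \<gamma>" using vertex_in_drawn [OF G D X subset_refl] cover by blast
    ultimately show ?thesis using X unfolding drawn_def by blast
  qed
  have finP: "finite (p ` V)" using fin by simp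
  show thesis
  proof (rule separation_or_linking_arc [OF clo M12 finP])
    fix x assume "x \<in> M1 \<inter> p ` V" then show "x islimpt M1" using lim [OF sub(2)] by (simp add: M1_def)
  next
    fix x assume "x \<in> M2 \<inter> p ` V" then show "x islimpt M2" using lim [OF sub(3)] by (simp add: M2_def)
  next
    fix U1 U2 assume "open U1" "open U2" "U1 \<inter> U2 = {}" "U1 \<union> U2 = - L" "M1 - L \<subseteq> U1" "M2 - L \<subseteq> U2"
    then show thesis using separated [of U1 U2] unfolding L_def M1_def M2_def by blast
  next
    fix g assume g: "arc g" "pathstart g \<in> M1 - L - p ` V" "pathfinish g \<in> M2 - L - p ` V"
      and int: "\<And>t. 0 < t \<Longrightarrow> t < 1 \<Longrightarrow> g t \<notin> L \<union> M1 \<union> M2"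
    obtain e1 where e1: "e1 \<in> E1" "pathstart g \<in> path_image (\<gamma> e1) - p ` V" using g(2) unfolding M1_def drawn_def by auto
    obtain e2 where e2: "e2 \<in> E2" "pathfinish g \<in> path_image (\<gamma> e2) - p ` V" using g(3) unfolding M2_def drawn_def by auto
    have "cofacial V E e1 e2" unfolding cofacial_def
    proof (intro ballI impI)
      fix u w assume uw: "u \<in> e1" "w \<in> e2" "u \<noteq> w"
      have "e1 \<in> E" "e2 \<in> E" using e1 e2 sub by auto
      then show "planar V (insert {u, w} E)"
        by (rule_tac planar_insert_edge_edge [OF G D uw(3) _ uw(1) _ uw(2) g(1) e1(2) e2(2) int [unfolded all]])
    qed
    then show thesis using cofacial e1(1) e2(1) by blast
  qed
qed

text \<open>Applied where the drawing of \<open>X\<close> and \<open>W\<close> is as small as a few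
  points, an arc or a star. An edge outside \<open>W\<close> meets it in vertices only, and an arc
  is infinite, so both \<open>U1\<close> and \<open>U2\<close> would be nonempty and disconnect the
  complement.\<close>

lemma cofacial_across_connected_complement:
  assumes G: "simple_graph V E" and D: "drawing V E p \<gamma>" and X: "X \<subseteq> V"
    and E: "E = W \<union> E1 \<union> E2" "E1 \<inter> E2 = {}" "W \<inter> (E1 \<union> E2) = {}" and cover: "V \<subseteq> X \<union> \<Union>E"
    and int: "\<Union>E1 \<inter> \<Union>E2 \<subseteq> X \<union> \<Union>W"
    and conn: "connected (- drawn X W p \<gamma>)" and ne: "E1 \<noteq> {}" "E2 \<noteq> {}"
  obtains e1 e2 where "e1 \<in> E1" "e2 \<in> E2" "cofacial V E e1 e2"
proof (rule separated_or_cofacial [OF G D X E(1,2) cover int])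
  fix U1 U2 assume U: "open U1" "open U2" "U1 \<inter> U2 = {}" "U1 \<union> U2 = - drawn X W p \<gamma>"
      "drawn {} E1 p \<gamma> - drawn X W p \<gamma> \<subseteq> U1" "drawn {} E2 p \<gamma> - drawn X W p \<gamma> \<subseteq> U2"
  have nonempty: "drawn {} F p \<gamma> - drawn X W p \<gamma> \<noteq> {}" if F: "F \<subseteq> E" "F \<noteq> {}" "W \<inter> F = {}" for F
  proof
    assume "drawn {} F p \<gamma> - drawn X W p \<gamma> = {}"
    moreover obtain e where e: "e \<in> F" using F by blast
    then have "path_image (\<gamma> e) \<subseteq> drawn {} F p \<gamma>" by (auto simp: drawn_def)
    ultimately have "path_image (\<gamma> e) \<subseteq> drawn {} {e} p \<gamma> \<inter> drawn X W p \<gamma>" by (auto simp: drawn_def)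
    also have "\<dots> \<subseteq> p ` (({} \<union> \<Union>{e}) \<inter> (X \<union> \<Union>W))"
      by (rule drawn_Int [OF G D _ X]) (use e F E in auto)
    also have "\<dots> \<subseteq> p ` V"
    proof -
      have "e \<subseteq> V" using e F simple_graph_finite [OF G] by blast
      then show ?thesis by blast
    qed
    finally have "finite (path_image (\<gamma> e))" using simple_graph_finite [OF G] by (meson finite_imageI finite_subset)
    then show False using edge_infinite [OF D] e F by blast
  qed
  have "U1 \<inter> - drawn X W p \<gamma> = {} \<or> U2 \<inter> - drawn X W p \<gamma> = {}"
    by (rule connectedD [OF conn U(1,2)]) (use U in auto)
  moreover have "drawn {} E1 p \<gamma> - drawn X W p \<gamma> \<noteq> {}" "drawn {} E2 p \<gamma> - drawn X W p \<gamma> \<noteq> {}"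
    using nonempty ne E by auto
  ultimately show thesis using U(5,6) by blast
qed (rule that)

lemma planar_join_isolated:
  assumes pl: "planar V E" and x: "x \<in> V" "x \<notin> \<Union>E" and x': "x' \<in> V" "x' \<noteq> x"
  obtains u where "u \<in> V" "u \<noteq> x" "planar V (insert {x, u} E)"
proof -
  obtain p \<gamma> where G: "simple_graph V E" and D: "drawing V E p \<gamma>" using pl planar_iff_drawing by metis
  define M where "M = drawn (V - {x}) E p \<gamma>"
  have "closed M" unfolding M_def using drawing_compact(2) [OF D subset_refl] simple_graph_finite [OF G] by simp
  have xM: "p x \<notin> M" unfolding M_def using vertex_in_drawn [OF G D _ subset_refl x(1), of "V - {x}"] x by blast
  have all: "{} \<union> {p x} \<union> M = drawn V E p \<gamma>" unfolding M_def drawn_def using x by auto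
  have "p x' \<in> M" unfolding M_def drawn_def using x' by auto
  then have ne: "M - {} \<noteq> {}" by blast
  show thesis
  \<comment> \<open>No points are to be avoided, since \<open>M\<close> may itself contain isolated
    points; the arc can therefore end at a vertex or inside an edge.\<close>
  proof (rule linking_arc [of "{}" "{p x}" M "{}"])
    fix g assume g: "arc g" "pathstart g \<in> {p x} - {} - {}" "pathfinish g \<in> M - {} - {}"
      and int: "\<And>t. 0 < t \<Longrightarrow> t < 1 \<Longrightarrow> g t \<notin> {} \<union> {p x} \<union> M"
    have st: "pathstart g = p x" using g(2) by simp
    consider u where "u \<in> V - {x}" "pathfinish g = p u" | e where "e \<in> E" "pathfinish g \<in> path_image (\<gamma> e) - p ` V"
    proof (cases "pathfinish g \<in> p ` V")
      case True
      then obtain u where u: "u \<in> V" "pathfinish g = p u" by blast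
      then have "u \<noteq> x" using g(3) xM by auto
      then show thesis using that(1) u by blast
    next
      case False
      then obtain e where "e \<in> E" "pathfinish g \<in> path_image (\<gamma> e)" using g(3) unfolding M_def drawn_def by blast
      then show thesis using that(2) False by blast
    qed
    then show thesis
    proof cases
      case 1
      have "planar V (insert {x, u} E)"
        by (rule planar_insert_vertex_vertex [OF G D _ _ _ g(1) st 1(2) int [unfolded all]]) (use x 1 in auto)
      then show thesis using that 1 by blast
    next
      case 2
      obtain u where u: "u \<in> e" "u \<in> V" "u \<noteq> x"
      proof -
        obtain a b where "e = {a, b}" "a \<in> V" using 2(1) G unfolding simple_graph_def by blast
        then show thesis using that [of a] x(2) 2(1) by auto
      qed
      have int': "reversepath g t \<notin> drawn V E p \<gamma>" if "0 < t" "t < 1" for t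
        using int [of "1 - t"] that unfolding all by (simp add: reversepath_def)
      have "planar V (insert {u, x} E)"
        by (rule planar_insert_vertex_edge [OF G D x(1) u(3) 2(1) u(1) _ _ _ int'])
          (use g(1) st 2(2) in \<open>auto simp: arc_reversepath\<close>)
      then show thesis using that u by (simp add: insert_commute)
    qed
  qed (use \<open>closed M\<close> xM ne in auto)
qed

lemma connected_component_along_walk:
  assumes D: "drawing V E p \<gamma>" and ab: "(a, b) \<in> {(a, b). {a, b} \<in> F}\<^sup>*" and F: "F \<subseteq> E"
    and Z: "p a \<in> Z" "\<And>e. e \<in> F \<Longrightarrow> path_image (\<gamma> e) \<subseteq> Z"
  shows "connected_component Z (p a) (p b)"
  using ab
proof (induction rule: rtrancl_induct)
  case base then show ?case using Z by (simp add: connected_component_refl_eq)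
next
  case (step b c)
  then have e: "{b, c} \<in> F" by simp
  have ends: "{pathstart (\<gamma> {b, c}), pathfinish (\<gamma> {b, c})} = {p b, p c}" using drawingD(3) [OF D] e F by auto
  have "p b \<in> path_image (\<gamma> {b, c})" "p c \<in> path_image (\<gamma> {b, c})"
    using ends pathstart_in_path_image [of "\<gamma> {b, c}"] pathfinish_in_path_image [of "\<gamma> {b, c}"]
    by (metis doubleton_eq_iff)+
  moreover have "connected (path_image (\<gamma> {b, c}))" using drawingD(2) [OF D] e F by (intro connected_arc_image) auto
  ultimately have "connected_component Z (p b) (p c)"
    unfolding connected_component_def using Z(2) [OF e] by blast
  then show ?case using step.IH connected_component_trans by metis
qed

text \<open>Janiszewski's theorem, one edge at a time: a new edge meets the star drawn so far in the
  connected set \<open>{p s}\<close>.\<close>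

lemma connected_star_complement:
  assumes G: "simple_graph V E" and D: "drawing V E p \<gamma>" and s: "s \<in> V" and F: "F \<subseteq> E" "\<And>e. e \<in> F \<Longrightarrow> s \<in> e"
  shows "connected (- drawn {s} F p \<gamma>)"
proof -
  have "finite F" using F simple_graph_finite [OF G] finite_subset by blast
  then show ?thesis using F
  proof (induction F)
    case empty
    have "path_connected (- {p s})" by (rule path_connected_complement_countable) auto
    then show ?case by (simp add: drawn_def path_connected_imp_connected)
  next
    case (insert e F)
    have eE: "e \<in> E" "F \<subseteq> E" "s \<in> e" using insert by auto
    have a: "arc (\<gamma> e)" using drawingD(2) [OF D eE(1)] .
    have ps: "p s \<in> path_image (\<gamma> e)" using vertex_on_edge [OF G D eE(1) s] eE by simp
    have "drawn {} {e} p \<gamma> \<inter> drawn {s} F p \<gamma> \<subseteq> p ` (({} \<union> \<Union>{e}) \<inter> ({s} \<union> \<Union>F))"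
      by (rule drawn_Int [OF G D]) (use insert eE s in auto)
    also have "\<dots> \<subseteq> {p s}"
    proof -
      have "e \<inter> f \<subseteq> {s}" if "f \<in> F" for f
      proof -
        obtain z where "e = {s, z}" using simple_graphD [OF G eE(1,3)] by metis
        moreover have "f \<in> E" "s \<in> f" "f \<noteq> e" using that insert by auto
        moreover from this obtain z' where "f = {s, z'}" using simple_graphD [OF G] by metis
        ultimately show ?thesis by auto
      qed
      then show ?thesis by auto
    qed
    finally have int: "path_image (\<gamma> e) \<inter> drawn {s} F p \<gamma> = {p s}" using ps by (auto simp: drawn_def)
    have "connected (- (path_image (\<gamma> e) \<union> drawn {s} F p \<gamma>))"
    proof (rule Janiszewski_connected)
      show "compact (path_image (\<gamma> e))" using a by (rule compact_arc_image)
      show "closed (drawn {s} F p \<gamma>)" using drawing_compact(2) [OF D eE(2)] insert by simp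
      show "connected (path_image (\<gamma> e) \<inter> drawn {s} F p \<gamma>)" unfolding int by simp
      show "connected (- path_image (\<gamma> e))" using connected_arc_complement [OF a] by simp
      show "connected (- drawn {s} F p \<gamma>)" using insert by simp
    qed
    moreover have "path_image (\<gamma> e) \<union> drawn {s} F p \<gamma> = drawn {s} (insert e F) p \<gamma>" by (auto simp: drawn_def)
    ultimately show ?case by simp
  qed
qed

text \<open>If no face touched edges at both parts \<open>S1\<close> and \<open>S2\<close> of a separator, the plane would be
  covered by two closed sets meeting in the drawings of the two sides, and the two sides would be
  joined inside either of these sets.\<close>

lemma separator_cofacial:
  assumes pl: "planar V E" and V: "V = C \<union> (S1 \<union> S2) \<union> Q"
    and disj: "C \<inter> (S1 \<union> S2) = {}" "Q \<inter> (S1 \<union> S2) = {}" "C \<inter> Q = {}" "S1 \<inter> S2 = {}"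
    and noE: "\<And>a b. a \<in> C \<Longrightarrow> b \<in> Q \<Longrightarrow> {a, b} \<notin> E" "\<And>a b. a \<in> S1 \<Longrightarrow> b \<in> S2 \<Longrightarrow> {a, b} \<notin> E"
    and cov: "S1 \<union> S2 \<subseteq> \<Union>E" and cq: "c \<in> C" "q \<in> Q"
    and via1: "(c, q) \<in> {(a, b). {a, b} \<in> {e \<in> E. e \<inter> S2 = {}}}\<^sup>*"
    and via2: "(c, q) \<in> {(a, b). {a, b} \<in> {e \<in> E. e \<inter> S1 = {}}}\<^sup>*"
  obtains e1 e2 where "e1 \<in> E" "e2 \<in> E" "e1 \<inter> S1 \<noteq> {}" "e2 \<inter> S2 \<noteq> {}" "cofacial V E e1 e2"
proof -
  obtain p \<gamma> where G: "simple_graph V E" and D: "drawing V E p \<gamma>" using pl planar_iff_drawing by metis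
  have EV: "E \<subseteq> Pow V" "finite V" "finite E" using simple_graph_finite [OF G] by auto
  have edge2: "e \<subseteq> A \<or> e \<subseteq> B" if e: "e \<in> E" "e \<subseteq> A \<union> B" "\<And>a b. a \<in> A \<Longrightarrow> b \<in> B \<Longrightarrow> {a, b} \<notin> E" for e A B
  proof -
    obtain a b where "e = {a, b}" using e(1) G unfolding simple_graph_def by blast
    then show ?thesis using e(1,2) e(3) [of a b] e(3) [of b a] by (auto simp: insert_commute)
  qed
  define W where "W = {e \<in> E. e \<inter> (S1 \<union> S2) = {}}"
  define E1 where "E1 = {e \<in> E. e \<inter> S1 \<noteq> {}}"
  define E2 where "E2 = {e \<in> E. e \<inter> S2 \<noteq> {}}"
  have no12: "e \<inter> S1 = {} \<or> e \<inter> S2 = {}" if e: "e \<in> E" for e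
  proof (rule ccontr)
    assume "\<not> ?thesis"
    then obtain a b where ab: "a \<in> e" "a \<in> S1" "b \<in> e" "b \<in> S2" by blast
    then have "a \<noteq> b" using disj by blast
    then have "{a, b} = e" using simple_graphD [OF G e ab(1)] ab by (metis insertE singletonD)
    then show False using noE(2) ab e by blast
  qed
  define L where "L = drawn (C \<union> Q) W p \<gamma>"
  show thesis
  proof (rule separated_or_cofacial [OF G D, of "C \<union> Q" W E1 E2])
    show "C \<union> Q \<subseteq> V" using V by blast
    show "E = W \<union> E1 \<union> E2" by (auto simp: W_def E1_def E2_def)
    show "E1 \<inter> E2 = {}" using no12 by (auto simp: E1_def E2_def)
    show "V \<subseteq> C \<union> Q \<union> \<Union>E" using V cov by blast
    have "x \<in> C \<union> Q" if x: "e1 \<in> E1" "e2 \<in> E2" "x \<in> e1" "x \<in> e2" for x e1 e2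
    proof -
      have "e1 \<in> E" "e2 \<in> E" using x by (auto simp: E1_def E2_def)
      then have "x \<notin> S1" "x \<notin> S2" using x no12 [of e1] no12 [of e2] by (auto simp: E1_def E2_def)
      then show ?thesis using V EV \<open>e1 \<in> E\<close> x(3) by blast
    qed
    then show "\<Union>E1 \<inter> \<Union>E2 \<subseteq> C \<union> Q \<union> \<Union>W" by blast
  next
    fix e1 e2 assume "e1 \<in> E1" "e2 \<in> E2" "cofacial V E e1 e2"
    then show thesis by (intro that [of e1 e2]) (auto simp: E1_def E2_def)
  next
    fix U1 U2 assume U: "open U1" "open U2" "U1 \<inter> U2 = {}" "U1 \<union> U2 = - drawn (C \<union> Q) W p \<gamma>"
      "drawn {} E1 p \<gamma> - drawn (C \<union> Q) W p \<gamma> \<subseteq> U1" "drawn {} E2 p \<gamma> - drawn (C \<union> Q) W p \<gamma> \<subseteq> U2"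
    note U = U [folded L_def]
    define L1 where "L1 = drawn C {e \<in> E. e \<subseteq> C} p \<gamma>"
    define L2 where "L2 = drawn Q {e \<in> E. e \<subseteq> Q} p \<gamma>"
    have finC: "finite C" "finite Q" using V EV by auto
    \<comment> \<open>No edge joins \<open>C\<close> to \<open>Q\<close>, so an edge that avoids the
      separator lies in one of them. This splits \<open>L\<close> into the disjoint closed sets
      \<open>L1\<close> and \<open>L2\<close>.\<close>
    have W: "W = {e \<in> E. e \<subseteq> C} \<union> {e \<in> E. e \<subseteq> Q}"
    proof (intro set_eqI iffI)
      fix e assume e: "e \<in> W"
      then have "e \<in> E" "e \<subseteq> C \<union> Q" using V EV by (auto simp: W_def)
      then show "e \<in> {e \<in> E. e \<subseteq> C} \<union> {e \<in> E. e \<subseteq> Q}" using edge2 [OF _ _ noE(1)] by blast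
    qed (use disj in \<open>auto simp: W_def\<close>)
    then have L: "L = L1 \<union> L2" unfolding L_def L1_def L2_def by (simp only: drawn_Un)
    have clo: "closed L1" "closed L2" unfolding L1_def L2_def using drawing_compact(2) [OF D] finC EV by auto
    have L12: "L1 \<inter> L2 = {}"
    proof -
      have "{e \<in> E. e \<subseteq> C} \<inter> {e \<in> E. e \<subseteq> Q} = {}" using disj(3) G unfolding simple_graph_def by blast
      then have "L1 \<inter> L2 \<subseteq> p ` ((C \<union> \<Union>{e \<in> E. e \<subseteq> C}) \<inter> (Q \<union> \<Union>{e \<in> E. e \<subseteq> Q}))"
        unfolding L1_def L2_def by (intro drawn_Int [OF G D]) (use V in auto)
      also have "(C \<union> \<Union>{e \<in> E. e \<subseteq> C}) \<inter> (Q \<union> \<Union>{e \<in> E. e \<subseteq> Q}) = {}" using disj(3) by blast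
      finally show ?thesis by simp
    qed
    have pc: "p c \<in> L1" "p q \<in> L2" using cq by (auto simp: L1_def L2_def drawn_def)
    have inside: "path_image (\<gamma> e) \<subseteq> L \<union> U'"
      if e: "e \<in> W \<union> F" and F: "drawn {} F p \<gamma> - L \<subseteq> U'" for e F U'
    proof -
      have "path_image (\<gamma> e) \<subseteq> L \<union> drawn {} F p \<gamma>" using e unfolding L_def drawn_def by blast
      then show ?thesis using F by blast
    qed
    have WE: "{e \<in> E. e \<inter> S2 = {}} \<subseteq> W \<union> E1" "{e \<in> E. e \<inter> S1 = {}} \<subseteq> W \<union> E2"
      by (auto simp: W_def E1_def E2_def)
    \<comment> \<open>A walk that avoids \<open>S2\<close> uses edges of \<open>W\<close> and
      \<open>E1\<close> only, and these are drawn inside \<open>L \<union> U1\<close>, the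
      complement of the open set \<open>U2\<close>.\<close>
    have A: "connected_component (L \<union> U1) (p c) (p q)"
      by (rule connected_component_along_walk [OF D via1])
        (use pc L inside [OF subsetD [OF WE(1)] U(5)] in auto)
    have B: "connected_component (L \<union> U2) (p c) (p q)"
      by (rule connected_component_along_walk [OF D via2])
        (use pc L inside [OF subsetD [OF WE(2)] U(6)] in auto)
    have "L \<union> U1 = - U2" "L \<union> U2 = - U1" using U(3,4) by blast+
    then have "closed (L \<union> U1)" "closed (L \<union> U2)" using U(1,2) by auto
    moreover have "(L \<union> U1) \<union> (L \<union> U2) = UNIV" "(L \<union> U1) \<inter> (L \<union> U2) = L1 \<union> L2" using U(3,4) L by blast+
    ultimately have False using plane_cover_links_once [OF _ _ clo _ _ L12 pc A B] by blast
    then show thesis ..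
  qed
qed

section \<open>Triangulations and quadrangulations\<close>

text \<open>The exception to 2-connectedness: a star with at least two leaves is maximal bipartite
  planar, but its centre is a cut vertex.\<close>

definition star :: "'a set \<Rightarrow> 'a set set \<Rightarrow> bool" where
  "star V E \<longleftrightarrow> (\<exists>s\<in>V. \<forall>w\<in>V - {s}. {s, w} \<in> E)"

lemma planar_simple: "planar V E \<Longrightarrow> simple_graph V E"
  by (simp add: planar_def)

lemma triangulation_planar: "triangulation V E \<Longrightarrow> planar V E"
  by (simp add: triangulation_def)

lemma quadrangulation_planar: "quadrangulation V E \<Longrightarrow> planar V E"
  by (simp add: quadrangulation_def)

lemma quadrangulation_bipartition:
  assumes "quadrangulation V E"
  obtains A where "A \<subseteq> V" "\<forall>e\<in>E. card (e \<inter> A) = 1"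
proof -
  have "bipartite V E" using assms by (simp add: quadrangulation_def)
  then show thesis using that unfolding bipartite_def by auto
qed

lemma triangulationD:
  assumes "triangulation V E" "u \<in> V" "w \<in> V" "u \<noteq> w" "planar V (insert {u, w} E)"
  shows "{u, w} \<in> E"
  using assms unfolding triangulation_def by meson

lemma quadrangulationD:
  assumes "quadrangulation V E" "u \<in> V" "w \<in> V" "u \<noteq> w" "planar V (insert {u, w} E)"
    "bipartite V (insert {u, w} E)"
  shows "{u, w} \<in> E"
  using assms unfolding quadrangulation_def by meson

lemma card_pair_Int_eq_1: "u \<noteq> w \<Longrightarrow> card ({u, w} \<inter> A) = 1 \<longleftrightarrow> (u \<in> A \<longleftrightarrow> w \<notin> A)"
  by (cases "u \<in> A"; cases "w \<in> A") (auto simp: Int_insert_left)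

lemma triangulation_not_isolated:
  assumes T: "triangulation V E" and x: "x \<in> V" "x' \<in> V" "x' \<noteq> x"
  shows "x \<in> \<Union>E"
proof (rule ccontr)
  assume "x \<notin> \<Union>E"
  moreover have "planar V E" using T by (simp add: triangulation_def)
  ultimately obtain u where "u \<in> V" "u \<noteq> x" "planar V (insert {x, u} E)"
    using planar_join_isolated [OF _ x(1) _ x(2,3)] by metis
  then have "{x, u} \<in> E" using triangulationD [OF T x(1)] by metis
  then show False using \<open>x \<notin> \<Union>E\<close> by blast
qed

lemma quadrangulation_not_isolated:
  assumes Q: "quadrangulation V E" and x: "x \<in> V" "x' \<in> V" "x' \<noteq> x"
  shows "x \<in> \<Union>E"
proof (rule ccontr)
  assume iso: "x \<notin> \<Union>E"
  have pl: "planar V E" and bi: "bipartite V E" using Q by (simp_all add: quadrangulation_def)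
  obtain u where u: "u \<in> V" "u \<noteq> x" "planar V (insert {x, u} E)"
    using planar_join_isolated [OF pl x(1) iso x(2,3)] by metis
  obtain A where A: "A \<subseteq> V" "\<forall>e\<in>E. card (e \<inter> A) = 1" using bi unfolding bipartite_def by blast
  \<comment> \<open>An isolated vertex may change its colour; \<open>x\<close> is given the colour
    opposite to that of \<open>u\<close>.\<close>
  define B where "B = (if u \<in> A then A - {x} else insert x A)"
  have "e \<inter> B = e \<inter> A" if "e \<in> E" for e using that iso unfolding B_def by auto
  moreover have "card ({x, u} \<inter> B) = 1" using u(2) by (subst card_pair_Int_eq_1) (auto simp: B_def)
  ultimately have "\<forall>e\<in>insert {x, u} E. card (e \<inter> B) = 1" using A(2) by simp
  moreover have "B \<subseteq> V" using A x by (auto simp: B_def)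
  ultimately have "bipartite V (insert {x, u} E)" unfolding bipartite_def by blast
  then have "{x, u} \<in> E" using quadrangulationD [OF Q x(1)] u by metis
  then show False using iso by blast
qed

lemma not_connected_onD:
  assumes "\<not> connected_on E W"
  obtains X Y where "X \<union> Y = W" "X \<inter> Y = {}" "X \<noteq> {}" "Y \<noteq> {}" "\<And>a b. a \<in> X \<Longrightarrow> b \<in> Y \<Longrightarrow> {a, b} \<notin> E"
proof -
  obtain X where "X \<subseteq> W" "X \<noteq> {}" "\<forall>a\<in>X. \<forall>b\<in>W - X. {a, b} \<notin> E" "X \<noteq> W"
    using assms unfolding connected_on_iff_no_cut by blast
  then show thesis using that [of X "W - X"] by blast
qed

text \<open>At most two vertices span at most one edge, so the drawing of a smaller separator with
  its inner edges is a finite set or one arc, and its complement is connected. Some face then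
  touches edges at both sides \<open>X\<close> and \<open>Y\<close>, and maximality yields an edge
  between them.\<close>

lemma triangulation_3_connected:
  assumes T: "triangulation V E"
  shows "k_connected 3 V E"
  unfolding k_connected_def
proof (intro allI impI, rule ccontr)
  fix S assume S: "S \<subseteq> V \<and> card S < 3" and "\<not> connected_on E (V - S)"
  then obtain X Y where XY: "X \<union> Y = V - S" "X \<inter> Y = {}" "X \<noteq> {}" "Y \<noteq> {}"
    and no: "\<And>a b. a \<in> X \<Longrightarrow> b \<in> Y \<Longrightarrow> {a, b} \<notin> E" using not_connected_onD by metis
  obtain p \<gamma> where G: "simple_graph V E" and D: "drawing V E p \<gamma>"
    using T planar_iff_drawing unfolding triangulation_def by metis
  have EV: "E \<subseteq> Pow V" "finite V" using simple_graph_finite [OF G] by auto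
  obtain x0 y0 where xy: "x0 \<in> X" "y0 \<in> Y" using XY by blast
  then have xyV: "x0 \<in> V" "y0 \<in> V" "x0 \<noteq> y0" using XY(1,2) by auto
  have iso: "w \<in> \<Union>E" if "w \<in> V" for w
  proof -
    have "x0 \<noteq> w \<or> y0 \<noteq> w" using xyV by auto
    then show ?thesis using triangulation_not_isolated [OF T that] xyV by auto
  qed
  define W where "W = {e \<in> E. e \<subseteq> S}"
  define E1 where "E1 = {e \<in> E. e \<inter> X \<noteq> {}}"
  define E2 where "E2 = {e \<in> E. e \<inter> Y \<noteq> {}}"
  have no12: "e \<inter> X = {} \<or> e \<inter> Y = {}" if e: "e \<in> E" for e
  proof (rule ccontr)
    assume "\<not> ?thesis"
    then obtain a b where ab: "a \<in> e" "a \<in> X" "b \<in> e" "b \<in> Y" by blast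
    then have "a \<noteq> b" using XY by blast
    then have "{a, b} = e" using simple_graphD [OF G e ab(1)] ab by (metis insertE singletonD)
    then show False using no ab e by blast
  qed
  have con: "connected (- drawn S W p \<gamma>)"
  proof (cases "W = {}")
    case True
    have "finite S" using finite_subset [OF _ EV(2)] S by simp
    then have "path_connected (- p ` S)" by (intro path_connected_complement_countable) (auto simp: countable_finite)
    then show ?thesis using True by (simp add: drawn_def path_connected_imp_connected)
  next
    case False
    then obtain e where e: "e \<in> E" "e \<subseteq> S" by (auto simp: W_def)
    obtain a b where ab: "e = {a, b}" "a \<noteq> b" using e(1) G unfolding simple_graph_def by blast
    have finS: "finite S" using finite_subset [OF _ EV(2)] S by simp
    have "card e = 2" using ab by simp
    then have "card S \<le> card e" using S by simp
    then have Se: "S = e" using card_seteq [OF finS e(2)] by simp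
    have "W = {e}"
    proof
      show "W \<subseteq> {e}"
      proof
        fix f assume "f \<in> W"
        then obtain c d where "f = {c, d}" "c \<noteq> d" "f \<subseteq> e" using G Se unfolding W_def simple_graph_def by blast
        then show "f \<in> {e}" using ab by auto
      qed
    qed (use e Se in \<open>auto simp: W_def\<close>)
    moreover have "p ` S \<subseteq> path_image (\<gamma> e)" using drawingD(4) [OF D e(1)] Se by blast
    ultimately have "drawn S W p \<gamma> = path_image (\<gamma> e)" by (auto simp: drawn_def)
    then show ?thesis using connected_arc_complement [OF drawingD(2) [OF D e(1)]] by simp
  qed
  show False
  proof (rule cofacial_across_connected_complement [OF G D, of S W E1 E2])
    show "S \<subseteq> V" using S by blast
    show "E = W \<union> E1 \<union> E2"
    proof
      show "E \<subseteq> W \<union> E1 \<union> E2"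
      proof
        fix e assume e: "e \<in> E"
        then have "e \<subseteq> V" using EV(1) by auto
        also have "V = S \<union> (X \<union> Y)" using XY(1) S by auto
        finally show "e \<in> W \<union> E1 \<union> E2" using e unfolding W_def E1_def E2_def by blast
      qed
    qed (auto simp: W_def E1_def E2_def)
    show "E1 \<inter> E2 = {}" using no12 by (auto simp: E1_def E2_def)
    have "X \<inter> S = {}" "Y \<inter> S = {}" using XY(1) by auto
    then show "W \<inter> (E1 \<union> E2) = {}" unfolding W_def E1_def E2_def by blast
    show "V \<subseteq> S \<union> \<Union>E" using iso by blast
    have "x \<in> S" if x: "e1 \<in> E1" "e2 \<in> E2" "x \<in> e1" "x \<in> e2" for x e1 e2
    proof -
      have "e1 \<in> E" "e2 \<in> E" using x by (auto simp: E1_def E2_def)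
      then have "x \<notin> X" "x \<notin> Y" using x no12 [of e1] no12 [of e2] by (auto simp: E1_def E2_def)
      moreover have "x \<in> V" using EV(1) \<open>e1 \<in> E\<close> x(3) by auto
      ultimately show ?thesis using XY(1) by (metis DiffI UnE)
    qed
    then show "\<Union>E1 \<inter> \<Union>E2 \<subseteq> S \<union> \<Union>W" by blast
    show "connected (- drawn S W p \<gamma>)" by (rule con)
    show "E1 \<noteq> {}"
    proof -
      obtain e where "e \<in> E" "x0 \<in> e" using iso [OF xyV(1)] by auto
      then show ?thesis using xy unfolding E1_def by blast
    qed
    show "E2 \<noteq> {}"
    proof -
      obtain e where "e \<in> E" "y0 \<in> e" using iso [OF xyV(2)] by auto
      then show ?thesis using xy unfolding E2_def by blast
    qed
  next
    fix e1 e2 assume e: "e1 \<in> E1" "e2 \<in> E2" "cofacial V E e1 e2"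
    obtain a b where ab: "a \<in> e1" "a \<in> X" "b \<in> e2" "b \<in> Y" using e by (auto simp: E1_def E2_def)
    then have "a \<noteq> b" "a \<in> V" "b \<in> V" using XY by auto
    moreover have "planar V (insert {a, b} E)" using e(3) ab \<open>a \<noteq> b\<close> unfolding cofacial_def by simp
    ultimately have "{a, b} \<in> E" using triangulationD [OF T] by simp
    then show False using no ab by simp
  qed
qed

text \<open>An edge inside \<open>X\<close> has ends of both colours, so one of them may be joined
  to a given vertex of \<open>Y\<close> on the same face. For this reason \<open>E1\<close> contains
  only edges inside \<open>X\<close>; the edges from \<open>X\<close> to the cut vertex go into
  \<open>W\<close>, where they form a star with connected complement.\<close>

lemma quadrangulation_no_edge_beside_cut:
  assumes Q: "quadrangulation V E" and S: "S \<subseteq> V" "card S < 2"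
    and XY: "X \<union> Y = V - S" "X \<inter> Y = {}" "X \<noteq> {}" "Y \<noteq> {}" and no: "\<And>a b. a \<in> X \<Longrightarrow> b \<in> Y \<Longrightarrow> {a, b} \<notin> E"
    and e0: "e0 \<in> E"
  shows "\<not> e0 \<subseteq> X"
proof
  assume e0X: "e0 \<subseteq> X"
  obtain p \<gamma> where G: "simple_graph V E" and D: "drawing V E p \<gamma>"
    using Q planar_iff_drawing unfolding quadrangulation_def by metis
  have EV: "E \<subseteq> Pow V" "finite V" using simple_graph_finite [OF G] by auto
  obtain x0 y0 where xy: "x0 \<in> X" "y0 \<in> Y" using XY by blast
  then have xyV: "x0 \<in> V" "y0 \<in> V" "x0 \<noteq> y0" using XY(1,2) by auto
  have iso: "w \<in> \<Union>E" if "w \<in> V" for w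
  proof -
    have "x0 \<noteq> w \<or> y0 \<noteq> w" using xyV by auto
    then show ?thesis using quadrangulation_not_isolated [OF Q that] xyV by auto
  qed
  have finS: "finite S" using finite_subset [OF _ EV(2)] S by simp
  consider "S = {}" | s where "S = {s}"
  proof -
    have "card S = 0 \<or> card S = 1" using S by auto
    then show thesis using that finS by (auto simp: card_1_singleton_iff)
  qed
  note S_cases = this
  define W where "W = {e \<in> E. e \<inter> X \<noteq> {} \<and> e \<inter> S \<noteq> {}}"
  define E1 where "E1 = {e \<in> E. e \<subseteq> X}"
  define E2 where "E2 = {e \<in> E. e \<inter> Y \<noteq> {}}"
  have no12: "e \<inter> X = {} \<or> e \<inter> Y = {}" if e: "e \<in> E" for e
  proof (rule ccontr)
    assume "\<not> ?thesis"
    then obtain a b where ab: "a \<in> e" "a \<in> X" "b \<in> e" "b \<in> Y" by blast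
    then have "a \<noteq> b" using XY by blast
    then have "{a, b} = e" using simple_graphD [OF G e ab(1)] ab by (metis insertE singletonD)
    then show False using no ab e by blast
  qed
  have con: "connected (- drawn S W p \<gamma>)"
    using S_cases
  proof cases
    case 1
    then show ?thesis by (simp add: drawn_def W_def connected_UNIV)
  next
    case 2
    have "connected (- drawn {s} W p \<gamma>)"
      by (rule connected_star_complement [OF G D]) (use 2 S(1) in \<open>auto simp: W_def\<close>)
    then show ?thesis using 2 by simp
  qed
  have notS: "\<not> e \<subseteq> S" if eE: "e \<in> E" for e
  proof -
    obtain a b where "e = {a, b}" "a \<noteq> b" using eE G unfolding simple_graph_def by blast
    then show ?thesis using S_cases by auto
  qed
  show False
  proof (rule cofacial_across_connected_complement [OF G D, of S W E1 E2])
    show "S \<subseteq> V" using S by blast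
    show "E = W \<union> E1 \<union> E2"
    proof
      show "E \<subseteq> W \<union> E1 \<union> E2"
      proof
        fix e assume e: "e \<in> E"
        then have "e \<subseteq> V" using EV(1) by auto
        also have "V = S \<union> (X \<union> Y)" using XY(1) S by auto
        finally show "e \<in> W \<union> E1 \<union> E2" using notS [OF e] e unfolding W_def E1_def E2_def by blast
      qed
    qed (auto simp: W_def E1_def E2_def)
    show "E1 \<inter> E2 = {}" using XY(2) by (auto simp: E1_def E2_def)
    show "W \<inter> (E1 \<union> E2) = {}"
    proof -
      have "e \<notin> E1 \<union> E2" if "e \<in> W" for e
      proof -
        have "X \<inter> S = {}" using XY(1) by auto
        then show ?thesis using that no12 [of e] unfolding W_def E1_def E2_def by blast
      qed
      then show ?thesis by auto
    qed
    show "V \<subseteq> S \<union> \<Union>E" using iso by blast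
    have disj: "x \<notin> e2" if x: "e1 \<in> E1" "e2 \<in> E2" "x \<in> e1" for x e1 e2
      using x no12 [of e2] unfolding E1_def E2_def by blast
    then show "\<Union>E1 \<inter> \<Union>E2 \<subseteq> S \<union> \<Union>W" by fastforce
    show "connected (- drawn S W p \<gamma>)" by (rule con)
    show "E1 \<noteq> {}" using e0 e0X by (auto simp: E1_def)
    show "E2 \<noteq> {}"
    proof -
      obtain e where "e \<in> E" "y0 \<in> e" using iso [OF xyV(2)] by auto
      then show ?thesis using xy unfolding E2_def by blast
    qed
  next
    fix e1 e2 assume e: "e1 \<in> E1" "e2 \<in> E2" "cofacial V E e1 e2"
    obtain b where b: "b \<in> e2" "b \<in> Y" using e by (auto simp: E2_def)
    obtain x x' where x: "e1 = {x, x'}" "x \<noteq> x'" using e(1) G unfolding E1_def simple_graph_def by blast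
    then have xX: "x \<in> X" "x' \<in> X" using e(1) by (auto simp: E1_def)
    obtain A where A: "A \<subseteq> V" "\<forall>e\<in>E. card (e \<inter> A) = 1" using quadrangulation_bipartition [OF Q] .
    have "card ({x, x'} \<inter> A) = 1" using A(2) e(1) x(1) by (auto simp: E1_def)
    then have "x \<in> A \<longleftrightarrow> x' \<notin> A" using card_pair_Int_eq_1 [OF x(2)] by simp
    then obtain a where a: "a \<in> {x, x'}" "a \<in> A \<longleftrightarrow> b \<notin> A" by blast
    then have "a \<in> X" "a \<in> e1" using xX x by auto
    then have ab: "a \<noteq> b" "a \<in> V" "b \<in> V" using XY b by auto
    have "planar V (insert {a, b} E)" using e(3) ab(1) b \<open>a \<in> e1\<close> unfolding cofacial_def by simp
    moreover have "card ({a, b} \<inter> A) = 1" using card_pair_Int_eq_1 [OF ab(1)] a(2) by simp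
    then have "bipartite V (insert {a, b} E)" unfolding bipartite_def using A by (intro exI [of _ A]) simp
    ultimately have "{a, b} \<in> E" using quadrangulationD [OF Q ab(2,3,1)] by simp
    then show False using no b \<open>a \<in> X\<close> by simp
  qed
qed

lemma quadrangulation_connected:
  assumes Q: "quadrangulation V E"
  shows "connected_on E V"
proof (rule ccontr)
  assume "\<not> connected_on E V"
  then obtain X Y where XY: "X \<union> Y = V" "X \<inter> Y = {}" "X \<noteq> {}" "Y \<noteq> {}"
    and no: "\<And>a b. a \<in> X \<Longrightarrow> b \<in> Y \<Longrightarrow> {a, b} \<notin> E" using not_connected_onD by metis
  have G: "simple_graph V E" using planar_simple [OF quadrangulation_planar [OF Q]] .
  obtain x0 y0 where xy: "x0 \<in> X" "y0 \<in> Y" using XY by blast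
  then have "x0 \<in> V" "y0 \<in> V" "y0 \<noteq> x0" using XY by auto
  then obtain e where e: "e \<in> E" "x0 \<in> e" using quadrangulation_not_isolated [OF Q] by blast
  then obtain z where z: "e = {x0, z}" "z \<in> V" using simple_graphD [OF G] by metis
  then have "z \<in> X" using no xy e XY by blast
  then have "e \<subseteq> X" using z xy by simp
  moreover have "\<not> e \<subseteq> X"
    by (rule quadrangulation_no_edge_beside_cut [OF Q, of "{}" X Y]) (use XY no e in auto)
  ultimately show False by blast
qed

text \<open>At a cut vertex \<open>s\<close>, no edge lies inside either side, so every edge
  contains \<open>s\<close>; and no vertex is isolated.\<close>

lemma quadrangulation_2_connected_or_star:
  assumes Q: "quadrangulation V E"
  shows "k_connected 2 V E \<or> star V E"
proof (rule ccontr)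
  assume *: "\<not> ?thesis"
  then obtain S where S: "S \<subseteq> V" "card S < 2" "\<not> connected_on E (V - S)" unfolding k_connected_def by blast
  have G: "simple_graph V E" using planar_simple [OF quadrangulation_planar [OF Q]] .
  have EV: "E \<subseteq> Pow V" "finite V" using simple_graph_finite [OF G] by auto
  have finS: "finite S" using finite_subset [OF _ EV(2)] S by simp
  have "S \<noteq> {}" using S(3) quadrangulation_connected [OF Q] by auto
  then have "card S \<noteq> 0" using finS by simp
  then have "card S = 1" using S(2) by simp
  then obtain s where s: "S = {s}" by (auto simp: card_1_singleton_iff)
  obtain X Y where XY: "X \<union> Y = V - S" "X \<inter> Y = {}" "X \<noteq> {}" "Y \<noteq> {}"
    and no: "\<And>a b. a \<in> X \<Longrightarrow> b \<in> Y \<Longrightarrow> {a, b} \<notin> E" using not_connected_onD [OF S(3)] by metis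
  have no': "{a, b} \<notin> E" if "a \<in> Y" "b \<in> X" for a b using no [OF that(2,1)] by (simp add: insert_commute)
  have X: "\<not> e \<subseteq> X" if "e \<in> E" for e
    by (rule quadrangulation_no_edge_beside_cut [OF Q S(1,2) XY no that])
  have Y: "\<not> e \<subseteq> Y" if "e \<in> E" for e
    by (rule quadrangulation_no_edge_beside_cut [OF Q S(1,2), of Y X]) (use XY no' that in auto)
  have "{s, w} \<in> E" if w: "w \<in> V - {s}" for w
  proof -
    have "s \<in> V" "s \<noteq> w" using s S w by auto
    then obtain e where e: "e \<in> E" "w \<in> e" using quadrangulation_not_isolated [OF Q, of w s] w by blast
    then obtain z where z: "e = {w, z}" "z \<in> V" using simple_graphD [OF G] by metis
    have "z = s"
    proof (rule ccontr)
      assume "z \<noteq> s"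
      then have "w \<in> X \<or> w \<in> Y" "z \<in> X \<or> z \<in> Y" using XY s w z by auto
      then show False using no [of w z] no' [of w z] X [OF e(1)] Y [OF e(1)] z(1) e(1) by auto
    qed
    then show ?thesis using e z by (simp add: insert_commute)
  qed
  then have "star V E" unfolding star_def using s S by blast
  then show False using * by blast
qed

section \<open>Cutting sets in the layers of maximal plane graphs\<close>

context conn_graph begin

text \<open>\<open>close\<close> is where maximality enters. It may assume that \<open>u\<close> and
  \<open>w\<close> are equally far from some \<open>v\<close>, because in the bipartite case this
  gives them the same colour.\<close>

lemma thick_if_cofacial_close:
  assumes pl: "planar V E" and k: "k_connected k V E" and d: "1 \<le> d"
    and close: "\<And>v u w e1 e2. v \<in> V \<Longrightarrow> gdist E v u = gdist E v w \<Longrightarrow> e1 \<in> E \<Longrightarrow> e2 \<in> E \<Longrightarrow>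
      u \<in> e1 \<Longrightarrow> w \<in> e2 \<Longrightarrow> u \<noteq> w \<Longrightarrow> cofacial V E e1 e2 \<Longrightarrow> gdist E u w \<le> d"
  shows "thick d k"
  unfolding thick_def
proof (intro ballI allI impI)
  fix v i x assume v: "v \<in> V" and i: "1 \<le> i" and x: "x \<in> V" "i < gdist E v x"
  define m where "m = gdist E v x"
  define C where "C = {z. (x, z) \<in> {(a, b). {a, b} \<in> E \<and> i < gdist E v a \<and> i < gdist E v b}\<^sup>*}"
  define S where "S = {s \<in> V - C. \<exists>c\<in>C. {s, c} \<in> E}"
  define Q where "Q = V - C - S"
  have xC: "x \<in> C" by (simp add: C_def)
  have C: "z \<in> V \<and> i < gdist E v z" if "z \<in> C" for z
  proof -
    have "(x, z) \<in> {(a, b). {a, b} \<in> E \<and> i < gdist E v a \<and> i < gdist E v b}\<^sup>*" using that by (simp add: C_def)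
    then show ?thesis by (induction rule: rtrancl_induct) (use x edgeV in auto)
  qed
  have C_step: "b \<in> C" if "a \<in> C" "{a, b} \<in> E" "i < gdist E v b" for a b
  proof -
    have "(a, b) \<in> {(a, b). {a, b} \<in> E \<and> i < gdist E v a \<and> i < gdist E v b}" using that C by auto
    then show ?thesis using that(1) unfolding C_def by (metis (no_types, lifting) mem_Collect_eq rtrancl.rtrancl_into_rtrancl)
  qed
  have S_layer: "S \<subseteq> layer v i"
  proof
    fix s assume "s \<in> S"
    then obtain c where c: "s \<in> V" "s \<notin> C" "c \<in> C" "{s, c} \<in> E" unfolding S_def by blast
    have "\<not> i < gdist E v s" using C_step [OF c(3), of s] c by (auto simp: insert_commute)
    moreover have "gdist E v c \<le> gdist E v s + 1" using gdist_edge_le [OF v c(4)] .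
    moreover have "i < gdist E v c" using C c by blast
    ultimately show "s \<in> layer v i" using c by (simp add: layer_def)
  qed
  have vC: "v \<notin> C" "v \<notin> S" using C [of v] S_layer i by (auto simp: layer_def)
  \<comment> \<open>The vertices beyond layer \<open>i\<close> on a shortest path from
    \<open>v\<close> to \<open>x\<close> lie in \<open>C\<close>, so its vertex in layer
    \<open>i\<close> lies in \<open>S\<close>.\<close>
  have geod: "w \<in> C" if "w \<in> V" "gdist E w x = l" "gdist E v w + l = m" "i < gdist E v w" for w l
    using that
  proof (induction l arbitrary: w)
    case 0 then show ?case using gdist_eq_0 x(1) xC by auto
  next
    case (Suc l)
    obtain z where z: "{z, w} \<in> E" "gdist E x z = l" using gdist_pred [OF x(1) Suc.prems(1)] Suc.prems(2) gdist_sym by metis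
    have zV: "z \<in> V" using edgeV z by blast
    have "m \<le> gdist E v z + gdist E z x" unfolding m_def using gdist_triangle v zV x(1) by blast
    then have ge: "m \<le> gdist E v z + l" using z gdist_sym [of x z] by simp
    have "{w, z} \<in> E" using z by (simp add: insert_commute)
    then have "gdist E v z \<le> gdist E v w + 1" using gdist_edge_le [OF v] by blast
    then have "gdist E v z + l = m" "i < gdist E v z" using ge Suc.prems by auto
    then have "z \<in> C" using Suc.IH [OF zV] z gdist_sym [of x z] by simp
    then show ?case using C_step z(1) Suc.prems by blast
  qed
  have cross: "\<exists>s\<in>S. gdist E v x = i + gdist E s x"
  proof -
    obtain s where s: "s \<in> V" "gdist E v s = i" "gdist E s x = m - i"
      using gdist_split [OF v x(1), of i] x(2) unfolding m_def by (metis less_imp_le)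
    then obtain l where l: "gdist E x s = Suc l" "m = i + Suc l"
      using x(2) gdist_sym [of s x] unfolding m_def by (metis Suc_diff_Suc add_diff_inverse_nat less_asym)
    obtain z where z: "{z, s} \<in> E" "gdist E x z = l" using gdist_pred [OF x(1) s(1) l(1)] by metis
    have zV: "z \<in> V" using edgeV z by blast
    have "m \<le> gdist E v z + gdist E z x" unfolding m_def using gdist_triangle v zV x(1) by blast
    then have ge: "m \<le> gdist E v z + l" using z gdist_sym [of x z] by simp
    have "{s, z} \<in> E" using z by (simp add: insert_commute)
    then have "gdist E v z \<le> i + 1" using gdist_edge_le [OF v, of s z] s by simp
    then have "gdist E v z + l = m" "i < gdist E v z" using ge l by auto
    then have "z \<in> C" using geod [OF zV] z gdist_sym [of x z] by simp
    moreover have "s \<notin> C" using C s by auto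
    ultimately have "s \<in> S" using s \<open>{s, z} \<in> E\<close> unfolding S_def by blast
    moreover have "gdist E v x = i + gdist E s x" using s(3) x(2) unfolding m_def by simp
    ultimately show ?thesis by blast
  qed
  have noCQ: "{a, b} \<notin> E" if "a \<in> C" "b \<in> Q" for a b
    using that unfolding Q_def S_def by (auto simp: insert_commute)
  have cardS: "k \<le> card S"
  proof (rule ccontr)
    assume "\<not> ?thesis"
    moreover have "S \<subseteq> V" by (auto simp: S_def)
    ultimately have con: "connected_on E (V - S)" using k unfolding k_connected_def by simp
    have "x \<notin> S" using xC by (simp add: S_def)
    obtain a b where "a \<in> C \<inter> (V - S)" "b \<in> (V - S) - C" "{a, b} \<in> E"
      by (rule connected_onD [OF con xC, of v]) (use x v vC \<open>x \<notin> S\<close> in auto)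
    then show False using noCQ [of a b] by (auto simp: Q_def)
  qed
  have linkedS: "linked d S" unfolding linked_def
  proof (intro allI impI, rule ccontr)
    fix S1 assume S1: "S1 \<subseteq> S" "S1 \<noteq> {} \<and> S1 \<noteq> S" and far: "\<not> (\<exists>a\<in>S1. \<exists>b\<in>S - S1. gdist E a b \<le> d)"
    define S2 where "S2 = S - S1"
    have SS: "S1 \<union> S2 = S" "S1 \<inter> S2 = {}" "S2 \<noteq> {}" using S1 by (auto simp: S2_def)
    \<comment> \<open>From \<open>x\<close> inside \<open>C\<close> to a neighbour of
      \<open>s\<close>, then from \<open>s\<close> down a shortest path to \<open>v\<close>, which
      leaves layer \<open>i\<close> at once. The only vertex of \<open>S\<close> used is
      \<open>s\<close>.\<close>
    have route: "(x, v) \<in> {(a, b). {a, b} \<in> {e \<in> E. e \<inter> T = {}}}\<^sup>*" if T: "T \<subseteq> S" and s: "s \<in> S" "s \<notin> T" for s T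
    proof -
      let ?R = "{(a, b). {a, b} \<in> {e \<in> E. e \<inter> T = {}}}"
      have CT: "C \<inter> T = {}" using T by (auto simp: S_def)
      have in_C: "(x, z) \<in> ?R\<^sup>*" if "z \<in> C" for z
      proof -
        have "(x, z) \<in> {(a, b). {a, b} \<in> E \<and> i < gdist E v a \<and> i < gdist E v b}\<^sup>*" using that by (simp add: C_def)
        then show ?thesis
        proof (induction rule: rtrancl_induct)
          case (step a b)
          then have "a \<notin> T" "b \<notin> T" using T S_layer by (auto simp: layer_def)
          then have "(a, b) \<in> ?R" using step by simp
          then show ?case using step.IH by (rule_tac rtrancl.rtrancl_into_rtrancl)
        qed simp
      qed
      have down: "(w, v) \<in> ?R\<^sup>*" if "w \<in> V" "w \<notin> T" "gdist E v w = l" "l \<le> i" for w l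
        using that
      proof (induction l arbitrary: w)
        case 0 then show ?case using gdist_eq_0 [OF v] by auto
      next
        case (Suc l)
        obtain z where z: "{z, w} \<in> E" "gdist E v z = l" using gdist_pred [OF v Suc.prems(1,3)] by metis
        have zT: "z \<notin> T" using z(2) Suc.prems T S_layer by (auto simp: layer_def)
        have "z \<in> V" using edgeV z by blast
        then have "(z, v) \<in> ?R\<^sup>*" using Suc.IH [OF _ zT z(2)] Suc.prems by simp
        moreover have "(w, z) \<in> ?R" using z zT Suc.prems by (simp add: insert_commute)
        ultimately show ?case by (rule_tac converse_rtrancl_into_rtrancl)
      qed
      obtain c where c: "c \<in> C" "{s, c} \<in> E" using s(1) unfolding S_def by blast
      have "(c, s) \<in> ?R" using c s CT by (auto simp: insert_commute)
      moreover have "(s, v) \<in> ?R\<^sup>*" using down [of s i] s S_layer by (auto simp: layer_def)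
      ultimately have "(c, v) \<in> ?R\<^sup>*" by (rule_tac converse_rtrancl_into_rtrancl)
      with in_C [OF c(1)] show ?thesis by (rule rtrancl_trans)
    qed
    obtain s1 s2 where s12: "s1 \<in> S1" "s2 \<in> S2" using S1 SS by blast
    show False
    proof (rule separator_cofacial [OF pl, of C S1 S2 Q x v])
      show "V = C \<union> (S1 \<union> S2) \<union> Q" unfolding SS(1) Q_def using C by (auto simp: S_def)
      show "C \<inter> (S1 \<union> S2) = {}" "Q \<inter> (S1 \<union> S2) = {}" "C \<inter> Q = {}" unfolding SS(1) by (auto simp: S_def Q_def)
      show "S1 \<inter> S2 = {}" by (rule SS(2))
      show "{a, b} \<notin> E" if "a \<in> C" "b \<in> Q" for a b using noCQ that by blast
      show "{a, b} \<notin> E" if "a \<in> S1" "b \<in> S2" for a b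
      proof
        assume "{a, b} \<in> E"
        then have "gdist E a b \<le> d" using gdist_edge [of a b] d by simp
        then show False using far that by (auto simp: S2_def)
      qed
      show "S1 \<union> S2 \<subseteq> \<Union>E" unfolding SS(1) by (auto simp: S_def)
      show "x \<in> C" by (rule xC)
      show "v \<in> Q" using v vC by (simp add: Q_def)
      show "(x, v) \<in> {(a, b). {a, b} \<in> {e \<in> E. e \<inter> S2 = {}}}\<^sup>*" by (rule route [of _ s1]) (use s12 SS in auto)
      show "(x, v) \<in> {(a, b). {a, b} \<in> {e \<in> E. e \<inter> S1 = {}}}\<^sup>*" by (rule route [of _ s2]) (use s12 SS in auto)
    next
      fix e1 e2 assume e: "e1 \<in> E" "e2 \<in> E" "e1 \<inter> S1 \<noteq> {}" "e2 \<inter> S2 \<noteq> {}" "cofacial V E e1 e2"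
      obtain u w where uw: "u \<in> e1" "u \<in> S1" "w \<in> e2" "w \<in> S2" using e by auto
      then have "u \<in> layer v i" "w \<in> layer v i" "u \<noteq> w" using SS S_layer by auto
      then have "gdist E u w \<le> d" by (intro close [OF v _ e(1,2) uw(1,3) _ e(5)]) (auto simp: layer_def)
      then show False using far uw by (auto simp: S2_def)
    qed
  qed
  show "\<exists>S\<subseteq>layer v i. k \<le> card S \<and> linked d S \<and> (\<exists>s\<in>S. gdist E v x = i + gdist E s x)"
    using S_layer cardS linkedS cross by blast
qed

lemma thick_triangulation:
  assumes T: "triangulation V E" and k: "k_connected k V E"
  shows "thick 1 k"
proof (rule thick_if_cofacial_close [OF triangulation_planar [OF T] k])
  fix v u w e1 e2 assume e: "e1 \<in> E" "e2 \<in> E" "u \<in> e1" "w \<in> e2" "u \<noteq> w" "cofacial V E e1 e2"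
  then have "planar V (insert {u, w} E)" by (simp add: cofacial_def)
  moreover have "u \<in> V" "w \<in> V" using e simple_graphD [OF simple] by metis+
  ultimately have "{u, w} \<in> E" using triangulationD [OF T] e(5) by simp
  then show "gdist E u w \<le> 1" by (rule gdist_edge)
qed simp

lemma bipartite_parity:
  assumes A: "\<forall>e\<in>E. card (e \<inter> A) = 1" and "v \<in> V" "x \<in> V"
  shows "even (gdist E v x) \<longleftrightarrow> (v \<in> A \<longleftrightarrow> x \<in> A)"
proof -
  have "even k \<longleftrightarrow> (v \<in> A \<longleftrightarrow> x \<in> A)" if "(v, x) \<in> adj E ^^ k" for x k
    using that
  proof (induction k arbitrary: x)
    case (Suc k)
    then obtain y where y: "(v, y) \<in> adj E ^^ k" "{y, x} \<in> E" by (auto simp: adj_def)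
    then have "y \<noteq> x" using edgeV by blast
    then have "y \<in> A \<longleftrightarrow> x \<notin> A" using A [rule_format, OF y(2)] card_pair_Int_eq_1 [OF \<open>y \<noteq> x\<close>] by simp
    then show ?case using Suc.IH [OF y(1)] by auto
  qed simp
  from this [OF reach [OF assms(2,3)]] show ?thesis .
qed

text \<open>\<open>u\<close> and \<open>w\<close> have the same colour and cannot be joined; instead
  \<open>u\<close> is joined to \<open>z\<close>, the other end of \<open>e2\<close>, which gives a
  path of length 2.\<close>

lemma thick_quadrangulation:
  assumes Q: "quadrangulation V E" and k: "k_connected k V E"
  shows "thick 2 k"
proof (rule thick_if_cofacial_close [OF quadrangulation_planar [OF Q] k])
  fix v u w e1 e2 assume v: "v \<in> V" "gdist E v u = gdist E v w"
    and e: "e1 \<in> E" "e2 \<in> E" "u \<in> e1" "w \<in> e2" "u \<noteq> w" "cofacial V E e1 e2"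
  obtain A where A: "A \<subseteq> V" "\<forall>e\<in>E. card (e \<inter> A) = 1" using quadrangulation_bipartition [OF Q] .
  obtain z where z: "e2 = {w, z}" "z \<noteq> w" "w \<in> V" "z \<in> V" using simple_graphD [OF simple e(2,4)] by metis
  have u: "u \<in> V" using e simple_graphD [OF simple] by metis
  have wz: "{w, z} \<in> E" using e z by simp
  have "u \<in> A \<longleftrightarrow> w \<in> A" using bipartite_parity [OF A(2) v(1) u] bipartite_parity [OF A(2) v(1) z(3)] v(2) by auto
  moreover have "card ({w, z} \<inter> A) = 1" using A(2) wz by simp
  then have "w \<in> A \<longleftrightarrow> z \<notin> A" using card_pair_Int_eq_1 [of w z] z(2) by simp
  ultimately have uz: "u \<in> A \<longleftrightarrow> z \<notin> A" by simp
  then have "u \<noteq> z" by auto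
  have "planar V (insert {u, z} E)" using e(3,6) z(1) \<open>u \<noteq> z\<close> by (simp add: cofacial_def)
  moreover have "card ({u, z} \<inter> A) = 1" using card_pair_Int_eq_1 [OF \<open>u \<noteq> z\<close>] uz by simp
  then have "bipartite V (insert {u, z} E)" unfolding bipartite_def using A by (intro exI [of _ A]) simp
  ultimately have "{u, z} \<in> E" using quadrangulationD [OF Q u z(4) \<open>u \<noteq> z\<close>] by simp
  then have "gdist E u z \<le> 1" by (rule gdist_edge)
  moreover have "gdist E z w \<le> 1" using gdist_edge [of z w] wz by (simp add: insert_commute)
  ultimately show "gdist E u w \<le> 2" using gdist_triangle [OF u z(4,3)] by simp
qed simp

end

section \<open>Summing over the layers\<close>

text \<open>Layer \<open>j\<close>, counted from either end, may fall short of \<open>2k\<close> vertices by \<open>deficit l j\<close>.\<close>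

definition deficit :: "int list \<Rightarrow> nat \<Rightarrow> int" where
  "deficit l j = (if j < length l then l ! j else 0)"

lemma deficit_nonneg: "\<forall>x\<in>set l. 0 \<le> x \<Longrightarrow> 0 \<le> deficit l j"
  by (auto simp: deficit_def)

lemma sum_deficit_le:
  assumes "\<forall>x\<in>set l. 0 \<le> x"
  shows "(\<Sum>j\<le>r. deficit l j) \<le> sum_list l"
proof -
  have "(\<Sum>j\<le>r. deficit l j) \<le> (\<Sum>j\<in>{..r} \<union> {..<length l}. deficit l j)"
    by (rule sum_mono2) (use deficit_nonneg [OF assms] in auto)
  also have "\<dots> = (\<Sum>j<length l. deficit l j)"
    by (rule sum.mono_neutral_right) (auto simp: deficit_def)
  also have "\<dots> = sum_list l" by (simp add: deficit_def sum_list_sum_nth atLeast0LessThan)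
  finally show ?thesis .
qed

context conn_graph begin

lemma proximity_le_average: "v \<in> V \<Longrightarrow> proximity V E \<le> total_distance V E v / (real (card V) - 1)"
  unfolding proximity_def average_distance_def [symmetric] using finV by (intro Min_le) auto

lemma total_distance_sum: "total_distance V E v = real (\<Sum>x\<in>V. gdist E v x)"
  by (simp add: total_distance_def)

lemma sum_layers_int:
  assumes "\<And>x. x \<in> V \<Longrightarrow> gdist E v x \<le> r"
  shows "int (card V) = (\<Sum>j\<le>r. int (card (layer v j)))"
    "int (\<Sum>x\<in>V. gdist E v x) = (\<Sum>j\<le>r. int j * int (card (layer v j)))"
  using sum_layers [OF assms] by simp_all

lemma distance_sum_le:
  fixes k :: nat
  assumes v: "v \<in> V" and r: "r = eccentricity V E v" and l: "\<forall>x\<in>set l. 0 \<le> x" "l \<noteq> []" "l ! 0 = 2 * int k - 1"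
    and low: "\<And>j. 1 \<le> j \<Longrightarrow> j < r \<Longrightarrow> 2 * int k - deficit l j - deficit l (r - j) \<le> int (card (layer v j))"
  shows "int (\<Sum>x\<in>V. gdist E v x) \<le> int r * (int (card V) - int k * (int r + 1) + sum_list l)"
proof -
  have bd: "gdist E v x \<le> r" if "x \<in> V" for x using ecc_ge [OF that] r by simp
  have low': "2 * int k - deficit l j - deficit l (r - j) \<le> int (card (layer v j))" if "j < r" for j
  proof (cases "j = 0")
    case True
    then show ?thesis using layer_0 [OF v] l deficit_nonneg [OF l(1), of r] by (simp add: deficit_def [of l 0])
  next
    case False then show ?thesis using low that by simp
  qed
  have "int (\<Sum>x\<in>V. gdist E v x) \<le> int r * int (card V) - int k * int r * (int r + 1)
    + (\<Sum>j\<le>r. (int r - int j) * deficit l j) + (\<Sum>j\<le>r. int j * deficit l j)"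
    using weighted_layer_sum_le [of r "int k" "deficit l" "deficit l" "\<lambda>j. int (card (layer v j))"] low'
      sum_layers_int [OF bd] by simp
  \<comment> \<open>The weights of the two ends add up to \<open>r\<close>, independently of the
    position.\<close>
  moreover have "(\<Sum>j\<le>r. (int r - int j) * deficit l j) + (\<Sum>j\<le>r. int j * deficit l j) = int r * (\<Sum>j\<le>r. deficit l j)"
    by (simp add: sum.distrib [symmetric] sum_distrib_left algebra_simps)
  moreover have "int r * (\<Sum>j\<le>r. deficit l j) \<le> int r * sum_list l"
    using sum_deficit_le [OF l(1), of r] by (intro mult_left_mono) auto
  ultimately show ?thesis by (simp add: algebra_simps)
qed

text \<open>A last layer with a single vertex is merged into the previous one; the unit lost in the sum is
  recovered from the lower bound for the layer at distance 3 from the end.\<close>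

lemma distance_sum_le_single_end:
  fixes k :: nat
  assumes v: "v \<in> V" and s: "Suc s = eccentricity V E v" "2 \<le> s" and one: "card (layer v (Suc s)) = 1"
    and l: "\<forall>x\<in>set l. 0 \<le> x" "2 < length l" "l ! 0 = 2 * int k - 1" "1 \<le> l ! 2"
    and low: "\<And>j. 1 \<le> j \<Longrightarrow> j < s \<Longrightarrow>
      2 * int k - deficit l j - ((deficit l)(2 := deficit l 2 - 1)) (s - j) \<le> int (card (layer v j))"
  shows "int (\<Sum>x\<in>V. gdist E v x) \<le> int s * (int (card V) - int k * (int s + 1) + sum_list l)"
proof -
  \<comment> \<open>Counted from the merged last layer \<open>s\<close>, position 2 is layer
    \<open>s - 2\<close>, which is 3 steps from layer \<open>Suc s\<close>.\<close>
  define b where "b = (deficit l)(2 := deficit l 2 - 1)"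
  define N where "N = (\<lambda>j. int (card (layer v j)))(s := int (card (layer v s)) + 1)"
  have bd: "gdist E v x \<le> Suc s" if "x \<in> V" for x using ecc_ge [OF that] s by simp
  have b0: "0 \<le> b j" for j using deficit_nonneg [OF l(1), of j] l(2,4) by (simp add: b_def deficit_def)
  have low': "2 * int k - deficit l j - b (s - j) \<le> N j" if "j < s" for j
  proof (cases "j = 0")
    case True
    have "deficit l 0 = 2 * int k - 1" using l(2,3) by (auto simp: deficit_def)
    then show ?thesis using True that layer_0 [OF v] b0 [of s] by (simp add: N_def)
  next
    case False then show ?thesis using low [of j] that by (simp add: N_def b_def)
  qed
  have split: "(\<Sum>j\<le>s. f j) = (\<Sum>j<s. f j) + f s" for f :: "nat \<Rightarrow> int"
    by (simp add: lessThan_Suc_atMost [symmetric])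
  have N1: "(\<Sum>j\<le>s. N j) = int (card V)"
    using sum_layers_int(1) [OF bd] one by (simp add: split N_def)
  \<comment> \<open>The vertex merged into layer \<open>s\<close> is counted there with a distance
    that is 1 too small.\<close>
  have N2: "int (\<Sum>x\<in>V. gdist E v x) = (\<Sum>j\<le>s. int j * N j) + 1"
    using sum_layers_int(2) [OF bd] one by (simp add: split N_def algebra_simps)
  have "(\<Sum>j\<le>s. int j * N j) \<le> int s * int (card V) - int k * int s * (int s + 1)
    + (\<Sum>j\<le>s. (int s - int j) * deficit l j) + (\<Sum>j\<le>s. int j * b j)"
    using weighted_layer_sum_le [of s "int k" "deficit l" b N] low' unfolding N1 by simp
  \<comment> \<open>The lowered entry has weight 2; saving 2 covers the additional 1 in
    \<open>N2\<close>.\<close>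
  moreover have "(\<Sum>j\<le>s. int j * b j) = (\<Sum>j\<le>s. int j * deficit l j) - 2"
  proof -
    have "(\<Sum>j\<le>s. int j * b j) = (\<Sum>j\<le>s. int j * deficit l j - (if j = 2 then 2 else 0))"
      by (rule sum.cong) (auto simp: b_def)
    also have "\<dots> = (\<Sum>j\<le>s. int j * deficit l j) - (\<Sum>j\<le>s. if j = 2 then 2 else 0)"
      by (rule sum_subtractf)
    also have "(\<Sum>j\<le>s. if j = 2 then 2 else 0) = (2::int)" using s(2) by simp
    finally show ?thesis .
  qed
  moreover have "(\<Sum>j\<le>s. (int s - int j) * deficit l j) + (\<Sum>j\<le>s. int j * deficit l j) = int s * (\<Sum>j\<le>s. deficit l j)"
    by (simp add: sum.distrib [symmetric] sum_distrib_left algebra_simps)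
  moreover have "int s * (\<Sum>j\<le>s. deficit l j) \<le> int s * sum_list l"
    using sum_deficit_le [OF l(1), of s] by (intro mult_left_mono) auto
  ultimately show ?thesis using N2 by (simp add: algebra_simps)
qed

text \<open>With \<open>N = n - 1\<close> the bound on the sum is the parabola
  \<open>s * (N + D - k * s)\<close>, whose maximum is \<open>(N + D)^2 / (4 * k)\<close>.
  Completing the square eliminates \<open>s\<close>; dividing by \<open>N\<close> and expanding
  gives the two terms.\<close>

lemma proximity_le_of_sum:
  fixes k :: nat and A :: int
  assumes v: "v \<in> V" and n: "2 \<le> card V" and k: "0 < k"
    and sum: "int (\<Sum>x\<in>V. gdist E v x) \<le> int s * (int (card V) - int k * (int s + 1) + A)"
    and D: "D = real_of_int A + 1 - real k"
  shows "proximity V E \<le> (real (card V) - 1 + 2 * D) / (4 * real k) + D\<^sup>2 / (4 * real k * (real (card V) - 1))"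
proof -
  define N where "N = real (card V) - 1"
  have N: "0 < N" using n by (simp add: N_def)
  have "real_of_int (int (\<Sum>x\<in>V. gdist E v x)) \<le> real_of_int (int s * (int (card V) - int k * (int s + 1) + A))"
    using sum by (simp only: of_int_le_iff)
  then have "total_distance V E v \<le> real s * (N + D - real k * real s)"
    by (simp add: total_distance_sum N_def D algebra_simps)
  moreover have "4 * real k * (real s * (N + D - real k * real s)) = (N + D)\<^sup>2 - (N + D - 2 * real k * real s)\<^sup>2"
    by (simp add: power2_eq_square algebra_simps)
  ultimately have "4 * real k * total_distance V E v \<le> (N + D)\<^sup>2"
    using mult_left_mono [of "total_distance V E v" "real s * (N + D - real k * real s)" "4 * real k"]
    by (smt (verit) of_nat_0_le_iff zero_le_power2)
  then have "total_distance V E v / N \<le> (N + D)\<^sup>2 / (4 * real k) / N"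
    using k N by (intro divide_right_mono) (auto simp: field_simps)
  also have "\<dots> = (N + 2 * D) / (4 * real k) + D\<^sup>2 / (4 * real k * N)"
    using k N by (simp add: field_simps power2_eq_square)
  finally show ?thesis using proximity_le_average [OF v] unfolding N_def by linarith
qed

lemma small_layer_near_ends:
  assumes th: "thick d k" and d: "0 < d" and c: "central_vertex V E v" and r: "r = eccentricity V E v"
    and small: "card (layer v j) < 2 * k" and t: "t = d * (card (layer v j) div 2) + 1"
  shows "j < t \<or> r - j \<le> t" "card (layer v j) = k \<Longrightarrow> j < t \<or> r - j < t"
    "\<nexists>w. central_vertex V E w \<and> card (layer w r) = 1 \<Longrightarrow> j < t \<or> r - j < t"
proof -
  have far: "t \<le> j \<and> j + t \<le> eccentricity V E v" if "\<not> (j < t \<or> r - j < t)"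
  proof -
    have "1 \<le> t" using t by simp
    then show ?thesis using that unfolding r by linarith
  qed
  note move = small_layer_move [OF th d c small t]
  show "j < t \<or> r - j \<le> t" using far move(1) r by fastforce
  show "j < t \<or> r - j < t" if "card (layer v j) = k" using far move(2) that by blast
  show "j < t \<or> r - j < t" if "\<nexists>w. central_vertex V E w \<and> card (layer w r) = 1"
    using far move(3) that r by blast
qed

text \<open>\<open>near\<close> is a finite arithmetical condition on \<open>l\<close>: the entry at
  each position where a layer of \<open>m\<close> vertices can occur must be at least
  \<open>2 * k - m\<close>. These positions are \<open>j < t\<close> and, at the far end, also
  \<open>t\<close> itself by the exceptional case of \<open>small_layer_move\<close>, which excludes
  \<open>m = k\<close>.\<close>

lemma proximity_triangulation:
  assumes T: "triangulation V E" and kc: "k_connected k V E" and V: "2 \<le> card V"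
    and l: "\<forall>x\<in>set l. 0 \<le> x" "l \<noteq> []" "l ! 0 = 2 * int k - 1" and k: "0 < k"
    and near: "\<And>m t j. k \<le> m \<Longrightarrow> m < 2 * k \<Longrightarrow> t = m div 2 + 1 \<Longrightarrow> 1 \<le> j \<Longrightarrow>
      j < t \<or> (m \<noteq> k \<and> j = t) \<Longrightarrow> 2 * int k - int m \<le> deficit l j"
    and D: "D = real_of_int (sum_list l) + 1 - real k"
  shows "proximity V E \<le> (real (card V) - 1 + 2 * D) / (4 * real k) + D\<^sup>2 / (4 * real k * (real (card V) - 1))"
proof -
  have "V \<noteq> {}" using V by auto
  then obtain v where c: "central_vertex V E v" using ex_central by blast
  then have v: "v \<in> V" by (simp add: central_vertex_def)
  define r where "r = eccentricity V E v"
  have th: "thick 1 k" by (rule thick_triangulation [OF T kc])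
  have "int (\<Sum>x\<in>V. gdist E v x) \<le> int r * (int (card V) - int k * (int r + 1) + sum_list l)"
  proof (rule distance_sum_le [OF v r_def l])
    fix j assume j: "1 \<le> j" "j < r"
    define m where "m = card (layer v j)"
    define t where "t = m div 2 + 1"
    have km: "k \<le> m" using layer_ge [OF th v j(1)] j(2) unfolding m_def r_def by simp
    have nn: "0 \<le> deficit l i" for i by (rule deficit_nonneg [OF l(1)])
    show "2 * int k - deficit l j - deficit l (r - j) \<le> int (card (layer v j))"
    proof (cases "m < 2 * k")
      case False then show ?thesis using nn [of j] nn [of "r - j"] by (simp add: m_def [symmetric])
    next
      case True
      have ends: "j < t \<or> r - j \<le> t" "m = k \<Longrightarrow> j < t \<or> r - j < t"
        using small_layer_near_ends(1,2) [OF th _ c r_def, of j t] True by (simp_all add: m_def t_def)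
      then have "(j < t \<or> (m \<noteq> k \<and> j = t)) \<or> (r - j < t \<or> (m \<noteq> k \<and> r - j = t))" by auto
      moreover have "1 \<le> r - j" using j by simp
      ultimately have "2 * int k - int m \<le> deficit l j \<or> 2 * int k - int m \<le> deficit l (r - j)"
        using near [OF km True t_def] j by blast
      then show ?thesis using nn [of j] nn [of "r - j"] by (auto simp: m_def [symmetric])
    qed
  qed
  then show ?thesis by (rule proximity_le_of_sum [OF v V k _ D])
qed

text \<open>Here \<open>l\<close> has to cover the positions \<open>j < t\<close> only. The position
  \<open>r - j = t\<close> occurs only if some central vertex \<open>w\<close> has a single farthest
  vertex; then the count starts from \<open>w\<close> and merges the last layer into the previous
  one, so that \<open>r - j = t\<close> becomes \<open>s - j < t\<close>.\<close>

lemma proximity_quadrangulation: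
  assumes Q: "quadrangulation V E" and kc: "k_connected k V E" and V: "2 \<le> card V"
    and l: "\<forall>x\<in>set l. 0 \<le> x" "2 < length l" "l ! 0 = 2 * int k - 1" "1 \<le> l ! 2" and k: "2 \<le> k"
    and near: "\<And>m t j. k \<le> m \<Longrightarrow> m < 2 * k \<Longrightarrow> t = 2 * (m div 2) + 1 \<Longrightarrow> 1 \<le> j \<Longrightarrow>
      j < t \<Longrightarrow> 2 * int k - int m \<le> deficit l j"
    and near': "\<And>m. k < m \<Longrightarrow> m < 2 * k \<Longrightarrow> 2 * int k - int m \<le> deficit l 2 - 1" "int k \<le> deficit l 1"
      "k div 2 = 1"
    and D: "D = real_of_int (sum_list l) + 1 - real k"
  shows "proximity V E \<le> (real (card V) - 1 + 2 * D) / (4 * real k) + D\<^sup>2 / (4 * real k * (real (card V) - 1))"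
proof -
  have "V \<noteq> {}" using V by auto
  then obtain v where c: "central_vertex V E v" using ex_central by blast
  then have v: "v \<in> V" by (simp add: central_vertex_def)
  define r where "r = eccentricity V E v"
  have th: "thick 2 k" by (rule thick_quadrangulation [OF Q kc])
  have nn: "0 \<le> deficit l i" for i by (rule deficit_nonneg [OF l(1)])
  have k0: "0 < k" and lne: "l \<noteq> []" using k l by auto
  show ?thesis
  \<comment> \<open>As \<open>t\<close> is at least 3, a radius of at most 5 already forces
    \<open>j < t\<close> or \<open>r - j < t\<close>.\<close>
  proof (cases "r \<le> 5 \<or> (\<nexists>w. central_vertex V E w \<and> card (layer w r) = 1)")
    case True
    have "int (\<Sum>x\<in>V. gdist E v x) \<le> int r * (int (card V) - int k * (int r + 1) + sum_list l)"
    proof (rule distance_sum_le [OF v r_def l(1) lne l(3)])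
      fix j assume j: "1 \<le> j" "j < r"
      define m where "m = card (layer v j)"
      define t where "t = 2 * (m div 2) + 1"
      have km: "k \<le> m" using layer_ge [OF th v j(1)] j(2) unfolding m_def r_def by simp
      show "2 * int k - deficit l j - deficit l (r - j) \<le> int (card (layer v j))"
      proof (cases "m < 2 * k")
        case False then show ?thesis using nn [of j] nn [of "r - j"] by (simp add: m_def [symmetric])
      next
        case small: True
        have "1 \<le> m div 2" using km k by linarith
        then have "3 \<le> t" by (simp add: t_def)
        have "j < t \<or> r - j < t"
        proof (cases "r \<le> 5")
          case True then show ?thesis using \<open>3 \<le> t\<close> by linarith
        next
          case False
          then show ?thesis
            using True small small_layer_near_ends(3) [OF th _ c r_def, of j t] by (simp add: m_def t_def)
        qed
        moreover have "1 \<le> r - j" using j by simp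
        ultimately have "2 * int k - int m \<le> deficit l j \<or> 2 * int k - int m \<le> deficit l (r - j)"
          using near [OF km small t_def] j by blast
        then show ?thesis using nn [of j] nn [of "r - j"] by (auto simp: m_def [symmetric])
      qed
    qed
    then show ?thesis by (rule proximity_le_of_sum [OF v V k0 _ D])
  next
    case False
    then obtain w where cw: "central_vertex V E w" and one: "card (layer w r) = 1" by blast
    have w: "w \<in> V" using cw by (simp add: central_vertex_def)
    have rw: "r = eccentricity V E w" using c cw unfolding r_def central_vertex_def by (meson order_antisym)
    define s where "s = r - 1"
    have s: "Suc s = r" "2 \<le> s" using False by (auto simp: s_def)
    have "int (\<Sum>x\<in>V. gdist E w x) \<le> int s * (int (card V) - int k * (int s + 1) + sum_list l)"
    proof (rule distance_sum_le_single_end [OF w _ s(2) _ l])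
      show "Suc s = eccentricity V E w" "card (layer w (Suc s)) = 1" using s rw one by simp_all
      fix j assume j: "1 \<le> j" "j < s"
      define b where "b = (deficit l)(2 := deficit l 2 - 1)"
      define m where "m = card (layer w j)"
      define t where "t = 2 * (m div 2) + 1"
      have jr: "j < eccentricity V E w" using j s rw by simp
      have km: "k \<le> m" using layer_ge [OF th w j(1) jr] unfolding m_def by simp
      have nb: "0 \<le> b i" for i using nn [of i] l(2,4) by (simp add: b_def deficit_def)
      have "2 * int k - int m \<le> deficit l j \<or> 2 * int k - int m \<le> b (s - j)" if small: "m < 2 * k"
      proof (cases "m = k")
        case True
        then have t3: "t = 3" using near'(3) by (simp add: t_def)
        have "j < t \<or> r - j < t"
          using small_layer_near_ends(2) [OF th _ cw rw, of j t] True small by (simp add: m_def t_def)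
        \<comment> \<open>At the far end a layer of exactly \<open>k\<close> vertices can only be at
          position 1 after merging, so it does not compete for the entry at position 2 that was
          lowered by 1.\<close>
        then consider "j < t" | "s - j = 1" using t3 j s(1) by linarith
        then show ?thesis
        proof cases
          case 1 then show ?thesis using near [OF km small t_def j(1)] by simp
        next
          case 2 then show ?thesis using near'(2) True by (simp add: b_def)
        qed
      next
        case False
        then have "k < m" using km by simp
        have "j < t \<or> r - j \<le> t"
          using small_layer_near_ends(1) [OF th _ cw rw, of j t] small by (simp add: m_def t_def)
        then consider "j < t" | "s - j < t" using s(1) j by linarith
        then show ?thesis
        proof cases
          case 1 then show ?thesis using near [OF km small t_def j(1)] by simp
        next
          case 2
          have "1 \<le> s - j" using j by simp
          then have "2 * int k - int m \<le> deficit l (s - j)" using near [OF km small t_def] 2 by blast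
          then show ?thesis using near'(1) [OF \<open>k < m\<close> small] by (auto simp: b_def)
        qed
      qed
      then have "2 * int k - deficit l j - b (s - j) \<le> int m"
        using nn [of j] nb [of "s - j"] by linarith
      then show "2 * int k - deficit l j - ((deficit l)(2 := deficit l 2 - 1)) (s - j) \<le> int (card (layer w j))"
        by (simp only: b_def m_def)
    qed
    then show ?thesis by (rule proximity_le_of_sum [OF w V k0 _ D])
  qed
qed

lemma proximity_star:
  assumes "star V E" and V: "2 \<le> card V"
  shows "proximity V E \<le> 1"
proof -
  obtain s where s: "s \<in> V" "\<And>w. w \<in> V - {s} \<Longrightarrow> {s, w} \<in> E" using assms unfolding star_def by blast
  have "(\<Sum>x\<in>V. gdist E s x) = (\<Sum>x\<in>V - {s}. gdist E s x)"
    using finV s(1) by (simp add: sum.remove)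
  also have "\<dots> \<le> (\<Sum>x\<in>V - {s}. 1)" using s(2) gdist_edge by (intro sum_mono) auto
  also have "\<dots> = card V - 1" using finV s(1) by simp
  finally have "total_distance V E s \<le> real (card V - 1)" unfolding total_distance_sum by (simp only: of_nat_le_iff)
  then have "total_distance V E s / (real (card V) - 1) \<le> 1" using V by (simp add: of_nat_diff)
  then show ?thesis using proximity_le_average [OF s(1)] by linarith
qed

end

section \<open>The five bounds\<close>

lemma k_connected_imp_conn_graph:
  assumes "simple_graph V E" "k_connected k V E" "0 < k"
  shows "conn_graph V E"
proof
  have "connected_on E (V - {})" using assms(2,3) unfolding k_connected_def by (metis card.empty empty_subsetI)
  then show "connected_on E V" by simp
qed (rule assms)

theorem theorem2p6:
  fixes V :: "'a set" and E :: "'a set set" and v :: 'a and n :: nat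
  assumes "planar V E"
    and "n = card V"
    and "central_vertex V E v"
  shows "(triangulation V E \<longrightarrow>
            proximity V E \<le> (real n + 19) / 12 + 25 / (3 * (real n - 1)))
       \<and> (triangulation V E \<and> k_connected 4 V E \<longrightarrow>
            proximity V E \<le> (real n + 35) / 16 + 91 / (4 * (real n - 1)))
       \<and> (triangulation V E \<and> k_connected 5 V E \<longrightarrow>
            proximity V E \<le> (real n + 57) / 20 + 393 / (10 * (real n - 1)))
       \<and> (quadrangulation V E \<longrightarrow>
            proximity V E \<le> (real n + 11) / 8 + 9 / (2 * (real n - 1)))
       \<and> (quadrangulation V E \<and> k_connected 3 V E \<longrightarrow>
            proximity V E \<le> (real n + 25) / 12 + 169 / (12 * (real n - 1)))"
proof -
  have G: "simple_graph V E" by (rule planar_simple [OF assms(1)])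
  have finV: "finite V" and v: "v \<in> V" using G assms(3) by (auto simp: simple_graph_def central_vertex_def)
  then have "n \<noteq> 0" using assms(2) by auto
  then consider "n = 1" | "2 \<le> n" by linarith
  then show ?thesis
  proof cases
    case 1
    then obtain u where "V = {u}" using assms(2) by (metis card_1_singletonE)
    \<comment> \<open>For \<open>n = 1\<close> the average distance and the last terms of the bounds
      are quotients by 0, hence 0.\<close>
    then have "proximity V E = 0" by (simp add: proximity_def average_distance_def)
    then show ?thesis using 1 by simp
  next
    case 2
    then have V: "2 \<le> card V" using assms(2) by simp
    define N where "N = real (card V) - 1"
    have N: "1 \<le> N" and n: "real n = N + 1" using V assms(2) by (auto simp: N_def)
    have graph: "conn_graph V E" if "k_connected k V E" "0 < k" for k
      by (rule k_connected_imp_conn_graph [OF G that])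
    show ?thesis
    proof (intro conjI impI)
      assume T: "triangulation V E"
      have k: "k_connected 3 V E" by (rule triangulation_3_connected [OF T])
      \<comment> \<open>Layers of 3 vertices (\<open>t = 2\<close>) need an entry 3 at position 1;
        layers of 4 (\<open>t = 3\<close>) need 2 at positions 1 to 3. With total 12,
        \<open>D = 12 + 1 - 3 = 10\<close>.\<close>
      have "proximity V E \<le> (N + 2 * 10) / (4 * real 3) + 10\<^sup>2 / (4 * real 3 * N)"
        unfolding N_def
      proof (rule conn_graph.proximity_triangulation [OF graph [OF k] T k V, of "[5, 3, 2, 2]"])
        fix m t j :: nat assume "3 \<le> m" "m < 2 * 3" "t = m div 2 + 1" "1 \<le> j" "j < t \<or> (m \<noteq> 3 \<and> j = t)"
        moreover from this have "m = 3 \<or> m = 4 \<or> m = 5" "j = 1 \<or> j = 2 \<or> j = 3" by linarith+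
        ultimately show "2 * int 3 - int m \<le> deficit [5, 3, 2, 2] j"
          by (elim disjE) (simp_all add: deficit_def)
      qed simp_all
      then show "proximity V E \<le> (real n + 19) / 12 + 25 / (3 * (real n - 1))"
        unfolding n using N by (simp add: field_simps)
    next
      assume "triangulation V E \<and> k_connected 4 V E"
      then have T: "triangulation V E" and k: "k_connected 4 V E" by simp_all
      \<comment> \<open>\<open>D = 21 + 1 - 4 = 18\<close>; the last term becomes
        \<open>81 / (4 * (n - 1))\<close>, so the claim has some room.\<close>
      have "proximity V E \<le> (N + 2 * 18) / (4 * real 4) + 18\<^sup>2 / (4 * real 4 * N)"
        unfolding N_def
      proof (rule conn_graph.proximity_triangulation [OF graph [OF k] T k V, of "[7, 4, 4, 4, 2]"])
        fix m t j :: nat assume "4 \<le> m" "m < 2 * 4" "t = m div 2 + 1" "1 \<le> j" "j < t \<or> (m \<noteq> 4 \<and> j = t)"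
        moreover from this have "m = 4 \<or> m = 5 \<or> m = 6 \<or> m = 7" "j = 1 \<or> j = 2 \<or> j = 3 \<or> j = 4" by linarith+
        ultimately show "2 * int 4 - int m \<le> deficit [7, 4, 4, 4, 2] j"
          by (elim disjE) (simp_all add: deficit_def)
      qed simp_all
      then show "proximity V E \<le> (real n + 35) / 16 + 91 / (4 * (real n - 1))"
        unfolding n using N by (simp add: field_simps)
    next
      assume "triangulation V E \<and> k_connected 5 V E"
      then have T: "triangulation V E" and k: "k_connected 5 V E" by simp_all
      \<comment> \<open>\<open>D = 30 + 1 - 5 = 26\<close>, which gives
        \<open>(n + 51) / 20 + 169 / (5 * (n - 1))\<close>, slightly below the claim.\<close>
      have "proximity V E \<le> (N + 2 * 26) / (4 * real 5) + 26\<^sup>2 / (4 * real 5 * N)"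
        unfolding N_def
      proof (rule conn_graph.proximity_triangulation [OF graph [OF k] T k V, of "[9, 5, 5, 5, 4, 2]"])
        fix m t j :: nat assume "5 \<le> m" "m < 2 * 5" "t = m div 2 + 1" "1 \<le> j" "j < t \<or> (m \<noteq> 5 \<and> j = t)"
        moreover from this have "m = 5 \<or> m = 6 \<or> m = 7 \<or> m = 8 \<or> m = 9" "j = 1 \<or> j = 2 \<or> j = 3 \<or> j = 4 \<or> j = 5"
          by linarith+
        ultimately show "2 * int 5 - int m \<le> deficit [9, 5, 5, 5, 4, 2] j"
          by (elim disjE) (simp_all add: deficit_def)
      qed simp_all
      then show "proximity V E \<le> (real n + 57) / 20 + 393 / (10 * (real n - 1))"
        unfolding n using N by (simp add: field_simps)
    next
      assume Q: "quadrangulation V E"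
      show "proximity V E \<le> (real n + 11) / 8 + 9 / (2 * (real n - 1))"
      proof (cases "star V E")
        case True
        interpret conn_graph V E using G quadrangulation_connected [OF Q] by unfold_locales
        have "proximity V E \<le> 1" by (rule proximity_star [OF True V])
        also have "1 \<le> (real n + 11) / 8 + 9 / (2 * (real n - 1))" unfolding n using N by (simp add: field_simps)
        finally show ?thesis .
      next
        case False
        then have k: "k_connected 2 V E" using quadrangulation_2_connected_or_star [OF Q] by simp
        \<comment> \<open>Layers of 2 and of 3 vertices both have \<open>t = 3\<close>. The entry 2
          required by the former leaves the latter the spare unit used in merging.
          \<open>D = 7 + 1 - 2 = 6\<close>.\<close>
        have "proximity V E \<le> (N + 2 * 6) / (4 * real 2) + 6\<^sup>2 / (4 * real 2 * N)"
          unfolding N_def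
        proof (rule conn_graph.proximity_quadrangulation [OF graph [OF k] Q k V, of "[3, 2, 2]"])
          fix m t j :: nat assume "2 \<le> m" "m < 2 * 2" "t = 2 * (m div 2) + 1" "1 \<le> j" "j < t"
          moreover from this have "m = 2 \<or> m = 3" "j = 1 \<or> j = 2" by presburger+
          ultimately show "2 * int 2 - int m \<le> deficit [3, 2, 2] j"
            by (elim disjE) (simp_all add: deficit_def)
        qed (simp_all add: deficit_def)
        then show ?thesis unfolding n using N by (simp add: field_simps)
      qed
    next
      assume "quadrangulation V E \<and> k_connected 3 V E"
      then have Q: "quadrangulation V E" and k: "k_connected 3 V E" by simp_all
      \<comment> \<open>\<open>t\<close> is 3 for layers of 3 vertices and 5 for layers of 4 or 5.
        \<open>D = 15 + 1 - 3 = 13\<close>.\<close>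
      have "proximity V E \<le> (N + 2 * 13) / (4 * real 3) + 13\<^sup>2 / (4 * real 3 * N)"
        unfolding N_def
      proof (rule conn_graph.proximity_quadrangulation [OF graph [OF k] Q k V, of "[5, 3, 3, 2, 2]"])
        fix m t j :: nat assume "3 \<le> m" "m < 2 * 3" "t = 2 * (m div 2) + 1" "1 \<le> j" "j < t"
        moreover from this have "m = 3 \<or> m = 4 \<or> m = 5" "j = 1 \<or> j = 2 \<or> j = 3 \<or> j = 4" by presburger+
        ultimately show "2 * int 3 - int m \<le> deficit [5, 3, 3, 2, 2] j"
          by (elim disjE) (simp_all add: deficit_def)
      qed (simp_all add: deficit_def)
      then show "proximity V E \<le> (real n + 25) / 12 + 169 / (12 * (real n - 1))"
        unfolding n using N by (simp add: field_simps)
    qed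
  qed
qed

end
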